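(* There exists a bounded divergence-free (autonomous) vector field $b:\mathbb{R}^2\to\mathbb{R}^2$ such that $b\in W^{1,p}_{\mathrm{loc}}(\mathbb{R}^2;\mathbb{R}^2)$ for every $p\in[1,\infty)$, $b(z)\cdot e_1>0$ for $\mathscr{L}^2$-a.e. $z\in\mathbb{R}^2$ (where $e_1=(1,0)$), and for every time $t>0$ the regular Lagrangian flow $X$ of $b$ satisfies $$X(t,\cdot)\notin\mathrm{BV}_{\mathrm{loc}}(\mathbb{R}^2;\mathbb{R}^2).$$
   Context: Regular Lagrangian flow: given $b\in L^1_{\mathrm{loc}}((0,T)\times\mathbb{R}^d;\mathbb{R}^d)$, a map $X:[0,T)\times\mathbb{R}^d\to\mathbb{R}^d$ is a regular Lagrangian flow of $b$ if (1) for $\mathscr{L}^d$-a.e. $x$ the map $t\mapsto X(t,x)$ is absolutely continuous, $X(0,x)=x$, and $\partial_tX(t,x)=b(t,X(t,x))$ for $\mathscr{L}^1$-a.e. $t\in(0,T)$; (2) there is $L>0$ such that $X(t,\cdot)_\sharp\mathscr{L}^d\le L\,\mathscr{L}^d$ for every $t\in[0,T)$. An autonomous field is regarded as constant in time; for bounded divergence-free $b\in W^{1,p}_{\mathrm{loc}}$ the regular Lagrangian flow exists, is unique up to $\mathscr{L}^d$-null sets, and is defined for all $t\ge0$ (known result). *)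

theory Defs
  imports "HOL-Analysis.Analysis"
begin

definition locally_integrable_on ::
    "'a::euclidean_space set \<Rightarrow> ('a \<Rightarrow> 'b::euclidean_space) \<Rightarrow> bool" where
  "locally_integrable_on U f \<longleftrightarrow>
     (\<forall>K. compact K \<and> K \<subseteq> U \<longrightarrow> set_integrable lebesgue K f)"

abbreviation partial_deriv :: "'a::euclidean_space \<Rightarrow> ('a \<Rightarrow> real) \<Rightarrow> 'a \<Rightarrow> real" where
  "partial_deriv i \<phi> x \<equiv> frechet_derivative \<phi> (at x) i"

primrec Ck :: "nat \<Rightarrow> ('a::euclidean_space \<Rightarrow> real) \<Rightarrow> bool" where
  "Ck 0 \<phi> \<longleftrightarrow> continuous_on UNIV \<phi>"
| "Ck (Suc k) \<phi> \<longleftrightarrow>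
     \<phi> differentiable_on UNIV \<and> (\<forall>i\<in>Basis. Ck k (partial_deriv i \<phi>))"

definition test_functions :: "('a::euclidean_space \<Rightarrow> real) set" where
  "test_functions = {\<phi>. (\<forall>k. Ck k \<phi>) \<and> compact (closure {x. \<phi> x \<noteq> 0})}"

definition divergence_free :: "('a::euclidean_space \<Rightarrow> 'a) \<Rightarrow> bool" where
  "divergence_free b \<longleftrightarrow>
     locally_integrable_on UNIV b \<and>
     (\<forall>\<phi>\<in>test_functions.
        (\<integral>x. (\<Sum>i\<in>Basis. (b x \<bullet> i) * partial_deriv i \<phi> x) \<partial>lebesgue) = 0)"

definition has_weak_partial_deriv ::
    "'a::euclidean_space \<Rightarrow> ('a \<Rightarrow> 'b::euclidean_space) \<Rightarrow> ('a \<Rightarrow> 'b) \<Rightarrow> bool" where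
  "has_weak_partial_deriv i f g \<longleftrightarrow>
     locally_integrable_on UNIV f \<and> locally_integrable_on UNIV g \<and>
     (\<forall>\<phi>\<in>test_functions.
        (\<integral>x. partial_deriv i \<phi> x *\<^sub>R f x \<partial>lebesgue) = - (\<integral>x. \<phi> x *\<^sub>R g x \<partial>lebesgue))"

definition Lp_loc :: "real \<Rightarrow> ('a::euclidean_space \<Rightarrow> 'b::euclidean_space) set" where
  "Lp_loc p = {f. f \<in> borel_measurable lebesgue \<and>
     (\<forall>K. compact K \<longrightarrow> set_integrable lebesgue K (\<lambda>x. norm (f x) powr p))}"

definition W1p_loc :: "real \<Rightarrow> ('a::euclidean_space \<Rightarrow> 'b::euclidean_space) set" where
  "W1p_loc p = {f. f \<in> Lp_loc p \<and>
     (\<forall>i\<in>Basis. \<exists>g. g \<in> Lp_loc p \<and> has_weak_partial_deriv i f g)}"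

definition radon_measure :: "'a::euclidean_space measure \<Rightarrow> bool" where
  "radon_measure \<mu> \<longleftrightarrow>
     sets \<mu> = sets borel \<and> (\<forall>K. compact K \<longrightarrow> emeasure \<mu> K < \<infinity>)"

text \<open>
  The distributional derivative of a function in \<open>BV_loc\<close> is a matrix of signed Radon measures.
  A signed Radon measure may take both values \<open>\<infinity>\<close> and \<open>-\<infinity>\<close> on unbounded sets, so each entry
  is given as a difference of two positive Radon measures \<open>\<mu>\<close> and \<open>\<nu>\<close> (Jordan decomposition).
\<close>

definition BV_loc :: "('a::euclidean_space \<Rightarrow> 'b::euclidean_space) set" where
  "BV_loc = {f. locally_integrable_on UNIV f \<and>
     (\<forall>i\<in>Basis. \<forall>j\<in>Basis. \<exists>\<mu> \<nu>. radon_measure \<mu> \<and> radon_measure \<nu> \<and>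
        (\<forall>\<phi>\<in>test_functions.
           (\<integral>x. (f x \<bullet> j) * partial_deriv i \<phi> x \<partial>lebesgue)
             = - ((\<integral>x. \<phi> x \<partial>\<mu>) - (\<integral>x. \<phi> x \<partial>\<nu>))))}"

definition abs_continuous_on :: "real set \<Rightarrow> (real \<Rightarrow> 'b::real_normed_vector) \<Rightarrow> bool" where
  "abs_continuous_on I f \<longleftrightarrow>
     (\<forall>\<epsilon>>0. \<exists>\<delta>>0. \<forall>(n::nat) u v.
        (\<forall>k<n. u k \<le> v k \<and> {u k..v k} \<subseteq> I) \<and>
        disjoint_family_on (\<lambda>k. {u k<..<v k}) {..<n} \<and>
        (\<Sum>k<n. v k - u k) < \<delta>
        \<longrightarrow> (\<Sum>k<n. norm (f (v k) - f (u k))) < \<epsilon>)"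

text \<open>
  The flow is considered on the time interval \<open>[0,T)\<close>, where \<open>T = \<infinity>\<close> is allowed; the values
  \<open>X t x\<close> and \<open>b t x\<close> for other times \<open>t\<close> play no role.
\<close>

definition regular_lagrangian_flow ::
    "ereal \<Rightarrow> (real \<Rightarrow> 'a::euclidean_space \<Rightarrow> 'a) \<Rightarrow> (real \<Rightarrow> 'a \<Rightarrow> 'a) \<Rightarrow> bool" where
  "regular_lagrangian_flow T b X \<longleftrightarrow>
     locally_integrable_on ({t. 0 < t \<and> ereal t < T} \<times> UNIV) (\<lambda>(t, x). b t x) \<and>
     (AE x in lebesgue.
        abs_continuous_on {t. 0 \<le> t \<and> ereal t < T} (\<lambda>t. X t x) \<and>
        X 0 x = x \<and>
        (AE t in lebesgue. 0 < t \<and> ereal t < T \<longrightarrow>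
           ((\<lambda>s. X s x) has_vector_derivative b t (X t x)) (at t))) \<and>
     (\<exists>L>0. \<forall>t. 0 \<le> t \<and> ereal t < T \<longrightarrow>
        X t \<in> borel_measurable lebesgue \<and>
        (\<forall>A\<in>sets borel.
           emeasure (distr lebesgue borel (X t)) A \<le> ennreal L * emeasure lborel A))"

end

theory Submission
  imports Defs
begin

text \<open>
  The field is the perpendicular gradient of \<open>stream\<close>, so it is divergence free and its flow preserves
  the level lines of \<open>stream\<close>, which are graphs over the first axis. Its first component
  \<open>kappa (x\<^sup>2 + y\<^sup>2) * (x\<^sup>2 + y\<^sup>2 cos\<^sup>2 (vlog (y\<^sup>2) / 5))\<close> vanishes only at the origin and at points \<open>(0, a)\<close>
  which accumulate at the origin. On the level lines that cross the second axis near the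
  maxima of the oscillating factor, it is of order \<open>r (log r)\<^sup>2\<close> at distance \<open>r\<close> from the origin. This is
  the borderline that makes everything work: the gradient is of order \<open>(log r)\<^sup>2\<close> and hence in every
  \<open>L\<^sup>p\<close>, whereas \<open>1 / (r (log r)\<^sup>2)\<close> is integrable at \<open>0\<close>, so that these lines, however close to the
  origin, are crossed in a uniformly short time. On the lines near a stagnation point the crossing time
  tends to infinity. Since both kinds of lines alternate infinitely often, the first component of
  \<open>X t\<close> oscillates by a fixed amount infinitely often on each vertical segment slightly to the left of the
  second axis, which is incompatible with a distributional derivative of locally finite mass.

  The field is continuous and bounded, so the trajectories of every regular Lagrangian flow are
  classical, and the argument applies to all of them. Existence is obtained by parametrising each level line by
  travel time.
\<close>

section \<open>Fubini and weak derivatives in the plane\<close>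

text \<open>The contradiction comes from counting. From a stuck level up to the next fast one, the
  first component of \<open>X t\<close> rises from at most 0 to at least
  \<open>4 * \<delta>\<close>, and each such rise costs the positive part of its vertical derivative
  a fixed mass per unit of width. For every \<open>n\<close>, \<open>n\<close> disjoint pairs of
  levels cost \<open>n\<close> times as much, all above the same interval from
  \<open>- 3 * \<delta>\<close> to \<open>- 2 * \<delta>\<close> and below a fixed height. The
  obstacle is that the neighbourhoods of the levels in which the crossing estimates hold shrink with
  the pair and are not rectangles. The mass is therefore estimated on thin strips around each
  abscissa, and bisection extends the estimate to the whole interval.

  The oscillation is one in \<open>ln y\<close> near the origin: a phase with derivative of order
  \<open>1 / y\<close> produces infinitely many zeros, while the product of \<open>y\<^sup>2\<close>
  and the squared cosine still has a derivative of order \<open>y\<close>, like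
  \<open>y\<^sup>2\<close> itself. Stagnation points thus come at no cost for the integrability of
  the gradient.\<close>

definition vec2 :: "real \<Rightarrow> real \<Rightarrow> real^2" where
  "vec2 x y = (\<chi> i. if i = 1 then x else y)"

lemma vec2_nth [simp]: "vec2 x y $ 1 = x" "vec2 x y $ 2 = y"
  by (simp_all add: vec2_def)

lemma vec2_eta [simp]: "vec2 (z $ 1) (z $ 2) = z"
  by (simp add: vec_eq_iff forall_2)

lemma Basis_real2: "(Basis :: (real^2) set) = {axis 1 1, axis 2 1}"
  unfolding Basis_vec_def by (auto simp: UNIV_2)

lemma axis_real2_neq: "axis 1 1 \<noteq> (axis 2 1 :: real^2)"
  by (simp add: axis_eq_axis)

lemma inner_axis2 [simp]: "z \<bullet> axis 1 1 = z $ 1" "z \<bullet> axis 2 1 = z $ 2" for z :: "real^2"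
  by (simp_all add: inner_axis)

lemma continuous_vec2 [continuous_intros]:
  assumes "continuous_on S f" "continuous_on S g"
  shows "continuous_on S (\<lambda>x. vec2 (f x) (g x))"
  unfolding vec2_def
proof (rule continuous_on_vec_lambda)
  fix i :: 2 show "continuous_on S (\<lambda>x. if i = 1 then f x else g x)"
    using assms by (cases "i = 1") auto
qed

lemma vec2_eq_add: "vec2 x y = x *\<^sub>R axis 1 1 + y *\<^sub>R axis 2 1"
  by (simp add: vec_eq_iff forall_2 axis_def)

lemma measurable_vec2 [measurable]:
  assumes [measurable]: "f \<in> borel_measurable M" "g \<in> borel_measurable M"
  shows "(\<lambda>x. vec2 (f x) (g x)) \<in> borel_measurable M"
  unfolding vec2_eq_add by measurable

lemma measurable_nth_real2 [measurable]: "(\<lambda>z::real^2. z $ i) \<in> borel_measurable borel"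
  by (intro borel_measurable_continuous_onI continuous_intros)

lemma norm_vec2_le: "norm z \<le> \<bar>z $ 1\<bar> + \<bar>z $ 2\<bar>" for z :: "real^2"
  using norm_le_l1_cart[of z] by (simp add: sum_2)

text \<open>Transports Fubini from the product measure to \<open>real^2\<close>. Lebesgue measure is
  determined by its values on boxes, and a box pulls back to a product of two intervals.\<close>

lemma lborel_real2: "lborel = distr (lborel \<Otimes>\<^sub>M lborel) borel (\<lambda>(x, y). vec2 x y)"
proof (rule lborel_eqI)
  have m: "(\<lambda>(x, y). vec2 x y) \<in> borel_measurable (lborel \<Otimes>\<^sub>M lborel)"
    unfolding case_prod_unfold by (intro measurable_vec2) auto
  fix l u :: "real^2" assume lu: "\<And>b. b \<in> Basis \<Longrightarrow> l \<bullet> b \<le> u \<bullet> b"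
  have le: "l $ 1 \<le> u $ 1" "l $ 2 \<le> u $ 2"
    using lu[of "axis 1 1"] lu[of "axis 2 1"] by (auto simp: Basis_real2)
  have "(\<lambda>(x, y). vec2 x y) -` box l u \<inter> space (lborel \<Otimes>\<^sub>M lborel)
      = {l $ 1<..<u $ 1} \<times> {l $ 2<..<u $ 2}"
    by (auto simp: mem_box_cart forall_2 space_pair_measure)
  then have "emeasure (distr (lborel \<Otimes>\<^sub>M lborel) borel (\<lambda>(x, y). vec2 x y)) (box l u)
     = emeasure (lborel \<Otimes>\<^sub>M lborel) ({l $ 1<..<u $ 1} \<times> {l $ 2<..<u $ 2})"
    by (subst emeasure_distr[OF m]) auto
  also have "\<dots> = ennreal (u $ 1 - l $ 1) * ennreal (u $ 2 - l $ 2)"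
    using le by (subst lborel.emeasure_pair_measure_Times) auto
  also have "\<dots> = ennreal (prod ((\<bullet>) (u - l)) Basis)"
    using le by (simp add: Basis_real2 axis_real2_neq ennreal_mult)
  finally show "emeasure (distr (lborel \<Otimes>\<^sub>M lborel) borel (\<lambda>(x, y). vec2 x y)) (box l u)
    = ennreal (prod ((\<bullet>) (u - l)) Basis)" .
qed simp

lemma measurable_vec2_pair: "(\<lambda>(x, y). vec2 x y) \<in> borel_measurable (lborel \<Otimes>\<^sub>M lborel)"
  unfolding case_prod_unfold by (intro measurable_vec2) auto

lemma nn_integral_real2:
  assumes [measurable]: "f \<in> borel_measurable borel"
  shows "(\<integral>\<^sup>+z. f z \<partial>lborel) = (\<integral>\<^sup>+x. \<integral>\<^sup>+y. f (vec2 x y) \<partial>lborel \<partial>lborel)"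
proof -
  have "(\<integral>\<^sup>+z. f z \<partial>lborel) = (\<integral>\<^sup>+z. f (case z of (x, y) \<Rightarrow> vec2 x y) \<partial>(lborel \<Otimes>\<^sub>M lborel))"
    by (subst lborel_real2, subst nn_integral_distr[OF measurable_vec2_pair]) auto
  also have "\<dots> = (\<integral>\<^sup>+x. \<integral>\<^sup>+y. f (vec2 x y) \<partial>lborel \<partial>lborel)"
    by (subst lborel.nn_integral_fst[symmetric]) (use measurable_vec2_pair in \<open>auto\<close>)
  finally show ?thesis .
qed

lemma integrable_real2:
  fixes f :: "real^2 \<Rightarrow> real"
  assumes "integrable lborel f"
  shows "integrable (lborel \<Otimes>\<^sub>M lborel) (\<lambda>(x, y). f (vec2 x y))"
proof -
  have "integrable (distr (lborel \<Otimes>\<^sub>M lborel) borel (\<lambda>(x, y). vec2 x y)) f"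
    using assms by (subst (asm) lborel_real2)
  then show ?thesis
    using integrable_distr[OF measurable_vec2_pair] by (simp add: case_prod_unfold)
qed

lemma integral_real2:
  fixes f :: "real^2 \<Rightarrow> real"
  assumes "integrable lborel f"
  shows "(\<integral>z. f z \<partial>lborel) = (\<integral>x. \<integral>y. f (vec2 x y) \<partial>lborel \<partial>lborel)"
    "(\<integral>z. f z \<partial>lborel) = (\<integral>y. \<integral>x. f (vec2 x y) \<partial>lborel \<partial>lborel)"
proof -
  have "(\<integral>z. f z \<partial>lborel) = (\<integral>z. f (case z of (x, y) \<Rightarrow> vec2 x y) \<partial>(lborel \<Otimes>\<^sub>M lborel))"
    by (subst lborel_real2, subst integral_distr[OF measurable_vec2_pair]) (use assms in auto)
  then have *: "(\<integral>z. f z \<partial>lborel) = integral\<^sup>L (lborel \<Otimes>\<^sub>M lborel) (\<lambda>(x, y). f (vec2 x y))"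
    by (simp add: case_prod_unfold)
  show "(\<integral>z. f z \<partial>lborel) = (\<integral>x. \<integral>y. f (vec2 x y) \<partial>lborel \<partial>lborel)"
    unfolding * using lborel_pair.integral_fst[OF integrable_real2[OF assms]] by simp
  show "(\<integral>z. f z \<partial>lborel) = (\<integral>y. \<integral>x. f (vec2 x y) \<partial>lborel \<partial>lborel)"
    unfolding * using lborel_pair.integral_snd[OF integrable_real2[OF assms]] by simp
qed

lemma AE_integrable_slices:
  fixes f :: "real^2 \<Rightarrow> real"
  assumes "integrable lborel f"
  shows "AE x in lborel. integrable lborel (\<lambda>y. f (vec2 x y))"
    "AE y in lborel. integrable lborel (\<lambda>x. f (vec2 x y))"
  using lborel_pair.AE_integrable_fst[OF integrable_real2[OF assms]]
    lborel_pair.AE_integrable_snd[OF integrable_real2[OF assms]] by simp_all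

lemma AE_real2I:
  assumes m: "{z. \<not> P z} \<in> sets borel"
    and "AE x in lborel. AE y in lborel. P (vec2 x y)"
  shows "AE z in (lborel :: (real^2) measure). P z"
proof -
  have [measurable]: "indicator {z. \<not> P z} \<in> borel_measurable borel" using m by simp
  have "emeasure lborel {z. \<not> P z} = (\<integral>\<^sup>+z. indicator {z. \<not> P z} z \<partial>lborel)"
    using m by simp
  also have "\<dots> = (\<integral>\<^sup>+x. \<integral>\<^sup>+y. indicator {z. \<not> P z} (vec2 x y) \<partial>lborel \<partial>lborel)"
    by (rule nn_integral_real2) simp
  also have "\<dots> = (\<integral>\<^sup>+x. 0 \<partial>(lborel :: real measure))"
  proof (rule nn_integral_cong_AE)
    show "AE x in lborel. (\<integral>\<^sup>+y. indicator {z. \<not> P z} (vec2 x y) \<partial>lborel) = 0"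
      using assms(2)
    proof eventually_elim
      case (elim x)
      then have "(\<integral>\<^sup>+y. indicator {z. \<not> P z} (vec2 x y) \<partial>lborel) = (\<integral>\<^sup>+y. 0 \<partial>(lborel :: real measure))"
        by (intro nn_integral_cong_AE) (auto elim: eventually_mono)
      then show ?case by simp
    qed
  qed
  finally have "emeasure lborel {z. \<not> P z} = 0" by simp
  then show ?thesis using m by (intro AE_I[where N="{z. \<not> P z}"]) auto
qed

text \<open>A slice must have integral zero only if it is integrable, since integrability is known
  for almost every slice but for no particular one. The disjunction covers slicing along either
  axis, as the two partial derivatives need.\<close>

lemma integral_zero_real2:
  fixes w :: "real^2 \<Rightarrow> real"
  assumes "integrable lborel w"
    and "(AE x in lborel. integrable lborel (\<lambda>y. w (vec2 x y)) \<longrightarrow> (\<integral>y. w (vec2 x y) \<partial>lborel) = 0) \<or>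
         (AE y in lborel. integrable lborel (\<lambda>x. w (vec2 x y)) \<longrightarrow> (\<integral>x. w (vec2 x y) \<partial>lborel) = 0)"
  shows "(\<integral>z. w z \<partial>lborel) = 0"
  using assms(2)
proof
  assume "AE x in lborel. integrable lborel (\<lambda>y. w (vec2 x y)) \<longrightarrow> (\<integral>y. w (vec2 x y) \<partial>lborel) = 0"
  with AE_integrable_slices(1)[OF assms(1)] have "AE x in lborel. (\<integral>y. w (vec2 x y) \<partial>lborel) = 0"
    by eventually_elim auto
  then show ?thesis unfolding integral_real2(1)[OF assms(1)] by (rule integral_eq_zero_AE)
next
  assume "AE y in lborel. integrable lborel (\<lambda>x. w (vec2 x y)) \<longrightarrow> (\<integral>x. w (vec2 x y) \<partial>lborel) = 0"
  with AE_integrable_slices(2)[OF assms(1)] have "AE y in lborel. (\<integral>x. w (vec2 x y) \<partial>lborel) = 0"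
    by eventually_elim auto
  then show ?thesis unfolding integral_real2(2)[OF assms(1)] by (rule integral_eq_zero_AE)
qed

text \<open>The finite set \<open>S\<close> absorbs the singular point at which a line meets an
  axis; there \<open>F\<close> is only continuous.\<close>

lemma integral_derivative_zero:
  fixes F w :: "real \<Rightarrow> real"
  assumes "integrable lborel w" "finite S" "M \<ge> 0"
    and "continuous_on {-M..M} F" "F (-M) = 0" "F M = 0"
    and "\<And>x. x \<in> {-M<..<M} - S \<Longrightarrow> (F has_real_derivative w x) (at x)"
    and "\<And>x. x \<notin> {-M..M} \<Longrightarrow> w x = 0"
  shows "(\<integral>x. w x \<partial>lborel) = 0"
proof -
  have "(w has_integral F M - F (-M)) {-M..M}"
    using assms by (intro fundamental_theorem_of_calculus_interior_strong[of S])
      (auto simp: has_real_derivative_iff_has_vector_derivative[symmetric])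
  then have "(w has_integral 0) UNIV"
    unfolding assms(5,6) diff_zero by (rule has_integral_on_superset) (use assms(8) in auto)
  moreover have "(w has_integral (\<integral>x. w x \<partial>lborel)) UNIV"
    using has_integral_integral_lborel[OF assms(1)] by simp
  ultimately show ?thesis by (rule has_integral_unique[symmetric])
qed

lemma test_functionD:
  fixes \<phi> :: "real^2 \<Rightarrow> real"
  assumes "\<phi> \<in> test_functions"
  shows "continuous_on UNIV \<phi>" "i \<in> Basis \<Longrightarrow> continuous_on UNIV (partial_deriv i \<phi>)"
    "\<And>z. \<phi> differentiable (at z)"
    "\<exists>M>0. \<forall>z. M \<le> \<bar>z $ 1\<bar> \<or> M \<le> \<bar>z $ 2\<bar> \<longrightarrow> \<phi> z = 0 \<and> (\<forall>i. partial_deriv i \<phi> z = 0)"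
proof -
  have C: "Ck k \<phi>" for k using assms by (simp add: test_functions_def)
  show "continuous_on UNIV \<phi>" using C[of 0] by simp
  have 1: "\<phi> differentiable_on UNIV" "\<forall>i\<in>Basis. continuous_on UNIV (partial_deriv i \<phi>)"
    using C[of "Suc 0"] by simp_all
  then show "i \<in> Basis \<Longrightarrow> continuous_on UNIV (partial_deriv i \<phi>)" by blast
  show "\<And>z. \<phi> differentiable (at z)" using 1(1) by (simp add: differentiable_on_def)
  have "bounded (closure {x. \<phi> x \<noteq> 0})"
    using assms by (intro compact_imp_bounded) (simp add: test_functions_def)
  then obtain B where B: "B > 0" "\<And>z. z \<in> closure {x. \<phi> x \<noteq> 0} \<Longrightarrow> norm z \<le> B"
    by (auto simp: bounded_pos)
  have "\<phi> z = 0 \<and> (\<forall>i. partial_deriv i \<phi> z = 0)" if "B + 1 \<le> \<bar>z $ 1\<bar> \<or> B + 1 \<le> \<bar>z $ 2\<bar>" for z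
  proof -
    have "norm z > B" using that component_le_norm_cart[of z 1] component_le_norm_cart[of z 2] by linarith
    then have z: "z \<in> - closure {x. \<phi> x \<noteq> 0}" using B by fastforce
    have o: "open (- closure {x. \<phi> x \<noteq> 0})" by (rule open_Compl) (rule closed_closure)
    have 0: "\<phi> w = 0" if "w \<in> - closure {x. \<phi> x \<noteq> 0}" for w
      using that closure_subset[of "{x. \<phi> x \<noteq> 0}"] by blast
    have "(\<phi> has_derivative (\<lambda>_. 0)) (at z)"
      by (rule has_derivative_transform_within_open[OF has_derivative_const[of 0 "at z"] o z])
        (rule 0[symmetric])
    then have "frechet_derivative \<phi> (at z) = (\<lambda>_. 0)" by (rule frechet_derivative_at[symmetric])
    then show ?thesis using 0[OF z] by simp
  qed
  then show "\<exists>M>0. \<forall>z. M \<le> \<bar>z $ 1\<bar> \<or> M \<le> \<bar>z $ 2\<bar> \<longrightarrow> \<phi> z = 0 \<and> (\<forall>i. partial_deriv i \<phi> z = 0)"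
    using B(1) by (intro exI[of _ "B + 1"]) auto
qed

lemma partial_deriv_line:
  fixes \<phi> :: "real^2 \<Rightarrow> real"
  assumes "\<phi> differentiable (at (vec2 x y))"
  shows "((\<lambda>x. \<phi> (vec2 x y)) has_real_derivative partial_deriv (axis 1 1) \<phi> (vec2 x y)) (at x)"
    "((\<lambda>y. \<phi> (vec2 x y)) has_real_derivative partial_deriv (axis 2 1) \<phi> (vec2 x y)) (at y)"
proof -
  have d: "(\<phi> has_derivative frechet_derivative \<phi> (at (vec2 x y))) (at (vec2 x y))"
    using assms frechet_derivative_works by blast
  then interpret bounded_linear "frechet_derivative \<phi> (at (vec2 x y))"
    by (rule has_derivative_bounded_linear)
  have "((\<lambda>x. vec2 x y) has_derivative (\<lambda>h. h *\<^sub>R axis 1 1)) (at x)"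
    unfolding vec2_eq_add by (auto intro!: derivative_eq_intros)
  from has_derivative_compose[OF this d]
  show "((\<lambda>x. \<phi> (vec2 x y)) has_real_derivative partial_deriv (axis 1 1) \<phi> (vec2 x y)) (at x)"
    by (simp add: has_field_derivative_def scaleR mult_commute_abs)
  have "((\<lambda>y. vec2 x y) has_derivative (\<lambda>h. h *\<^sub>R axis 2 1)) (at y)"
    unfolding vec2_eq_add by (auto intro!: derivative_eq_intros)
  from has_derivative_compose[OF this d]
  show "((\<lambda>y. \<phi> (vec2 x y)) has_real_derivative partial_deriv (axis 2 1) \<phi> (vec2 x y)) (at y)"
    by (simp add: has_field_derivative_def scaleR mult_commute_abs)
qed

text \<open>Dominates \<open>w\<close> by a function of the first coordinate alone, so that the
  integral over the box factors. The exponent -1/2 stands for any exponent above -1.\<close>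

lemma singular_integrable:
  fixes w :: "real^2 \<Rightarrow> real"
  assumes [measurable]: "w \<in> borel_measurable borel" and "M > 0"
    and b: "\<And>z. \<bar>z $ 1\<bar> \<le> M \<Longrightarrow> \<bar>z $ 2\<bar> \<le> M \<Longrightarrow> z $ 1 \<noteq> 0 \<Longrightarrow> \<bar>w z\<bar> \<le> C * \<bar>z $ 1\<bar> powr (- 1 / 2)"
  shows "set_integrable lborel {z. \<bar>z $ 1\<bar> \<le> M \<and> \<bar>z $ 2\<bar> \<le> M} w"
proof -
  let ?K = "{z::real^2. \<bar>z $ 1\<bar> \<le> M \<and> \<bar>z $ 2\<bar> \<le> M}"
  define h where "h x = indicator {-M..M} x * \<bar>x\<bar> powr (- 1 / 2)" for x :: real
  have hm[measurable]: "h \<in> borel_measurable borel" unfolding h_def by measurable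
  have C: "C \<ge> 0"
  proof -
    have "0 \<le> C * \<bar>M\<bar> powr (- 1 / 2)" using b[of "vec2 M 0"] assms(2) by simp
    then show ?thesis using assms(2) by (simp add: zero_le_mult_iff)
  qed
  have fin: "(\<integral>\<^sup>+x. ennreal (h x) \<partial>lborel) < \<infinity>"
  proof -
    have i: "((\<lambda>x. x powr (- 1 / 2)) has_integral (M powr (- 1 / 2 + 1) / (- 1 / 2 + 1))) {0..M}"
      using assms(2) by (intro has_integral_powr_from_0) auto
    have i1: "((\<lambda>x. \<bar>x\<bar> powr (- 1 / 2)) has_integral (M powr (- 1 / 2 + 1) / (- 1 / 2 + 1))) {0..M}"
      by (rule has_integral_eq[OF _ i]) auto
    have "((\<lambda>x. \<bar>- x\<bar> powr (- 1 / 2)) has_integral (M powr (- 1 / 2 + 1) / (- 1 / 2 + 1))) {- M..- 0}"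
      using i1 by (subst has_integral_reflect_real) simp_all
    then have i2: "((\<lambda>x. \<bar>x\<bar> powr (- 1 / 2)) has_integral (M powr (- 1 / 2 + 1) / (- 1 / 2 + 1))) {- M..0}"
      by simp
    have "((\<lambda>x. \<bar>x\<bar> powr (- 1 / 2)) has_integral
       (M powr (- 1 / 2 + 1) / (- 1 / 2 + 1) + M powr (- 1 / 2 + 1) / (- 1 / 2 + 1))) {- M..M}"
      using assms(2) by (intro has_integral_combine[OF _ _ i2 i1]) auto
    then have "(\<integral>\<^sup>+x. ennreal (\<bar>x\<bar> powr (- 1 / 2)) * indicator {-M..M} x \<partial>lborel) =
       ennreal (M powr (- 1 / 2 + 1) / (- 1 / 2 + 1) + M powr (- 1 / 2 + 1) / (- 1 / 2 + 1))"
      by (rule nn_integral_has_integral_lebesgue'[rotated]) simp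
    moreover have "(\<integral>\<^sup>+x. ennreal (h x) \<partial>lborel)
        = (\<integral>\<^sup>+x. ennreal (\<bar>x\<bar> powr (- 1 / 2)) * indicator {-M..M} x \<partial>lborel)"
      by (rule nn_integral_cong) (simp add: h_def indicator_def)
    ultimately show ?thesis by simp
  qed
  have [measurable]: "?K \<in> sets borel" by measurable
  have "(\<integral>\<^sup>+z. ennreal (norm (indicator ?K z *\<^sub>R w z)) \<partial>lborel)
      = (\<integral>\<^sup>+x. \<integral>\<^sup>+y. ennreal (norm (indicator ?K (vec2 x y) *\<^sub>R w (vec2 x y))) \<partial>lborel \<partial>lborel)"
    by (rule nn_integral_real2) measurable
  also have "\<dots> \<le> (\<integral>\<^sup>+x. \<integral>\<^sup>+y. ennreal (C * h x) * indicator {-M..M} y \<partial>lborel \<partial>lborel)"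
  proof (rule nn_integral_mono_AE)
    show "AE x in lborel. (\<integral>\<^sup>+y. ennreal (norm (indicator ?K (vec2 x y) *\<^sub>R w (vec2 x y))) \<partial>lborel)
       \<le> (\<integral>\<^sup>+y. ennreal (C * h x) * indicator {-M..M} y \<partial>lborel)"
      using AE_lborel_singleton[of 0]
    proof eventually_elim
      case (elim x)
      show ?case
      proof (rule nn_integral_mono)
        fix y :: real
        show "ennreal (norm (indicator ?K (vec2 x y) *\<^sub>R w (vec2 x y))) \<le> ennreal (C * h x) * indicator {-M..M} y"
          using b[of "vec2 x y"] elim by (auto simp: indicator_def h_def abs_le_iff)
      qed
    qed
  qed
  also have "\<dots> = (\<integral>\<^sup>+x. ennreal (h x) * (ennreal C * ennreal (2 * M)) \<partial>lborel)"
  proof (rule nn_integral_cong)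
    fix x :: real
    have "(\<integral>\<^sup>+y. ennreal (C * h x) * indicator {-M..M} y \<partial>lborel) = ennreal (C * h x) * emeasure lborel {-M..M}"
      by (rule nn_integral_cmult_indicator) simp
    also have "\<dots> = ennreal (h x) * (ennreal C * ennreal (2 * M))"
      using C assms(2) by (simp add: ennreal_mult' mult_ac h_def)
    finally show "(\<integral>\<^sup>+y. ennreal (C * h x) * indicator {-M..M} y \<partial>lborel) = ennreal (h x) * (ennreal C * ennreal (2 * M))" .
  qed
  also have "\<dots> = (\<integral>\<^sup>+x. ennreal (h x) \<partial>lborel) * (ennreal C * ennreal (2 * M))"
    by (rule nn_integral_multc) measurable
  also have "\<dots> < \<infinity>" using fin by (simp add: ennreal_mult_less_top)
  finally have fin': "(\<integral>\<^sup>+z. ennreal (norm (indicator ?K z *\<^sub>R w z)) \<partial>lborel) < \<infinity>" .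
  have "(\<lambda>z. indicator ?K z *\<^sub>R w z) \<in> borel_measurable lborel"
    unfolding measurable_lborel1 by measurable
  then show ?thesis unfolding set_integrable_def using fin' by (rule integrableI_bounded)
qed

section \<open>Absolutely continuous solutions\<close>

text \<open>Absolute continuity speaks of indexed families of intervals, gauge integration of finite
  sets of tagged ones; an enumeration of \<open>q\<close> passes from one to the other. The open
  interiors are disjoint and lie in \<open>W\<close>, so their total length is below
  \<open>\<delta>\<close>.\<close>

lemma sum_tagged_partial_division_less:
  fixes q :: "(real \<times> real set) set" and f :: "real \<Rightarrow> 'a :: real_normed_vector"
  assumes q: "q tagged_partial_division_of {a..b}"
    and W: "\<And>x K. (x, K) \<in> q \<Longrightarrow> K \<subseteq> W" "W \<in> lmeasurable"
    and I: "{a..b} \<subseteq> I" "measure lebesgue W < \<delta>"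
    and \<delta>: "\<forall>(n::nat) u v. (\<forall>k<n. u k \<le> v k \<and> {u k..v k} \<subseteq> I) \<and>
        disjoint_family_on (\<lambda>k. {u k<..<v k}) {..<n} \<and> (\<Sum>k<n. v k - u k) < \<delta> \<longrightarrow>
        (\<Sum>k<n. norm (f (v k) - f (u k))) < e"
  shows "(\<Sum>(x, K)\<in>q. norm (f (Sup K) - f (Inf K))) < e"
proof -
  have fin: "finite q" using tagged_partial_division_ofD(1)[OF q] .
  have K: "\<exists>c d. K = {c..d} \<and> c \<le> d \<and> a \<le> c \<and> d \<le> b" if xK: "(x, K) \<in> q" for x K
  proof -
    obtain c d where cd: "K = cbox c d" using tagged_partial_division_ofD(4)[OF q xK] by blast
    have "x \<in> {c..d}" "{c..d} \<subseteq> {a..b}"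
      using tagged_partial_division_ofD(2,3)[OF q xK] cd by simp_all
    then show ?thesis using cd by (intro exI[of _ c] exI[of _ d]) auto
  qed
  obtain h where h: "bij_betw h {..<card q} q"
    using ex_bij_betw_nat_finite[OF fin] by (auto simp: atLeast0LessThan)
  define n u v where "n = card q" and "u = (\<lambda>k. Inf (snd (h k)))" and "v = (\<lambda>k. Sup (snd (h k)))"
  have hq: "h k \<in> q" if "k < n" for k using h that by (auto simp: bij_betw_def n_def)
  have uv: "snd (h k) = {u k..v k} \<and> u k \<le> v k \<and> a \<le> u k \<and> v k \<le> b" if "k < n" for k
  proof -
    have "(fst (h k), snd (h k)) \<in> q" using hq[OF that] by simp
    from K[OF this] obtain c d where "snd (h k) = {c..d}" "c \<le> d" "a \<le> c" "d \<le> b" by blast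
    then show ?thesis unfolding u_def v_def by simp
  qed
  have disj: "disjoint_family_on (\<lambda>k. {u k<..<v k}) {..<n}"
    unfolding disjoint_family_on_def
  proof (intro ballI impI)
    fix k l assume kl: "k \<in> {..<n}" "l \<in> {..<n}" "k \<noteq> l"
    then have "h k \<noteq> h l" using h by (auto simp: bij_betw_def inj_on_def n_def)
    then have "interior (snd (h k)) \<inter> interior (snd (h l)) = {}"
      using tagged_partial_division_ofD(5)[OF q, of "fst (h k)" "snd (h k)" "fst (h l)" "snd (h l)"] hq kl
      by simp
    then show "{u k<..<v k} \<inter> {u l<..<v l} = {}" using uv kl by simp
  qed
  have "(\<Sum>k<n. v k - u k) = (\<Sum>k<n. measure lebesgue {u k<..<v k})"
    using uv by (intro sum.cong) auto
  also have "\<dots> = measure lebesgue (\<Union>k<n. {u k<..<v k})"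
    by (intro measure_finite_Union[symmetric] disj) (use uv in auto)
  also have "\<dots> \<le> measure lebesgue W"
  proof (rule measure_mono_fmeasurable[OF _ _ W(2)])
    show "(\<Union>k<n. {u k<..<v k}) \<subseteq> W"
    proof (rule UN_least)
      fix k assume k: "k \<in> {..<n}"
      then have "(fst (h k), snd (h k)) \<in> q" using hq[of k] by simp
      then have 1: "snd (h k) \<subseteq> W" by (rule W(1))
      have "snd (h k) = {u k..v k}" using uv[of k] k by simp
      moreover have "{u k<..<v k} \<subseteq> {u k..v k}" by (rule subsetI) simp
      ultimately have "{u k<..<v k} \<subseteq> snd (h k)" by (simp only:)
      with 1 show "{u k<..<v k} \<subseteq> W" by blast
    qed
  qed auto
  finally have len: "(\<Sum>k<n. v k - u k) \<le> measure lebesgue W" .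
  have sum: "(\<Sum>(x, K)\<in>q. norm (f (Sup K) - f (Inf K))) = (\<Sum>k<n. norm (f (v k) - f (u k)))"
    unfolding n_def u_def v_def by (subst sum.reindex_bij_betw[OF h, symmetric]) (simp add: case_prod_unfold)
  have "(\<Sum>k<n. norm (f (v k) - f (u k))) < e"
  proof (rule \<delta>[rule_format], intro conjI allI impI disj)
    show "u k \<le> v k" "{u k..v k} \<subseteq> I" if "k < n" for k using uv[OF that] I(1) by auto
    show "(\<Sum>k<n. v k - u k) < \<delta>" using len I(2) by linarith
  qed
  then show ?thesis using sum by simp
qed

text \<open>A gauge argument: intervals tagged in the null set lie in an open set of measure below
  \<open>\<delta>\<close>, so absolute continuity bounds the sum of their increments by
  \<open>e\<close>; an interval with any other tag has an increment of at most \<open>e\<close>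
  times its length.\<close>

lemma abs_continuous_zero_derivative:
  fixes f :: "real \<Rightarrow> 'a :: real_normed_vector"
  assumes ac: "abs_continuous_on I f" and sub: "{a..b} \<subseteq> I" and ab: "a \<le> b"
    and N: "negligible N"
    and d: "\<And>t. t \<in> {a<..<b} - N \<Longrightarrow> (f has_vector_derivative 0) (at t)"
  shows "f b = f a"
proof -
  have "norm (f b - f a) \<le> e * (1 + (b - a))" if e: "e > 0" for e
  proof -
    obtain \<delta> where \<delta>: "\<delta> > 0" "\<forall>(n::nat) u v.
        (\<forall>k<n. u k \<le> v k \<and> {u k..v k} \<subseteq> I) \<and>
        disjoint_family_on (\<lambda>k. {u k<..<v k}) {..<n} \<and> (\<Sum>k<n. v k - u k) < \<delta> \<longrightarrow>
        (\<Sum>k<n. norm (f (v k) - f (u k))) < e"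
      using ac[unfolded abs_continuous_on_def, rule_format, OF e] by blast
    \<comment> \<open>The end points join the exceptional set, since the derivative is known only
      inside the interval.\<close>
    define N' where "N' = insert a (insert b N)"
    have N': "negligible N'" using N by (simp add: N'_def negligible_insert)
    then have N's: "N' \<in> sets lebesgue" by (rule negligible_imp_sets)
    obtain U where U: "open U" "N' \<subseteq> U" "U - N' \<in> lmeasurable" "emeasure lebesgue (U - N') < ennreal \<delta>"
      using sets_lebesgue_outer_open[OF N's \<delta>(1)] by blast
    have Um: "U \<in> lmeasurable"
    proof -
      have "U = (U - N') \<union> N'" using U(2) by blast
      moreover have "N' \<in> lmeasurable" using N' by (simp add: negligible_imp_measurable)
      ultimately show ?thesis using fmeasurable.Un[OF U(3), of N'] by simp
    qed
    have mU: "measure lebesgue U < \<delta>"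
    proof -
      have "emeasure lebesgue U = emeasure lebesgue (U - N')"
        using N' N's Um by (intro emeasure_Diff_null_set[symmetric]) (auto simp: negligible_iff_null_sets)
      then have "ennreal (measure lebesgue U) < ennreal \<delta>"
        using U(4) emeasure_eq_measure2[OF Um] by simp
      then show ?thesis by (simp add: ennreal_less_iff)
    qed
    have "\<exists>r>0. \<forall>y. \<bar>y - t\<bar> < r \<longrightarrow> norm (f y - f t) \<le> e * \<bar>y - t\<bar>" if "t \<in> {a..b} - N'" for t
    proof -
      have "(f has_vector_derivative 0) (at t)" using d that by (auto simp: N'_def)
      then have "(f has_derivative (\<lambda>_. 0)) (at t)" by (simp add: has_vector_derivative_def)
      then have "\<forall>e>0. \<exists>r>0. \<forall>y\<in>UNIV. norm (y - t) < r \<longrightarrow> norm (f y - f t - 0) \<le> e * norm (y - t)"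
        unfolding has_derivative_within_alt by (rule conjunct2)
      from this[rule_format, OF e] show ?thesis by simp
    qed
    then have "\<forall>t\<in>{a..b} - N'. \<exists>r>0. \<forall>y. \<bar>y - t\<bar> < r \<longrightarrow> norm (f y - f t) \<le> e * \<bar>y - t\<bar>" by (rule ballI)
    from bchoice[OF this] obtain r where
      "\<forall>t\<in>{a..b} - N'. r t > 0 \<and> (\<forall>y. \<bar>y - t\<bar> < r t \<longrightarrow> norm (f y - f t) \<le> e * \<bar>y - t\<bar>)" ..
    then have r: "\<And>t. t \<in> {a..b} - N' \<Longrightarrow> r t > 0"
      "\<And>t y. t \<in> {a..b} - N' \<Longrightarrow> \<bar>y - t\<bar> < r t \<Longrightarrow> norm (f y - f t) \<le> e * \<bar>y - t\<bar>"
      by blast+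
    define g where "g t = (if t \<in> N' then U else if t \<in> {a..b} then ball t (r t) else ball t 1)" for t
    have "gauge g" unfolding gauge_def g_def using U(1,2) r(1) by auto
    then obtain p where p: "p tagged_division_of {a..b}" "g fine p"
      using fine_division_exists_real by blast
    define p1 p2 where "p1 = {(x, K) \<in> p. x \<in> N'}" and "p2 = {(x, K) \<in> p. x \<notin> N'}"
    have fin: "finite p" using tagged_division_ofD(1)[OF p(1)] .
    have p12: "p = p1 \<union> p2" "p1 \<inter> p2 = {}" "finite p1" "finite p2"
      using fin by (auto simp: p1_def p2_def intro: finite_subset[OF _ fin])
    have K: "\<exists>c d. K = {c..d} \<and> c \<le> d" "x \<in> K" "x \<in> {a..b}" if xK: "(x, K) \<in> p" for x K
    proof -
      obtain c d where cd: "K = cbox c d" using tagged_division_ofD(4)[OF p(1) xK] by blast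
      show x: "x \<in> K" using tagged_division_ofD(2)[OF p(1) xK] .
      then show "x \<in> {a..b}" using tagged_division_ofD(3)[OF p(1) xK] by blast
      show "\<exists>c d. K = {c..d} \<and> c \<le> d" using x cd by (intro exI[of _ c] exI[of _ d]) auto
    qed
    have "f b - f a = (\<Sum>(x, K)\<in>p. f (Sup K) - f (Inf K))"
      using additive_tagged_division_1[OF ab p(1), of f] by simp
    also have "norm \<dots> \<le> (\<Sum>(x, K)\<in>p. norm (f (Sup K) - f (Inf K)))"
      by (rule order_trans[OF norm_sum]) (simp add: case_prod_unfold)
    also have "\<dots> = (\<Sum>(x, K)\<in>p1. norm (f (Sup K) - f (Inf K))) + (\<Sum>(x, K)\<in>p2. norm (f (Sup K) - f (Inf K)))"
      unfolding p12(1) by (rule sum.union_disjoint[OF p12(3,4,2)])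
    also have "(\<Sum>(x, K)\<in>p1. norm (f (Sup K) - f (Inf K))) \<le> e"
    proof -
      have q: "p1 tagged_partial_division_of {a..b}"
        using p(1)[unfolded tagged_division_of_def, THEN conjunct1]
        by (rule tagged_partial_division_subset) (auto simp: p1_def)
      have KU: "K \<subseteq> U" if "(x, K) \<in> p1" for x K
      proof -
        have "x \<in> N'" "(x, K) \<in> p" using that by (auto simp: p1_def)
        then have "K \<subseteq> g x" using p(2) by (auto simp: fine_def)
        then show ?thesis using \<open>x \<in> N'\<close> by (simp add: g_def)
      qed
      show ?thesis
        by (rule less_imp_le, rule sum_tagged_partial_division_less[OF q _ Um sub mU \<delta>(2)], rule KU)
    qed
    also have "(\<Sum>(x, K)\<in>p2. norm (f (Sup K) - f (Inf K))) \<le> (\<Sum>(x, K)\<in>p2. e * (Sup K - Inf K))"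
    proof (rule sum_mono, clarify)
      fix x K assume xK: "(x, K) \<in> p2"
      then have xp: "(x, K) \<in> p" "x \<notin> N'" by (auto simp: p2_def)
      obtain c d where cd: "K = {c..d}" "c \<le> d" using K(1)[OF xp(1)] by blast
      have x: "c \<le> x" "x \<le> d" "x \<in> {a..b} - N'" using K(2,3)[OF xp(1)] cd xp by auto
      have "K \<subseteq> g x" using p(2) xp(1) by (auto simp: fine_def)
      then have sub: "K \<subseteq> ball x (r x)" using x(3) by (simp add: g_def)
      then have "c \<in> ball x (r x)" "d \<in> ball x (r x)" using cd by auto
      then have "norm (f c - f x) \<le> e * \<bar>c - x\<bar>" "norm (f d - f x) \<le> e * \<bar>d - x\<bar>"
        using r(2)[OF x(3)] by (auto simp: dist_real_def abs_minus_commute)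
      then have "norm (f d - f c) \<le> e * (d - x) + e * (x - c)"
        using norm_triangle_ineq4[of "f d - f x" "f c - f x"] x by simp
      then show "norm (f (Sup K) - f (Inf K)) \<le> e * (Sup K - Inf K)"
        using cd by (simp add: algebra_simps)
    qed
    also have "\<dots> \<le> (\<Sum>(x, K)\<in>p. e * (Sup K - Inf K))"
    proof (rule sum_mono2[OF fin])
      show "p2 \<subseteq> p" using p12(1) by blast
      fix z assume "z \<in> p - p2"
      then obtain x K where "z = (x, K)" "(x, K) \<in> p" by (cases z) auto
      then show "0 \<le> (case z of (x, K) \<Rightarrow> e * (Sup K - Inf K))" using K(1)[of x K] e by auto
    qed
    also have "\<dots> = e * (\<Sum>(x, K)\<in>p. Sup K - Inf K)"
      by (simp add: sum_distrib_left case_prod_unfold)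
    also have "(\<Sum>(x, K)\<in>p. Sup K - Inf K) = b - a"
      using additive_tagged_division_1[OF ab p(1), of "\<lambda>x. x"] by simp
    finally show ?thesis by (simp add: algebra_simps)
  qed
  then have *: "norm (f b - f a) \<le> e * (1 + (b - a))" if "e > 0" for e using that by blast
  have "norm (f b - f a) \<le> 0"
  proof (rule field_le_epsilon)
    fix e :: real assume "e > 0"
    then show "norm (f b - f a) \<le> 0 + e" using *[of "e / (1 + (b - a))"] ab by simp
  qed
  then show ?thesis by simp
qed

lemma abs_continuous_on_diff_lipschitz:
  fixes f g :: "real \<Rightarrow> 'a :: real_normed_vector"
  assumes ac: "abs_continuous_on I f" and L: "L \<ge> 0"
    and g: "\<And>u v. u \<le> v \<Longrightarrow> {u..v} \<subseteq> I \<Longrightarrow> norm (g v - g u) \<le> L * (v - u)"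
  shows "abs_continuous_on I (\<lambda>t. f t - g t)"
  unfolding abs_continuous_on_def
proof (intro allI impI)
  fix e :: real assume e: "e > 0"
  then have e2: "e / 2 > 0" by simp
  obtain d where d: "d > 0" "\<forall>(n::nat) u v.
      (\<forall>k<n. u k \<le> v k \<and> {u k..v k} \<subseteq> I) \<and>
      disjoint_family_on (\<lambda>k. {u k<..<v k}) {..<n} \<and> (\<Sum>k<n. v k - u k) < d \<longrightarrow>
      (\<Sum>k<n. norm (f (v k) - f (u k))) < e / 2"
    using ac[unfolded abs_continuous_on_def, rule_format, OF e2] by blast
  \<comment> \<open>Half of \<open>e\<close> is reserved for each function; \<open>L + 1\<close>
    avoids a division by zero.\<close>
  define d' where "d' = min d (e / (2 * (L + 1)))"
  have d': "d' > 0" "d' \<le> d" "L * d' \<le> e / 2"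
  proof -
    show "d' > 0" "d' \<le> d" using d(1) e L by (auto simp: d'_def)
    have "L * d' \<le> L * (e / (2 * (L + 1)))" using L by (intro mult_left_mono) (auto simp: d'_def)
    also have "\<dots> \<le> e / 2" using L e by (simp add: field_simps)
    finally show "L * d' \<le> e / 2" .
  qed
  show "\<exists>d>0. \<forall>n u v. (\<forall>k<n. u k \<le> v k \<and> {u k..v k} \<subseteq> I) \<and>
      disjoint_family_on (\<lambda>k. {u k<..<v k}) {..<n::nat} \<and> (\<Sum>k<n. v k - u k) < d \<longrightarrow>
      (\<Sum>k<n. norm (f (v k) - g (v k) - (f (u k) - g (u k)))) < e"
  proof (intro exI[of _ d'] conjI allI impI d'(1))
    fix n :: nat and u v :: "nat \<Rightarrow> real"
    assume A: "(\<forall>k<n. u k \<le> v k \<and> {u k..v k} \<subseteq> I) \<and>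
      disjoint_family_on (\<lambda>k. {u k<..<v k}) {..<n} \<and> (\<Sum>k<n. v k - u k) < d'"
    have "(\<Sum>k<n. norm (f (v k) - f (u k))) < e / 2"
      using A d'(2) by (intro d(2)[rule_format]) auto
    moreover have "(\<Sum>k<n. norm (g (v k) - g (u k))) \<le> (\<Sum>k<n. L * (v k - u k))"
      using A by (intro sum_mono g) auto
    moreover have "\<dots> \<le> L * d'" unfolding sum_distrib_left[symmetric]
      using A L by (intro mult_left_mono) auto
    moreover have "(\<Sum>k<n. norm (f (v k) - g (v k) - (f (u k) - g (u k))))
        \<le> (\<Sum>k<n. norm (f (v k) - f (u k)) + norm (g (v k) - g (u k)))"
    proof (rule sum_mono)
      fix k
      show "norm (f (v k) - g (v k) - (f (u k) - g (u k))) \<le> norm (f (v k) - f (u k)) + norm (g (v k) - g (u k))"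
        using norm_triangle_ineq4[of "f (v k) - f (u k)" "g (v k) - g (u k)"] by (simp add: algebra_simps)
    qed
    ultimately show "(\<Sum>k<n. norm (f (v k) - g (v k) - (f (u k) - g (u k)))) < e"
      using d'(3) by (simp add: sum.distrib)
  qed
qed

lemma abs_continuous_on_imp_continuous_on:
  fixes f :: "real \<Rightarrow> 'a :: real_normed_vector"
  assumes "abs_continuous_on {0..} f"
  shows "continuous_on {0..} f"
  unfolding continuous_on_iff
proof (intro ballI allI impI)
  fix x e :: real assume x: "x \<in> {0..}" and e: "e > 0"
  obtain d where d: "d > 0" "\<forall>(n::nat) u v.
      (\<forall>k<n. u k \<le> v k \<and> {u k..v k} \<subseteq> {0..}) \<and>
      disjoint_family_on (\<lambda>k. {u k<..<v k}) {..<n} \<and> (\<Sum>k<n. v k - u k) < d \<longrightarrow>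
      (\<Sum>k<n. norm (f (v k) - f (u k))) < e"
    using assms[unfolded abs_continuous_on_def, rule_format, OF e] by blast
  have *: "norm (f b - f a) < e" if "0 \<le> a" "a \<le> b" "b - a < d" for a b
    using d(2)[rule_format, of 1 "\<lambda>_. a" "\<lambda>_. b"] that by (simp add: disjoint_family_on_def lessThan_Suc)
  show "\<exists>d>0. \<forall>y\<in>{0..}. dist y x < d \<longrightarrow> dist (f y) (f x) < e"
  proof (intro exI[of _ d] conjI ballI impI d(1))
    fix y assume "y \<in> {0..}" "dist y x < d"
    then show "dist (f y) (f x) < e"
      using *[of x y] *[of y x] x by (cases "x \<le> y") (auto simp: dist_norm norm_minus_commute)
  qed
qed

text \<open>The difference of \<open>X\<close> and the indefinite integral of \<open>B \<circ> X\<close> is absolutely continuous with derivative zero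
  almost everywhere, hence constant.\<close>

lemma ae_solution_classical:
  fixes X :: "real \<Rightarrow> 'a :: euclidean_space"
  assumes ac: "abs_continuous_on {0..} X" and B: "continuous_on UNIV B" "\<And>z. norm (B z) \<le> M"
    and ae: "AE t in lebesgue. 0 < t \<longrightarrow> (X has_vector_derivative B (X t)) (at t)"
    and t: "t \<ge> 0"
  shows "(X has_vector_derivative B (X t)) (at t within {0..})"
proof -
  define h where "h s = B (X s)" for s
  define G where "G s = integral {0..s} h" for s
  have hc: "continuous_on {0..} h" unfolding h_def
    by (rule continuous_on_compose2[OF B(1) abs_continuous_on_imp_continuous_on[OF ac]]) simp
  have Gd: "(G has_vector_derivative h s) (at s within {0..c})" if "s \<in> {0..c}" for s c
    unfolding G_def by (rule integral_has_vector_derivative[OF continuous_on_subset[OF hc] that]) auto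
  have "M \<ge> 0" using B(2)[of undefined] norm_ge_zero order_trans by blast
  have Glip: "norm (G v - G u) \<le> M * (v - u)" if uv: "u \<le> v" "{u..v} \<subseteq> {0..}" for u v
  proof -
    have u: "0 \<le> u" using uv by auto
    have i: "h integrable_on {0..v}" "h integrable_on {u..v}"
      using u by (auto intro!: integrable_continuous_interval continuous_on_subset[OF hc])
    have "G u + integral {u..v} h = G v"
      unfolding G_def by (rule Henstock_Kurzweil_Integration.integral_combine) (use u uv i in auto)
    moreover have "norm (integral {u..v} h) \<le> M * (v - u)"
      by (rule integral_bound[OF uv(1)]) (use u hc B(2) in \<open>auto intro: continuous_on_subset simp: h_def\<close>)
    ultimately show ?thesis by (metis add_diff_cancel_left')
  qed
  have acG: "abs_continuous_on {0..} (\<lambda>s. X s - G s)"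
    by (rule abs_continuous_on_diff_lipschitz[OF ac \<open>M \<ge> 0\<close> Glip])
  obtain N where N: "N \<in> null_sets lebesgue"
    "\<And>s. s \<notin> N \<Longrightarrow> 0 < s \<Longrightarrow> (X has_vector_derivative B (X s)) (at s)"
    using ae unfolding eventually_ae_filter by auto
  have N0: "negligible N" using N(1) by (simp add: negligible_iff_null_sets)
  have eq: "X s = X 0 + G s" if s: "s \<ge> 0" for s
  proof -
    have "X s - G s = X 0 - G 0"
    proof (rule abs_continuous_zero_derivative[OF acG _ s N0])
      fix r assume r: "r \<in> {0<..<s} - N"
      have "(G has_vector_derivative h r) (at r within {0..s})" using r by (intro Gd) auto
      then have "(G has_vector_derivative h r) (at r)"
        using at_within_Icc_at[of 0 r s] r by simp
      with N(2)[of r] r have "((\<lambda>s. X s - G s) has_vector_derivative B (X r) - h r) (at r)"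
        by (intro has_vector_derivative_diff) auto
      then show "((\<lambda>s. X s - G s) has_vector_derivative 0) (at r)" by (simp add: h_def)
    qed auto
    moreover have "G 0 = 0" by (simp add: G_def)
    ultimately show ?thesis by (simp add: algebra_simps)
  qed
  have "(G has_vector_derivative h t) (at t within {0..t + 1})" using t by (intro Gd) auto
  then have "((\<lambda>s. X 0 + G s) has_vector_derivative h t) (at t within {0..t + 1})"
    using has_vector_derivative_add[OF has_vector_derivative_const[of "X 0"]] by fastforce
  then have "(X has_vector_derivative h t) (at t within {0..t + 1})"
    by (rule has_vector_derivative_transform[rotated 2]) (use t in simp, rule eq, simp)
  moreover have "at t within {0..t + 1} = at t within {0..}"
    by (rule at_within_nhd[of _ "{..<t + 1}"]) auto
  ultimately show ?thesis by (simp add: h_def)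
qed

text \<open>The push-forward under \<open>g\<close> of the measure with density \<open>g'\<close>
  gives every open interval its length, hence is Lebesgue measure. It is applied to
  \<open>stream x\<close> and to \<open>travel_time h\<close>.\<close>

lemma nn_integral_substitution_real_line:
  fixes g g' :: "real \<Rightarrow> real" and f :: "real \<Rightarrow> ennreal"
  assumes f[measurable]: "f \<in> borel_measurable borel"
    and g: "\<And>x. (g has_real_derivative g' x) (at x)"
    and g': "continuous_on UNIV g'" "\<And>x. 0 < g' x"
    and top: "filterlim g at_top at_top" and bot: "filterlim g at_bot at_bot"
  shows "(\<integral>\<^sup>+x. f (g x) * ennreal (g' x) \<partial>lborel) = (\<integral>\<^sup>+y. f y \<partial>lborel)"
proof -
  have cont: "continuous_on UNIV g"
    using g DERIV_isCont continuous_at_imp_continuous_on by blast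
  have gm[measurable]: "g \<in> borel_measurable borel" "g' \<in> borel_measurable borel"
    using cont g' by (auto intro: borel_measurable_continuous_onI)
  have smono: "g x < g y" if "x < y" for x y
    using DERIV_pos_imp_increasing[OF that] g g' by blast
  then have mono: "g x \<le> g y" if "x \<le> y" for x y using that by (cases "x = y") (auto intro: less_imp_le)
  define D where "D = density lborel (\<lambda>x. ennreal (g' x))"
  have sets_D: "sets D = sets borel" by (simp add: D_def)
  have box: "emeasure (distr D borel g) {a<..<b} = ennreal (b - a)" if "a \<le> b" for a b
  proof (cases "a = b")
    case True then show ?thesis by simp
  next
    case False
    with that have ab: "a < b" by simp
    have "eventually (\<lambda>x. g x \<le> a) at_bot" using bot unfolding filterlim_at_bot by blast
    then obtain x1 where x1: "g x1 \<le> a" by (auto simp: eventually_at_bot_linorder)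
    have "eventually (\<lambda>x. g x \<ge> b) at_top" using top unfolding filterlim_at_top by blast
    then obtain x2 where x2: "g x2 \<ge> b" by (auto simp: eventually_at_top_linorder)
    have le: "x1 \<le> x2" using x1 x2 ab smono[of x2 x1] by linarith
    have c: "continuous_on {x1..x2} g" using cont by (rule continuous_on_subset) simp
    obtain u where u: "g u = a" using IVT'[of g x1 a x2, OF x1 _ le c] x2 ab by auto
    obtain v where v: "g v = b" using IVT'[of g x1 b x2, OF _ x2 le c] x1 ab by auto
    have uv: "u < v" using u v ab mono[of v u] by linarith
    have "g x \<in> {a<..<b} \<longleftrightarrow> x \<in> {u<..<v}" for x
      using smono[of u x] smono[of x v] mono[of x u] mono[of v x] u v
      unfolding greaterThanLessThan_iff by linarith
    then have "g -` {a<..<b} = {u<..<v}" by blast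
    then have *: "g -` {a<..<b} \<inter> space D = {u<..<v}" by (simp add: D_def)
    have "emeasure (distr D borel g) {a<..<b} = emeasure D {u<..<v}"
      unfolding *[symmetric] by (rule emeasure_distr) (auto simp: D_def)
    also have "\<dots> = (\<integral>\<^sup>+x. ennreal (g' x) * indicator {u<..<v} x \<partial>lborel)"
      unfolding D_def by (subst emeasure_density) auto
    also have "\<dots> = (\<integral>\<^sup>+x. ennreal (g' x) * indicator {u..v} x \<partial>lborel)"
      using AE_lborel_singleton[of u] AE_lborel_singleton[of v]
      by (intro nn_integral_cong_AE, eventually_elim) (auto simp: indicator_def)
    also have "\<dots> = ennreal (g v - g u)"
      using uv g g' by (intro nn_integral_FTC_Icc) (auto simp: less_imp_le DERIV_subset)
    also have "\<dots> = ennreal (b - a)" by (simp add: u v)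
    finally show ?thesis .
  qed
  have "lborel = distr D borel g"
  proof (rule lborel_eqI)
    fix l u :: real assume "\<And>b. b \<in> Basis \<Longrightarrow> l \<bullet> b \<le> u \<bullet> b"
    then have "l \<le> u" by simp
    then show "emeasure (distr D borel g) (box l u) = ennreal (prod ((\<bullet>) (u - l)) Basis)"
      by (simp add: box)
  qed simp
  then have "(\<integral>\<^sup>+y. f y \<partial>lborel) = (\<integral>\<^sup>+y. f y \<partial>distr D borel g)" by simp
  also have "\<dots> = (\<integral>\<^sup>+x. f (g x) \<partial>D)" by (rule nn_integral_distr) (auto simp: D_def)
  also have "\<dots> = (\<integral>\<^sup>+x. f (g x) * ennreal (g' x) \<partial>lborel)"
    unfolding D_def by (subst nn_integral_density) (auto simp: mult.commute)
  finally show ?thesis by simp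
qed

section \<open>The radial weight and the oscillating factor\<close>

definition vlog :: "real \<Rightarrow> real" where
  "vlog t = ln (1 + 1 / t)"

text \<open>The weight is chosen such that \<open>t * kappa t = (4 + vlog t)\<^sup>2 exp (- vlog t / 2)\<close>: this is of order
  \<open>sqrt t (log t)\<^sup>2\<close> at \<open>0\<close>, and it is bounded at infinity, which keeps the second component of the
  field bounded. The constant 4 makes it monotone. The value \<open>kappa 0\<close> is irrelevant, as
  \<open>kappa\<close> is multiplied by \<open>0\<close> at the origin.\<close>

definition kappa :: "real \<Rightarrow> real" where
  "kappa t = (4 + vlog t)\<^sup>2 * exp (- (ln t + ln (1 + t)) / 2)"

text \<open>\<open>kappa_rate\<close> is \<open>- kappa' / kappa\<close>.\<close>

definition kappa_rate :: "real \<Rightarrow> real" where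
  "kappa_rate t = (1 / t + 1 / (1 + t)) / 2 + 2 / ((4 + vlog t) * (t * (1 + t)))"

definition kappa_rate' :: "real \<Rightarrow> real" where
  "kappa_rate' t = - ((1 / t\<^sup>2 + 1 / (1 + t)\<^sup>2) / 2
      + 2 * ((4 + vlog t) * (1 + 2 * t) - 1) / ((4 + vlog t) * (t * (1 + t)))\<^sup>2)"

text \<open>The second derivative of \<open>kappa\<close>, with the factor \<open>kappa t\<close>
  kept so that it can be estimated relative to the weight itself.\<close>

definition kappa2 :: "real \<Rightarrow> real" where
  "kappa2 t = kappa t * ((kappa_rate t)\<^sup>2 - kappa_rate' t)"

lemma vlog_pos: "t > 0 \<Longrightarrow> vlog t > 0"
  unfolding vlog_def by (rule ln_gt_zero) simp

lemma vlog_nonneg: "t \<ge> 0 \<Longrightarrow> vlog t \<ge> 0"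
  using vlog_pos[of t] by (cases "t = 0") (auto simp: vlog_def)

lemma vlog_eq: "t > 0 \<Longrightarrow> vlog t = ln (1 + t) - ln t"
  using ln_div[of "1 + t" t] unfolding vlog_def by (simp add: add_divide_distrib add.commute)

lemma vlog_antimono: "0 < s \<Longrightarrow> s \<le> t \<Longrightarrow> vlog t \<le> vlog s"
  unfolding vlog_def by (subst ln_le_cancel_iff) (auto simp: field_simps add_pos_pos)

lemma vlog_strict_antimono: "0 < s \<Longrightarrow> s < t \<Longrightarrow> vlog t < vlog s"
  unfolding vlog_def by (subst ln_less_cancel_iff) (auto simp: field_simps add_pos_pos)

lemma vlog_deriv: "t > 0 \<Longrightarrow> (vlog has_real_derivative - 1 / (t * (1 + t))) (at t)"
  unfolding vlog_def
  by (auto intro!: derivative_eq_intros add_pos_pos simp: field_simps power2_eq_square)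

lemma kappa_pos: "t \<ge> 0 \<Longrightarrow> kappa t > 0"
  using vlog_nonneg[of t] unfolding kappa_def by simp

lemma kappa_rate_nonneg: "t > 0 \<Longrightarrow> 0 \<le> kappa_rate t"
  using vlog_pos[of t] unfolding kappa_rate_def by simp

lemma kappa_deriv:
  assumes "t > 0" shows "(kappa has_real_derivative - (kappa t * kappa_rate t)) (at t)"
proof -
  define e where "e = exp (- (ln t + ln (1 + t)) / 2)"
  define w where "w = 4 + vlog t"
  have w: "w > 0" using vlog_pos[OF assms] by (simp add: w_def)
  have "(kappa has_real_derivative
     2 * w * (- 1 / (t * (1 + t))) * e + w\<^sup>2 * (e * (- (1 / t + 1 / (1 + t)) / 2))) (at t)"
    unfolding kappa_def e_def w_def
    by (rule DERIV_cong, (rule derivative_intros vlog_deriv assms refl)+, insert assms)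
      (auto intro!: derivative_eq_intros simp: divide_simps, auto simp: algebra_simps power2_eq_square)
  moreover have "2 * w * (- 1 / (t * (1 + t))) * e + w\<^sup>2 * (e * (- (1 / t + 1 / (1 + t)) / 2))
      = - (w\<^sup>2 * e * ((1 / t + 1 / (1 + t)) / 2 + 2 / (w * (t * (1 + t)))))"
  proof -
    have "t \<noteq> 0" "1 + t \<noteq> 0" "w \<noteq> 0" using assms w by auto
    then show ?thesis by (simp add: divide_simps) (simp add: algebra_simps power2_eq_square)
  qed
  ultimately show ?thesis
    unfolding kappa_rate_def kappa_def e_def[symmetric] w_def[symmetric] by simp
qed

lemma kappa_rate_deriv:
  assumes "t > 0" shows "(kappa_rate has_real_derivative kappa_rate' t) (at t)"
proof -
  define w where "w = 4 + vlog t"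
  have w: "w > 0" using vlog_pos[OF assms] by (simp add: w_def)
  have t: "t \<noteq> 0" "1 + t \<noteq> 0" "w \<noteq> 0" using assms w by auto
  have "(kappa_rate has_real_derivative
     (- 1 / t\<^sup>2 + - 1 / (1 + t)\<^sup>2) / 2
      + - 2 * ((- 1 / (t * (1 + t))) * (t * (1 + t)) + w * (1 + 2 * t)) / (w * (t * (1 + t)))\<^sup>2) (at t)"
    unfolding kappa_rate_def w_def
    using t[unfolded w_def] assms
    by (auto intro!: derivative_eq_intros vlog_deriv simp: power2_eq_square)
      (simp add: divide_simps, simp add: algebra_simps)
  moreover have "(- 1 / (t * (1 + t))) * (t * (1 + t)) = - 1" using t by simp
  moreover have "(- 1 / t\<^sup>2 + - 1 / (1 + t)\<^sup>2) / 2 + - 2 * (- 1 + w * (1 + 2 * t)) / (w * (t * (1 + t)))\<^sup>2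
     = kappa_rate' t"
    unfolding kappa_rate'_def w_def[symmetric] by (simp add: algebra_simps diff_divide_distrib)
  ultimately show ?thesis by simp
qed

text \<open>As for a power of \<open>t\<close>, a derivative costs a factor of order
  \<open>1 / t\<close>. Since \<open>4 + vlog t\<close> is at least 4, the logarithm contributes no
  more than \<open>1 / (2 * t)\<close>.\<close>

lemma kappa_rate_bound:
  assumes "t > 0" shows "kappa_rate t \<le> 3 / (2 * t)"
proof -
  define w where "w = 4 + vlog t"
  have w: "w \<ge> 4" using vlog_pos[OF assms] by (simp add: w_def)
  have "2 / (w * (t * (1 + t))) \<le> 2 / (4 * (t * 1))"
    using w assms by (intro divide_left_mono mult_mono mult_pos_pos) auto
  moreover have "1 / (1 + t) \<le> 1 / t" using assms by (simp add: field_simps)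
  ultimately show ?thesis unfolding kappa_rate_def w_def[symmetric]
    by (simp add: field_simps)
qed

lemma kappa_rate'_bound:
  assumes "t > 0" shows "\<bar>kappa_rate' t\<bar> \<le> 2 / t\<^sup>2"
proof -
  define w where "w = 4 + vlog t"
  have w: "w \<ge> 4" using vlog_pos[OF assms] by (simp add: w_def)
  have a: "0 \<le> w * (1 + 2 * t) - 1"
    using w assms mult_mono[of 4 w 1 "1 + 2 * t"] by simp
  have "2 * (w * (1 + 2 * t) - 1) / (w * (t * (1 + t)))\<^sup>2
      \<le> 2 * (w * (2 * (1 + t))) / (w * (t * (1 + t)))\<^sup>2"
    using w assms by (intro divide_right_mono) (auto simp: algebra_simps)
  also have "\<dots> = 4 / (w * (t\<^sup>2 * (1 + t)))"
  proof -
    have "1 + t \<noteq> 0" "w \<noteq> 0" "t \<noteq> 0" using w assms by auto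
    then show ?thesis by (simp add: divide_simps) (simp add: power2_eq_square)
  qed
  also have "\<dots> \<le> 4 / (4 * (t\<^sup>2 * 1))"
    using w assms by (intro divide_left_mono mult_mono mult_pos_pos) auto
  finally have 1: "2 * (w * (1 + 2 * t) - 1) / (w * (t * (1 + t)))\<^sup>2 \<le> 1 / t\<^sup>2" by simp
  have 2: "1 / (1 + t)\<^sup>2 \<le> 1 / t\<^sup>2"
    using assms by (intro divide_left_mono power_mono mult_pos_pos) auto
  have "0 \<le> 2 * (w * (1 + 2 * t) - 1) / (w * (t * (1 + t)))\<^sup>2" using a by simp
  moreover have "0 \<le> 1 / t\<^sup>2" "0 \<le> 1 / (1 + t)\<^sup>2" by auto
  moreover have "2 / t\<^sup>2 = 1 / t\<^sup>2 + 1 / t\<^sup>2" by simp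
  moreover have "\<bar>- ((a + b) / 2 + c)\<bar> \<le> d"
    if "0 \<le> c" "0 \<le> a" "0 \<le> b" "d = a + a" "c \<le> a" "b \<le> a" for a b c d :: real
    using that unfolding abs_le_iff by (auto simp: field_simps)
  ultimately show ?thesis using 1 2 unfolding kappa_rate'_def w_def[symmetric]
    by blast
qed

lemma kappa2_deriv:
  assumes "t > 0"
  shows "((\<lambda>t. - (kappa t * kappa_rate t)) has_real_derivative kappa2 t) (at t)"
  unfolding kappa2_def
  by (rule derivative_eq_intros kappa_deriv kappa_rate_deriv assms refl)+
    (simp add: algebra_simps power2_eq_square)

lemma kappa2_bound:
  assumes "t > 0" shows "\<bar>kappa2 t\<bar> \<le> kappa t * (5 / t\<^sup>2)"
proof -
  have "(kappa_rate t)\<^sup>2 \<le> (3 / (2 * t))\<^sup>2"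
    using kappa_rate_bound kappa_rate_nonneg assms by (intro power_mono) auto
  then have "(kappa_rate t)\<^sup>2 \<le> (9/4) / t\<^sup>2" by (simp add: power2_eq_square field_simps)
  moreover have "(9/4) / t\<^sup>2 + 2 / t\<^sup>2 \<le> 5 / t\<^sup>2"
    using assms by (simp add: field_simps)
  moreover have "0 \<le> (kappa_rate t)\<^sup>2" by simp
  ultimately have "\<bar>(kappa_rate t)\<^sup>2 - kappa_rate' t\<bar> \<le> 5 / t\<^sup>2"
    using kappa_rate'_bound[OF assms] by linarith
  then show ?thesis unfolding kappa2_def abs_mult
    using kappa_pos[of t] assms mult_left_mono[of _ "5 / t\<^sup>2" "kappa t"] by simp
qed

text \<open>In terms of the squared distance \<open>t\<close> from the origin: an upper bound of
  \<open>speed\<close> everywhere and, up to the factor 1/4, a lower bound where the oscillating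
  factor is not small.\<close>

definition rho :: "real \<Rightarrow> real" where
  "rho t = t * kappa t"

lemma rho_eq: "t > 0 \<Longrightarrow> rho t = (4 + vlog t)\<^sup>2 * exp (- vlog t / 2)"
proof -
  assume t: "t > 0"
  have "t * exp (- (ln t + ln (1 + t)) / 2) = exp (ln t) * exp (- (ln t + ln (1 + t)) / 2)"
    using t by simp
  also have "\<dots> = exp (- vlog t / 2)"
    unfolding exp_add[symmetric] vlog_eq[OF t] by (simp add: field_simps)
  finally show ?thesis unfolding rho_def kappa_def by (simp add: algebra_simps)
qed

text \<open>With \<open>c\<close> in place of 4, the sign of the derivative is that of
  \<open>2 - (c + x) / 2\<close>. So 4 is the smallest constant for which the function decreases
  from \<open>x = 0\<close> on.\<close>

lemma square_times_exp_antimono: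
  assumes "0 \<le> u" "u \<le> v"
  shows "(4 + v)\<^sup>2 * exp (- v / 2) \<le> (4 + u)\<^sup>2 * exp (- u / (2::real))"
proof (rule DERIV_nonpos_imp_nonincreasing[OF assms(2)])
  fix x assume x: "u \<le> x" "x \<le> v"
  have "((\<lambda>v. (4 + v)\<^sup>2 * exp (- v / 2)) has_real_derivative
     - ((4 + x) * x / 2 * exp (- x / 2))) (at x)"
    by (rule derivative_eq_intros refl | simp)+ (simp add: algebra_simps power2_eq_square)
  moreover have "(4 + x) * x / 2 * exp (- x / 2) \<ge> 0" using x assms by simp
  ultimately show "\<exists>y. ((\<lambda>v. (4 + v)\<^sup>2 * exp (- v / 2)) has_real_derivative y) (at x) \<and> y \<le> 0"
    by (meson neg_le_0_iff_le)
qed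

lemma rho_mono:
  assumes "0 \<le> s" "s \<le> t" shows "rho s \<le> rho t"
proof (cases "s = 0")
  case True then show ?thesis using kappa_pos[of t] assms by (simp add: rho_def)
next
  case False
  then show ?thesis
    using assms square_times_exp_antimono[OF vlog_nonneg[of t] vlog_antimono[of s t]] by (simp add: rho_eq)
qed

lemma rho_le: "t \<ge> 0 \<Longrightarrow> rho t \<le> 16"
  using square_times_exp_antimono[of 0 "vlog t"] vlog_nonneg[of t] by (cases "t = 0") (auto simp: rho_def rho_eq[unfolded rho_def])

lemma rho_nonneg: "t \<ge> 0 \<Longrightarrow> rho t \<ge> 0"
  using kappa_pos[of t] by (simp add: rho_def)

lemma rho_pos: "t > 0 \<Longrightarrow> rho t > 0"
  using kappa_pos[of t] by (simp add: rho_def)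

lemma kappa_le: "t > 0 \<Longrightarrow> kappa t \<le> 16 / t"
  using rho_le[of t] by (simp add: rho_def field_simps)

text \<open>The logarithm is absorbed by a small power: \<open>ln z \<le> z\<close> for
  \<open>z = (1 + 1 / t) powr (e / 4)\<close> bounds \<open>vlog t\<close>, and squaring costs
  \<open>t powr (- e / 2)\<close> on top of \<open>t powr (- 1 / 2)\<close>. The power of
  \<open>1 + t\<close> that remains has a nonpositive exponent.\<close>

lemma kappa_powr_bound:
  assumes t: "t > 0" and e: "0 < e" "e \<le> 1"
  shows "kappa t \<le> (4 + 4 / e)\<^sup>2 * t powr (- (1 + e) / 2)"
proof -
  have z: "1 + 1 / t > 1" using t by simp
  have "(e / 4) * vlog t = ln ((1 + 1 / t) powr (e / 4))"
    using z unfolding vlog_def by (simp add: ln_powr)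
  also have "\<dots> \<le> (1 + 1 / t) powr (e / 4)"
  proof (rule ln_bound)
    have "1 + 1 / t \<noteq> 0" using z by linarith
    then show "0 < (1 + 1 / t) powr (e / 4)" by (simp add: powr_def)
  qed
  finally have v: "vlog t \<le> 4 / e * (1 + 1 / t) powr (e / 4)"
    using e by (simp add: field_simps)
  have "1 \<le> (1 + 1 / t) powr (e / 4)" using z e by (simp add: ge_one_powr_ge_zero)
  then have "4 + vlog t \<le> (4 + 4 / e) * (1 + 1 / t) powr (e / 4)"
    using v by (simp add: algebra_simps)
  then have "(4 + vlog t)\<^sup>2 \<le> ((4 + 4 / e) * (1 + 1 / t) powr (e / 4))\<^sup>2"
    using vlog_nonneg[of t] t by (intro power_mono) auto
  also have "\<dots> = (4 + 4 / e)\<^sup>2 * (1 + 1 / t) powr (e / 2)"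
    using z by (simp add: power_mult_distrib power2_eq_square powr_add[symmetric])
  also have "(1 + 1 / t) powr (e / 2) = exp (e / 2 * (ln (1 + t) - ln t))"
  proof -
    have "1 + 1 / t \<noteq> 0" using z by linarith
    then show ?thesis using vlog_eq[OF t] unfolding vlog_def by (simp add: powr_def)
  qed
  finally have 1: "(4 + vlog t)\<^sup>2 \<le> (4 + 4 / e)\<^sup>2 * exp (e / 2 * (ln (1 + t) - ln t))" .
  have "kappa t \<le> (4 + 4 / e)\<^sup>2 * exp (e / 2 * (ln (1 + t) - ln t)) * exp (- (ln t + ln (1 + t)) / 2)"
    unfolding kappa_def using 1 by (intro mult_right_mono) auto
  also have "\<dots> = (4 + 4 / e)\<^sup>2 * exp (- (1 + e) / 2 * ln t + (e - 1) / 2 * ln (1 + t))"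
    by (simp add: mult.assoc exp_add[symmetric]) (simp add: field_simps)
  also have "\<dots> \<le> (4 + 4 / e)\<^sup>2 * exp (- (1 + e) / 2 * ln t)"
  proof (rule mult_left_mono)
    have "(e - 1) / 2 * ln (1 + t) \<le> 0" using e t by (intro mult_nonpos_nonneg) auto
    then show "exp (- (1 + e) / 2 * ln t + (e - 1) / 2 * ln (1 + t)) \<le> exp (- (1 + e) / 2 * ln t)" by simp
  qed simp
  finally show ?thesis using t by (simp add: powr_def)
qed

text \<open>The factor \<open>1 / 5\<close> is small enough for \<open>cos\<^sup>2 \<ge> 1/4\<close> to hold on the whole band
  \<open>b / 9 \<le> y \<le> 6 b\<close> around a maximum \<open>b\<close>, see \<open>cos_sq_band\<close>.\<close>

definition osc_sq :: "real \<Rightarrow> real" where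
  "osc_sq y = (y * cos (vlog (y\<^sup>2) / 5))\<^sup>2"

definition osc_sq' :: "real \<Rightarrow> real" where
  "osc_sq' y = 2 * y * (cos (vlog (y\<^sup>2) / 5))\<^sup>2
     + 4 / 5 * y * cos (vlog (y\<^sup>2) / 5) * sin (vlog (y\<^sup>2) / 5) / (1 + y\<^sup>2)"

text \<open>The signed square root of \<open>osc_sq\<close>. Away from 0 its zeros are simple, which
  is the source of the quadratic behaviour of \<open>osc_sq\<close> at a stagnation point.\<close>

definition osc :: "real \<Rightarrow> real" where
  "osc y = y * cos (vlog (y\<^sup>2) / 5)"

lemma vlog_sq_deriv:
  assumes "y \<noteq> 0"
  shows "((\<lambda>y. vlog (y\<^sup>2)) has_real_derivative - 2 / (y * (1 + y\<^sup>2))) (at y)"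
proof -
  have y: "y\<^sup>2 > 0" using assms by simp
  have d: "((\<lambda>y::real. y\<^sup>2) has_real_derivative 2 * y) (at y)"
    by (auto intro!: derivative_eq_intros)
  have "1 + y\<^sup>2 > 0" using y by (rule pos_add_strict[OF zero_less_one])
  with DERIV_chain2[OF vlog_deriv[OF y] d] show ?thesis
    using assms by (auto simp: divide_simps power2_eq_square power3_eq_cube)
qed

lemma osc_deriv:
  assumes "y \<noteq> 0"
  shows "(osc has_real_derivative cos (vlog (y\<^sup>2) / 5)
     + 2 / 5 * sin (vlog (y\<^sup>2) / 5) / (1 + y\<^sup>2)) (at y)"
proof -
  have "1 + y\<^sup>2 > 0" using assms by (simp add: add_pos_nonneg)
  then show ?thesis
  unfolding osc_def
    apply -
    apply (rule DERIV_cong, (rule derivative_intros vlog_sq_deriv assms refl)+)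
    using assms by simp_all
qed

lemma osc_sq_eq: "osc_sq y = (osc y)\<^sup>2" by (simp add: osc_sq_def osc_def)

lemma osc_sq_deriv:
  assumes "y \<noteq> 0" shows "(osc_sq has_real_derivative osc_sq' y) (at y)"
  unfolding osc_sq_eq[abs_def]
  by (rule DERIV_cong, (rule derivative_intros osc_deriv assms refl)+)
    (simp add: osc_sq'_def osc_def algebra_simps power2_eq_square)

lemma osc_sq_nonneg: "0 \<le> osc_sq y" by (simp add: osc_sq_def)

lemma osc_sq_le: "osc_sq y \<le> y\<^sup>2"
proof -
  have "(cos (vlog (y\<^sup>2) / 5))\<^sup>2 \<le> 1" by (simp add: cos_squared_eq)
  then show ?thesis unfolding osc_sq_def power_mult_distrib
    by (intro mult_left_le) auto
qed

lemma osc_sq_even: "osc_sq (- y) = osc_sq y" "osc_sq \<bar>y\<bar> = osc_sq y" by (auto simp: osc_sq_def power_mult_distrib)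

text \<open>The phase has a derivative of order \<open>1 / y\<close>, which the factor
  \<open>y\<^sup>2\<close> turns into order \<open>y\<close>. The bound is therefore the one for
  \<open>y\<^sup>2\<close>, up to a constant.\<close>

lemma osc_sq'_bound: "\<bar>osc_sq' y\<bar> \<le> 3 * \<bar>y\<bar>"
proof -
  define c s where "c = cos (vlog (y\<^sup>2) / 5)" and "s = sin (vlog (y\<^sup>2) / 5)"
  have c: "\<bar>c\<bar> \<le> 1" "\<bar>s\<bar> \<le> 1" unfolding c_def s_def by auto
  have c2: "c\<^sup>2 \<le> 1" using c by (simp add: abs_square_le_1)
  have "\<bar>c * s\<bar> \<le> 1" using c by (simp add: abs_mult mult_le_one)
  then have cs: "\<bar>c * s\<bar> / (1 + y\<^sup>2) \<le> 1"
    by (smt (verit, best) divide_le_eq_1 zero_le_power2)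
  have "osc_sq' y = y * (2 * c\<^sup>2) + y * (4/5 * (c * s / (1 + y\<^sup>2)))"
    unfolding osc_sq'_def c_def[symmetric] s_def[symmetric] by simp
  also have "\<bar>\<dots>\<bar> \<le> \<bar>y\<bar> * 2 + \<bar>y\<bar> * 1"
  proof (intro order_trans[OF abs_triangle_ineq] add_mono)
    show "\<bar>y * (2 * c\<^sup>2)\<bar> \<le> \<bar>y\<bar> * 2"
      unfolding abs_mult[of y] using c2 by (intro mult_left_mono) auto
    have "\<bar>c * s / (1 + y\<^sup>2)\<bar> \<le> 1" using cs by (simp add: abs_mult)
    then show "\<bar>y * (4/5 * (c * s / (1 + y\<^sup>2)))\<bar> \<le> \<bar>y\<bar> * 1"
      unfolding abs_mult[of y] by (intro mult_left_mono) linarith+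
  qed
  finally show ?thesis by simp
qed

definition kappa1 :: "real \<Rightarrow> real" where
  "kappa1 t = - (kappa t * kappa_rate t)"

lemma kappa1_bound: "t > 0 \<Longrightarrow> \<bar>kappa1 t\<bar> \<le> kappa t * (3 / (2 * t))"
  using kappa_rate_bound[of t] kappa_rate_nonneg[of t] kappa_pos[of t]
    mult_left_mono[of "kappa_rate t" "3 / (2 * t)" "kappa t"]
  by (simp add: kappa1_def abs_mult)

section \<open>The first component of the field and its derivatives\<close>

definition speed :: "real \<Rightarrow> real \<Rightarrow> real" where
  "speed x y = kappa (x\<^sup>2 + y\<^sup>2) * (x\<^sup>2 + osc_sq y)"

definition speed_x :: "real \<Rightarrow> real \<Rightarrow> real" where
  "speed_x x y = 2 * x * kappa (x\<^sup>2 + y\<^sup>2) + 2 * x * kappa1 (x\<^sup>2 + y\<^sup>2) * (x\<^sup>2 + osc_sq y)"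

definition speed_y :: "real \<Rightarrow> real \<Rightarrow> real" where
  "speed_y x y = 2 * y * kappa1 (x\<^sup>2 + y\<^sup>2) * (x\<^sup>2 + osc_sq y) + kappa (x\<^sup>2 + y\<^sup>2) * osc_sq' y"

definition speed_xx :: "real \<Rightarrow> real \<Rightarrow> real" where
  "speed_xx x y = 2 * kappa (x\<^sup>2 + y\<^sup>2) + 8 * x\<^sup>2 * kappa1 (x\<^sup>2 + y\<^sup>2)
     + (2 * kappa1 (x\<^sup>2 + y\<^sup>2) + 4 * x\<^sup>2 * kappa2 (x\<^sup>2 + y\<^sup>2)) * (x\<^sup>2 + osc_sq y)"

lemma speed_nonneg: "0 \<le> speed x y"
  using kappa_pos[of "x\<^sup>2 + y\<^sup>2"] osc_sq_nonneg[of y] by (simp add: speed_def)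

lemma sum_sq_pos: "x \<noteq> 0 \<or> y \<noteq> 0 \<Longrightarrow> 0 < x\<^sup>2 + y\<^sup>2" for x y :: real
  by (simp add: sum_power2_gt_zero_iff)

lemma speed_pos: "x \<noteq> 0 \<or> osc_sq y \<noteq> 0 \<Longrightarrow> 0 < speed x y"
  using kappa_pos[of "x\<^sup>2 + y\<^sup>2"] osc_sq_nonneg[of y]
  unfolding speed_def by (intro mult_pos_pos) (auto intro: add_pos_nonneg add_nonneg_pos)

lemma speed_le_rho: "speed x y \<le> rho (x\<^sup>2 + y\<^sup>2)"
  using kappa_pos[of "x\<^sup>2 + y\<^sup>2"] osc_sq_le[of y]
    mult_right_mono[of "x\<^sup>2 + osc_sq y" "x\<^sup>2 + y\<^sup>2" "kappa (x\<^sup>2 + y\<^sup>2)"]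
  by (simp add: speed_def rho_def mult.commute)

lemma speed_le: "speed x y \<le> 16"
  using speed_le_rho[of x y] rho_le[of "x\<^sup>2 + y\<^sup>2"] by simp

lemma kappa_sq_deriv_x:
  assumes "x \<noteq> 0 \<or> y \<noteq> 0"
  shows "((\<lambda>x. kappa (x\<^sup>2 + y\<^sup>2)) has_real_derivative 2 * x * kappa1 (x\<^sup>2 + y\<^sup>2)) (at x)"
    "((\<lambda>x. kappa1 (x\<^sup>2 + y\<^sup>2)) has_real_derivative 2 * x * kappa2 (x\<^sup>2 + y\<^sup>2)) (at x)"
proof -
  have d: "((\<lambda>x. x\<^sup>2 + y\<^sup>2) has_real_derivative 2 * x) (at x)"
    by (auto intro!: derivative_eq_intros)
  show "((\<lambda>x. kappa (x\<^sup>2 + y\<^sup>2)) has_real_derivative 2 * x * kappa1 (x\<^sup>2 + y\<^sup>2)) (at x)"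
    using DERIV_chain2[OF kappa_deriv[OF sum_sq_pos[OF assms]] d] by (simp add: kappa1_def mult.commute)
  show "((\<lambda>x. kappa1 (x\<^sup>2 + y\<^sup>2)) has_real_derivative 2 * x * kappa2 (x\<^sup>2 + y\<^sup>2)) (at x)"
    using DERIV_chain2[OF kappa2_deriv[OF sum_sq_pos[OF assms]] d]
    by (simp add: kappa1_def mult.commute[of "kappa2 _"])
qed

lemma kappa_sq_deriv_y:
  assumes "x \<noteq> 0 \<or> y \<noteq> 0"
  shows "((\<lambda>y. kappa (x\<^sup>2 + y\<^sup>2)) has_real_derivative 2 * y * kappa1 (x\<^sup>2 + y\<^sup>2)) (at y)"
  using kappa_sq_deriv_x(1)[of y x] assms by (simp add: add.commute disj_commute)

lemma speed_deriv_x: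
  assumes "x \<noteq> 0 \<or> y \<noteq> 0"
  shows "((\<lambda>x. speed x y) has_real_derivative speed_x x y) (at x)"
  unfolding speed_def
  by (rule DERIV_cong, (rule derivative_intros kappa_sq_deriv_x(1)[OF assms] refl)+)
    (simp add: speed_x_def algebra_simps)

lemma speed_x_deriv:
  assumes "x \<noteq> 0 \<or> y \<noteq> 0"
  shows "((\<lambda>x. speed_x x y) has_real_derivative speed_xx x y) (at x)"
  unfolding speed_x_def
  by (rule DERIV_cong, (rule derivative_intros kappa_sq_deriv_x[OF assms] refl)+)
    (simp add: speed_xx_def algebra_simps power2_eq_square)

lemma speed_deriv_y:
  assumes "y \<noteq> 0"
  shows "((\<lambda>y. speed x y) has_real_derivative speed_y x y) (at y)"
  unfolding speed_def
  by (rule DERIV_cong, (rule derivative_intros kappa_sq_deriv_y osc_sq_deriv assms disjI2 refl)+)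
    (simp add: speed_y_def algebra_simps)

text \<open>Every derivative of \<open>kappa\<close> costs a factor \<open>1 / t\<close> with
  \<open>t = x\<^sup>2 + y\<^sup>2\<close>, and both \<open>x\<^sup>2\<close> and
  \<open>x\<^sup>2 + osc_sq y\<close> are at most \<open>t\<close>. The costs cancel and multiples
  of \<open>kappa\<close> remain.\<close>

lemma kappa1_mult_bound:
  assumes "x \<noteq> 0 \<or> y \<noteq> 0"
  shows "\<bar>kappa1 (x\<^sup>2 + y\<^sup>2) * (x\<^sup>2 + osc_sq y)\<bar> \<le> 3 / 2 * kappa (x\<^sup>2 + y\<^sup>2)"
    "\<bar>x\<^sup>2 * kappa1 (x\<^sup>2 + y\<^sup>2)\<bar> \<le> 3 / 2 * kappa (x\<^sup>2 + y\<^sup>2)"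
    "\<bar>x\<^sup>2 * kappa2 (x\<^sup>2 + y\<^sup>2) * (x\<^sup>2 + osc_sq y)\<bar> \<le> 5 * kappa (x\<^sup>2 + y\<^sup>2)"
proof -
  define t where "t = x\<^sup>2 + y\<^sup>2"
  have t: "t > 0" using sum_sq_pos[OF assms] by (simp add: t_def)
  have k: "kappa t > 0" using kappa_pos t by simp
  have E: "0 \<le> x\<^sup>2 + osc_sq y" "x\<^sup>2 + osc_sq y \<le> t" using osc_sq_nonneg[of y] osc_sq_le[of y] by (auto simp: t_def)
  have X: "0 \<le> x\<^sup>2" "x\<^sup>2 \<le> t" by (auto simp: t_def)
  have "\<bar>kappa1 t * (x\<^sup>2 + osc_sq y)\<bar> \<le> (kappa t * (3 / (2 * t))) * t"
    unfolding abs_mult using E k t kappa1_bound[OF t] by (intro mult_mono) auto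
  then show "\<bar>kappa1 (x\<^sup>2 + y\<^sup>2) * (x\<^sup>2 + osc_sq y)\<bar> \<le> 3 / 2 * kappa (x\<^sup>2 + y\<^sup>2)"
    using t unfolding t_def[symmetric] by (simp add: field_simps)
  have "\<bar>x\<^sup>2 * kappa1 t\<bar> \<le> t * (kappa t * (3 / (2 * t)))"
    unfolding abs_mult using X k t kappa1_bound[OF t] by (intro mult_mono) auto
  then show "\<bar>x\<^sup>2 * kappa1 (x\<^sup>2 + y\<^sup>2)\<bar> \<le> 3 / 2 * kappa (x\<^sup>2 + y\<^sup>2)"
    using t unfolding t_def[symmetric] by (simp add: field_simps)
  have "\<bar>x\<^sup>2 * kappa2 t * (x\<^sup>2 + osc_sq y)\<bar> \<le> t * (kappa t * (5 / t\<^sup>2)) * t"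
    unfolding abs_mult using X E k t kappa2_bound[OF t] by (intro mult_mono mult_nonneg_nonneg) auto
  then show "\<bar>x\<^sup>2 * kappa2 (x\<^sup>2 + y\<^sup>2) * (x\<^sup>2 + osc_sq y)\<bar> \<le> 5 * kappa (x\<^sup>2 + y\<^sup>2)"
    using t unfolding t_def[symmetric] by (simp add: field_simps power2_eq_square)
qed

lemma speed_x_bound: "\<bar>speed_x x y\<bar> \<le> 5 * \<bar>x\<bar> * kappa (x\<^sup>2 + y\<^sup>2)"
proof (cases "x = 0")
  case True then show ?thesis by (simp add: speed_x_def)
next
  case False
  let ?k = "kappa (x\<^sup>2 + y\<^sup>2)"
  have k: "?k > 0" using kappa_pos[of "x\<^sup>2 + y\<^sup>2"] by simp
  have "\<bar>?k + kappa1 (x\<^sup>2 + y\<^sup>2) * (x\<^sup>2 + osc_sq y)\<bar> \<le> 5 / 2 * ?k"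
    using kappa1_mult_bound(1)[of x y] False k by linarith
  then have "\<bar>2 * x\<bar> * \<bar>?k + kappa1 (x\<^sup>2 + y\<^sup>2) * (x\<^sup>2 + osc_sq y)\<bar> \<le> \<bar>2 * x\<bar> * (5 / 2 * ?k)"
    by (intro mult_left_mono) auto
  then show ?thesis unfolding speed_x_def abs_mult[symmetric] by (simp add: algebra_simps abs_mult)
qed

lemma speed_xx_bound: "x \<noteq> 0 \<Longrightarrow> \<bar>speed_xx x y\<bar> \<le> 40 * kappa (x\<^sup>2 + y\<^sup>2)"
proof -
  assume x: "x \<noteq> 0"
  let ?k = "kappa (x\<^sup>2 + y\<^sup>2)"
  have k: "?k > 0" using kappa_pos[of "x\<^sup>2 + y\<^sup>2"] by simp
  have "speed_xx x y = 2 * ?k + 8 * (x\<^sup>2 * kappa1 (x\<^sup>2 + y\<^sup>2)) + 2 * (kappa1 (x\<^sup>2 + y\<^sup>2) * (x\<^sup>2 + osc_sq y))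
     + 4 * (x\<^sup>2 * kappa2 (x\<^sup>2 + y\<^sup>2) * (x\<^sup>2 + osc_sq y))"
    unfolding speed_xx_def by (simp add: algebra_simps)
  then show ?thesis using kappa1_mult_bound[of x y] x k by linarith
qed

lemma speed_y_bound: "\<bar>speed_y x y\<bar> \<le> 6 * \<bar>y\<bar> * kappa (x\<^sup>2 + y\<^sup>2)"
proof (cases "y = 0")
  case True then show ?thesis by (simp add: speed_y_def osc_sq'_def)
next
  case False
  let ?k = "kappa (x\<^sup>2 + y\<^sup>2)"
  have k: "?k > 0" using kappa_pos[of "x\<^sup>2 + y\<^sup>2"] by simp
  have "\<bar>2 * y * kappa1 (x\<^sup>2 + y\<^sup>2) * (x\<^sup>2 + osc_sq y)\<bar> \<le> \<bar>2 * y\<bar> * (3 / 2 * ?k)"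
    unfolding mult.assoc[of "2 * y"] abs_mult[of "2 * y"]
    using kappa1_mult_bound(1)[of x y] False by (intro mult_left_mono) auto
  moreover have "\<bar>?k * osc_sq' y\<bar> \<le> ?k * (3 * \<bar>y\<bar>)"
    unfolding abs_mult using k osc_sq'_bound[of y] by (intro mult_mono) auto
  ultimately show ?thesis unfolding speed_y_def
    by (intro order_trans[OF abs_triangle_ineq]) (simp add: abs_mult[of 2] mult.commute)
qed

lemma power2_powr: "x \<noteq> 0 \<Longrightarrow> (x\<^sup>2) powr a = \<bar>x\<bar> powr (2 * a)" for x :: real
  using ln_realpow[of "\<bar>x\<bar>" 2] by (simp add: powr_def)

text \<open>As \<open>t powr (- (1 + e) / 2)\<close> is the product of \<open>t powr (- e)\<close>
  and \<open>t powr ((e - 1) / 2)\<close>, the first factor is bounded through \<open>x\<close> and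
  the second through \<open>y\<close>. The power of \<open>y\<close> is integrable at 0, so
  primitives in \<open>y\<close> are left with an arbitrarily weak singularity in
  \<open>x\<close>.\<close>

lemma kappa_powr_bound_abs:
  assumes "x \<noteq> 0" "y \<noteq> 0" and e: "0 < e" "e < 1"
  shows "kappa (x\<^sup>2 + y\<^sup>2) \<le> (4 + 4 / e)\<^sup>2 * \<bar>x\<bar> powr (- 2 * e) * \<bar>y\<bar> powr (e - 1)"
proof -
  define t where "t = x\<^sup>2 + y\<^sup>2"
  have t: "t > 0" using sum_sq_pos assms by (simp add: t_def)
  have "t powr (- (1 + e) / 2) = t powr (- e) * t powr ((e - 1) / 2)"
    unfolding powr_add[symmetric] by (rule arg_cong[of _ _ "\<lambda>a. t powr a"]) (simp add: field_simps)
  also have "\<dots> \<le> (x\<^sup>2) powr (- e) * (y\<^sup>2) powr ((e - 1) / 2)"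
    using assms by (intro mult_mono powr_mono2') (auto simp: t_def)
  also have "\<dots> = \<bar>x\<bar> powr (- 2 * e) * \<bar>y\<bar> powr (e - 1)"
  proof -
    have "2 * ((e - 1) / 2) = e - 1" "2 * - e = - 2 * e" by simp_all
    then show ?thesis unfolding power2_powr[OF assms(1)] power2_powr[OF assms(2)] by metis
  qed
  finally have "t powr (- (1 + e) / 2) \<le> \<bar>x\<bar> powr (- 2 * e) * \<bar>y\<bar> powr (e - 1)" .
  then have "(4 + 4 / e)\<^sup>2 * t powr (- (1 + e) / 2) \<le> (4 + 4 / e)\<^sup>2 * (\<bar>x\<bar> powr (- 2 * e) * \<bar>y\<bar> powr (e - 1))"
    by (rule mult_left_mono) simp
  moreover have "kappa t \<le> (4 + 4 / e)\<^sup>2 * t powr (- (1 + e) / 2)"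
    using kappa_powr_bound[of t e] t e by simp
  ultimately show ?thesis unfolding t_def[symmetric] mult.assoc by (rule order_trans[rotated])
qed

lemma abs_kappa_bound:
  assumes "x \<noteq> 0" and e: "0 < e" "e < 1" and z: "\<bar>z\<bar> \<le> \<bar>x\<bar> \<or> \<bar>z\<bar> \<le> \<bar>y\<bar>"
  shows "\<bar>z\<bar> * kappa (x\<^sup>2 + y\<^sup>2) \<le> (4 + 4 / e)\<^sup>2 * \<bar>x\<bar> powr (- e)"
proof -
  define t where "t = x\<^sup>2 + y\<^sup>2"
  have t: "t > 0" using sum_sq_pos assms by (simp add: t_def)
  have "z\<^sup>2 \<le> t" using z by (auto simp: t_def abs_le_square_iff add_increasing add_increasing2)
  then have "\<bar>z\<bar> \<le> t powr (1 / 2)" using t by (simp add: powr_half_sqrt real_le_rsqrt)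
  then have "\<bar>z\<bar> * kappa t \<le> t powr (1 / 2) * ((4 + 4 / e)\<^sup>2 * t powr (- (1 + e) / 2))"
    using kappa_powr_bound[of t e] t e kappa_pos[of t] by (intro mult_mono) auto
  also have "\<dots> = (4 + 4 / e)\<^sup>2 * t powr (- e / 2)"
    by (simp add: powr_add[symmetric] mult.left_commute) (simp add: field_simps)
  also have "t powr (- e / 2) \<le> (x\<^sup>2) powr (- e / 2)"
    using assms by (intro powr_mono2') (auto simp: t_def)
  also have "(x\<^sup>2) powr (- e / 2) = \<bar>x\<bar> powr (- e)"
    using assms by (simp add: power2_powr)
  finally show ?thesis unfolding t_def by (simp add: mult_left_mono)
qed

lemma continuous_osc_sq: "continuous_on UNIV osc_sq"
proof -
  have "isCont osc_sq y" for y
  proof (cases "y = 0")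
    case False then show ?thesis using osc_sq_deriv DERIV_isCont by blast
  next
    case True
    have "(osc_sq \<longlongrightarrow> 0) (at 0)"
    proof (rule tendsto_sandwich[where f="\<lambda>_. 0" and h="\<lambda>y. y\<^sup>2"])
      show "((\<lambda>y::real. y\<^sup>2) \<longlongrightarrow> 0) (at 0)" by (auto intro!: tendsto_eq_intros)
    qed (auto simp: osc_sq_nonneg osc_sq_le)
    then show ?thesis using True by (simp add: isCont_def osc_sq_def)
  qed
  then show ?thesis by (simp add: continuous_at_imp_continuous_on)
qed

lemma continuous_kappa: "continuous_on {0<..} kappa" "continuous_on {0<..} kappa1" "continuous_on {0<..} kappa2"
proof -
  show "continuous_on {0<..} kappa"
    using kappa_deriv DERIV_isCont by (intro continuous_at_imp_continuous_on) blast
  show "continuous_on {0<..} kappa1"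
    unfolding kappa1_def[abs_def] using kappa2_deriv DERIV_isCont by (intro continuous_at_imp_continuous_on) blast
  have "continuous_on {0<..} vlog"
    using vlog_deriv DERIV_isCont by (intro continuous_at_imp_continuous_on) blast
  moreover have "4 + vlog t \<noteq> 0" if "t > 0" for t using vlog_pos[OF that] by simp
  ultimately have r': "continuous_on {0<..} kappa_rate'"
    unfolding kappa_rate'_def by (intro continuous_intros) (auto simp: add_eq_0_iff)
  have "continuous_on {0<..} kappa_rate"
    using kappa_rate_deriv DERIV_isCont by (intro continuous_at_imp_continuous_on) blast
  then show "continuous_on {0<..} kappa2"
    unfolding kappa2_def[abs_def] using r' \<open>continuous_on {0<..} kappa\<close> by (intro continuous_intros)
qed

lemma continuous_speed_off:
  "continuous_on (- {(0, 0)}) (\<lambda>(x, y). speed x y)"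
proof -
  have "(fst z)\<^sup>2 + (snd z)\<^sup>2 \<in> {0<..}" if "z \<in> - {(0, 0)}" for z :: "real \<times> real"
  proof (cases z)
    case (Pair a b)
    then have "a \<noteq> 0 \<or> b \<noteq> 0" using that by auto
    then show ?thesis using sum_sq_pos[of a b] Pair by simp
  qed
  then have i: "(\<lambda>z. (fst z)\<^sup>2 + (snd z)\<^sup>2) ` (- {(0, 0)}) \<subseteq> {0::real<..}" by blast
  show ?thesis unfolding speed_def case_prod_unfold
    by (intro continuous_intros continuous_on_compose2[OF continuous_kappa(1) _ i] continuous_on_compose2[OF continuous_osc_sq] subset_UNIV)
qed

lemma continuous_speed_x:
  "continuous_on ((- {0}) \<times> UNIV) (\<lambda>(x, y). speed_x x y)"
  "continuous_on ((- {0}) \<times> UNIV) (\<lambda>(x, y). speed_xx x y)"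
proof -
  have "(fst z)\<^sup>2 + (snd z)\<^sup>2 \<in> {0<..}" if "z \<in> ((- {0}) \<times> UNIV)" for z :: "real \<times> real"
  proof (cases z)
    case (Pair a b)
    then have "a \<noteq> 0" using that by auto
    then show ?thesis using sum_sq_pos[of a b] Pair by simp
  qed
  then have i: "(\<lambda>z. (fst z)\<^sup>2 + (snd z)\<^sup>2) ` ((- {0}) \<times> UNIV) \<subseteq> {0::real<..}" by blast
  have c: "continuous_on ((- {0}) \<times> UNIV) (\<lambda>z::real\<times>real. (fst z)\<^sup>2 + (snd z)\<^sup>2)"
    by (intro continuous_intros)
  note k = continuous_on_compose2[OF continuous_kappa(1) c i]
    continuous_on_compose2[OF continuous_kappa(2) c i] continuous_on_compose2[OF continuous_kappa(3) c i]
  have m: "continuous_on ((- {0}) \<times> UNIV) (\<lambda>z::real\<times>real. osc_sq (snd z))"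
    by (rule continuous_on_compose2[OF continuous_osc_sq]) (auto intro!: continuous_intros)
  show "continuous_on ((- {0}) \<times> UNIV) (\<lambda>(x, y). speed_x x y)"
    "continuous_on ((- {0}) \<times> UNIV) (\<lambda>(x, y). speed_xx x y)"
    unfolding speed_x_def speed_xx_def case_prod_unfold
    by (intro continuous_intros k m)+
qed

lemma rho_tendsto_0: "((\<lambda>z::real\<times>real. rho ((fst z)\<^sup>2 + (snd z)\<^sup>2)) \<longlongrightarrow> 0) (at (0, 0))"
proof (rule tendsto_sandwich[where f="\<lambda>_. 0" and h="\<lambda>z. 400 * ((fst z)\<^sup>2 + (snd z)\<^sup>2) powr (1 / 4)"])
  show "((\<lambda>z::real\<times>real. 400 * ((fst z)\<^sup>2 + (snd z)\<^sup>2) powr (1 / 4)) \<longlongrightarrow> 0) (at (0, 0))"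
  proof -
    have "((\<lambda>z::real\<times>real. (fst z)\<^sup>2 + (snd z)\<^sup>2) \<longlongrightarrow> 0) (at (0, 0))"
      by (auto intro!: tendsto_eq_intros)
    from tendsto_zero_powrI[OF this tendsto_const[of "1/4"]] show ?thesis
      by (auto intro!: tendsto_eq_intros)
  qed
  have "rho t \<le> 400 * t powr (1 / 4)" if "t \<ge> 0" for t
  proof (cases "t = 0")
    case False
    then have t: "t > 0" using that by simp
    have "rho t \<le> t powr 1 * ((4 + 4 / (1/2))\<^sup>2 * t powr (- (1 + 1/2) / 2))"
      unfolding rho_def using t kappa_powr_bound[of t "1/2"] by (intro mult_mono) (auto simp: kappa_pos less_imp_le)
    also have "\<dots> = 144 * t powr (1 / 4)"
      unfolding mult.left_commute[of "t powr 1"] powr_add[symmetric] by simp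
    finally show ?thesis by (smt (verit) powr_ge_zero)
  qed (simp add: rho_def)
  then show "\<forall>\<^sub>F z in at (0::real, 0::real). rho ((fst z)\<^sup>2 + (snd z)\<^sup>2) \<le> 400 * ((fst z)\<^sup>2 + (snd z)\<^sup>2) powr (1 / 4)"
    by simp
qed (auto simp: rho_nonneg)

lemma continuous_speed: "continuous_on UNIV (\<lambda>(x, y). speed x y)"
proof -
  have "isCont (\<lambda>(x, y). speed x y) z" for z
  proof (cases "z = (0, 0)")
    case False
    then show ?thesis
      using continuous_speed_off by (subst (asm) continuous_on_eq_continuous_at) auto
  next
    case True
    have "((\<lambda>(x, y). speed x y) \<longlongrightarrow> 0) (at (0, 0))"
      by (rule tendsto_sandwich[OF _ _ tendsto_const rho_tendsto_0])
        (auto simp: speed_nonneg speed_le_rho case_prod_unfold)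
    moreover have "speed 0 0 = 0" by (simp add: speed_def osc_sq_def)
    ultimately show ?thesis using True by (simp add: isCont_def)
  qed
  then show ?thesis by (simp add: continuous_at_imp_continuous_on)
qed

lemma continuous_on_case_prod_compose:
  assumes "continuous_on S (\<lambda>(x, y). f x y)" "continuous_on A g" "continuous_on A h"
    "\<And>a. a \<in> A \<Longrightarrow> (g a, h a) \<in> S"
  shows "continuous_on A (\<lambda>a. f (g a) (h a))"
  using continuous_on_compose2[OF assms(1), of A "\<lambda>a. (g a, h a)"] assms
  by (auto intro!: continuous_intros)

lemma real_differentiableI: "(f has_real_derivative D) F \<Longrightarrow> f differentiable F"
  by (rule differentiableI[OF has_field_derivative_imp_has_derivative])

section \<open>The stream function\<close>

text \<open>The integral from \<open>0\<close> to \<open>y\<close>, scaled to the unit interval so that it has the right sign for negative \<open>y\<close>.\<close>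

definition primitive :: "(real \<Rightarrow> real) \<Rightarrow> real \<Rightarrow> real" where
  "primitive f y = y * integral {0..1} (\<lambda>u. f (u * y))"

lemma primitive_0 [simp]: "primitive f 0 = 0" by (simp add: primitive_def)

lemma antiderivative_real_line:
  fixes f :: "real \<Rightarrow> real"
  assumes "continuous_on UNIV f"
  obtains F where "\<And>x. (F has_real_derivative f x) (at x)"
proof -
  have "\<exists>F. \<forall>x. -\<infinity> < ereal x \<longrightarrow> ereal x < \<infinity> \<longrightarrow> (F has_vector_derivative f x) (at x)"
    using assms by (intro einterval_antiderivative)
      (auto simp: continuous_on_eq_continuous_at)
  then show ?thesis using that by (auto simp: has_real_derivative_iff_has_vector_derivative)
qed

lemma primitive_eq:
  assumes "\<And>x. (F has_real_derivative f x) (at x)"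
  shows "primitive f y = F y - F 0"
proof -
  have "((\<lambda>u. y * f (u * y)) has_integral F (1 * y) - F (0 * y)) {0..1}"
  proof (rule fundamental_theorem_of_calculus)
    fix u :: real
    have "((\<lambda>u. F (u * y)) has_real_derivative f (u * y) * y) (at u)"
      by (rule DERIV_chain2[OF assms]) (auto intro!: derivative_eq_intros)
    then show "((\<lambda>u. F (u * y)) has_vector_derivative y * f (u * y)) (at u within {0..1})"
      by (simp add: has_real_derivative_iff_has_vector_derivative mult.commute has_vector_derivative_at_within)
  qed simp
  then have "integral {0..1} (\<lambda>u. y * f (u * y)) = F (1 * y) - F (0 * y)" by (rule integral_unique)
  then show ?thesis by (simp add: primitive_def)
qed

lemma primitive_deriv:
  assumes "continuous_on UNIV f"
  shows "(primitive f has_real_derivative f y) (at y)"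
proof -
  obtain F where F: "\<And>x. (F has_real_derivative f x) (at x)"
    using antiderivative_real_line[OF assms] by blast
  have "primitive f = (\<lambda>y. F y - F 0)" using primitive_eq[OF F] by blast
  then show ?thesis by (auto intro!: derivative_eq_intros F)
qed

lemma primitive_continuous:
  assumes "continuous_on (U \<times> UNIV) (\<lambda>(x, s). f x s)"
  shows "continuous_on (U \<times> UNIV) (\<lambda>(x, y). primitive (f x) y)"
proof -
  have "continuous_on ((U \<times> UNIV) \<times> cbox 0 1) (\<lambda>(z, u). f (fst z) (u * snd z))"
    unfolding case_prod_unfold
    by (rule continuous_on_case_prod_compose[OF assms]) (auto intro!: continuous_intros)
  from integral_continuous_on_param[OF this] show ?thesis
    unfolding primitive_def case_prod_unfold by (intro continuous_intros) (simp add: cbox_interval)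
qed

lemma primitive_leibniz:
  assumes U: "open U" "convex U" "x \<in> U"
    and d: "\<And>x s. x \<in> U \<Longrightarrow> ((\<lambda>x. f x s) has_real_derivative f' x s) (at x)"
    and c: "\<And>x. x \<in> U \<Longrightarrow> continuous_on UNIV (f x)"
    and c': "continuous_on (U \<times> UNIV) (\<lambda>(x, s). f' x s)"
  shows "((\<lambda>x. primitive (f x) y) has_real_derivative primitive (f' x) y) (at x)"
proof -
  have "((\<lambda>x. integral (cbox 0 1) (\<lambda>u. f x (u * y))) has_field_derivative
      integral (cbox 0 1) (\<lambda>u. f' x (u * y))) (at x within U)"
  proof (rule leibniz_rule_field_derivative)
    show "continuous_on (U \<times> cbox 0 1) (\<lambda>(x, t). f' x (t * y))"
      unfolding case_prod_unfold
      by (rule continuous_on_case_prod_compose[OF c']) (auto intro!: continuous_intros)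
    show "(\<lambda>u. f x (u * y)) integrable_on cbox 0 1" if "x \<in> U" for x
      by (rule integrable_continuous, rule continuous_on_compose2[OF c[OF that]])
        (auto intro!: continuous_intros)
  qed (use U d in \<open>auto intro: DERIV_subset\<close>)
  then have "((\<lambda>x. integral {0..1} (\<lambda>u. f x (u * y))) has_real_derivative
      integral {0..1} (\<lambda>u. f' x (u * y))) (at x)"
    using U by (simp add: at_within_open[of x U])
  then show ?thesis unfolding primitive_def by (intro DERIV_cmult)
qed

lemma primitive_powr_bound:
  assumes c: "continuous_on UNIV f" and e: "0 < e"
    and b: "\<And>s. s \<noteq> 0 \<Longrightarrow> \<bar>f s\<bar> \<le> C * \<bar>s\<bar> powr (e - 1)"
  shows "\<bar>primitive f y\<bar> \<le> C * \<bar>y\<bar> powr e / e"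
proof (cases "y = 0")
  case True
  then show ?thesis using e by simp
next
  case False
  have i: "((\<lambda>u. C * \<bar>y\<bar> powr e * u powr (e - 1)) has_integral C * \<bar>y\<bar> powr e * (1 powr (e - 1 + 1) / (e - 1 + 1))) {0..1}"
    using e by (intro has_integral_mult_right has_integral_powr_from_0) auto
  \<comment> \<open>The value of \<open>0 powr (e - 1)\<close> is 0, while the hypothesis gives no
    bound for \<open>f\<close> at 0. The majorant is therefore altered at \<open>u = 0\<close>, a
    null set.\<close>
  have "norm (integral {0..1} (\<lambda>u. y * f (u * y)))
      \<le> integral {0..1} (\<lambda>u. if u = 0 then \<bar>y * f (u * y)\<bar> else C * \<bar>y\<bar> powr e * u powr (e - 1))"
  proof (rule integral_norm_bound_integral)
    show "(\<lambda>u. y * f (u * y)) integrable_on {0..1}"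
      by (rule integrable_continuous_interval) (intro continuous_intros continuous_on_compose2[OF c], auto)
    show "(\<lambda>u. if u = 0 then \<bar>y * f (u * y)\<bar> else C * \<bar>y\<bar> powr e * u powr (e - 1)) integrable_on {0..1}"
      using integrable_spike[OF has_integral_integrable[OF i], of "{0}"] by auto
    show "norm (y * f (u * y)) \<le> (if u = 0 then \<bar>y * f (u * y)\<bar> else C * \<bar>y\<bar> powr e * u powr (e - 1))"
      if "u \<in> {0..1}" for u :: real
    proof (cases "u = 0")
      case False
      then have u: "u > 0" using that by simp
      have "norm (y * f (u * y)) \<le> \<bar>y\<bar> * (C * \<bar>u * y\<bar> powr (e - 1))"
        using b[of "u * y"] False \<open>y \<noteq> 0\<close> by (simp add: abs_mult mult_left_mono)
      also have "\<dots> = C * (\<bar>y\<bar> powr 1 * \<bar>y\<bar> powr (e - 1)) * u powr (e - 1)"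
        using u by (simp add: abs_mult powr_mult)
      finally show ?thesis using False unfolding powr_add[symmetric] by simp
    qed simp
  qed
  also have "\<dots> = integral {0..1} (\<lambda>u. C * \<bar>y\<bar> powr e * u powr (e - 1))"
    by (rule integral_spike[of "{0}"]) auto
  also have "\<dots> = C * \<bar>y\<bar> powr e / e" using integral_unique[OF i] by simp
  finally show ?thesis by (simp add: primitive_def)
qed

definition stream :: "real \<Rightarrow> real \<Rightarrow> real" where
  "stream x y = primitive (speed x) y"

text \<open>The sign makes \<open>speed\<close> and \<open>vel2\<close> the components of the
  perpendicular gradient of \<open>stream\<close>, see \<open>stream_deriv_x\<close>.\<close>

definition vel2 :: "real \<Rightarrow> real \<Rightarrow> real" where
  "vel2 x y = - primitive (speed_x x) y"

definition vel2_x :: "real \<Rightarrow> real \<Rightarrow> real" where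
  "vel2_x x y = - primitive (speed_xx x) y"

lemma continuous_speed_slice: "continuous_on UNIV (speed x)"
  by (rule continuous_on_case_prod_compose[OF continuous_speed]) (auto intro!: continuous_intros)

lemma continuous_speed_x_slice: "continuous_on UNIV (speed_x x)"
proof (cases "x = 0")
  case True then show ?thesis by (simp add: speed_x_def[abs_def])
next
  case False then show ?thesis
    by (intro continuous_on_case_prod_compose[OF continuous_speed_x(1)]) (auto intro!: continuous_intros)
qed

lemma continuous_speed_xx_slice: "x \<noteq> 0 \<Longrightarrow> continuous_on UNIV (speed_xx x)"
  by (rule continuous_on_case_prod_compose[OF continuous_speed_x(2)]) (auto intro!: continuous_intros)

lemma stream_deriv_y: "((\<lambda>y. stream x y) has_real_derivative speed x y) (at y)"
  unfolding stream_def by (rule primitive_deriv[OF continuous_speed_slice])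

lemma vel2_deriv_y: "((\<lambda>y. vel2 x y) has_real_derivative - speed_x x y) (at y)"
  unfolding vel2_def by (intro DERIV_minus primitive_deriv[OF continuous_speed_x_slice])

lemma vel2_zero [simp]: "vel2 0 y = 0"
  by (simp add: vel2_def primitive_def speed_x_def)

lemma stream_zero [simp]: "stream x 0 = 0"
  by (simp add: stream_def)

lemma convex_nbhd_nonzero:
  fixes x :: real assumes "x \<noteq> 0"
  obtains U where "open U" "convex U" "x \<in> U" "U \<subseteq> - {0}"
proof (cases "x > 0")
  case True then show ?thesis using that[of "{0<..}"] by auto
next
  case False then show ?thesis using that[of "{..<0}"] assms by auto
qed

lemma stream_deriv_x_off:
  assumes "x \<noteq> 0" shows "((\<lambda>x. stream x y) has_real_derivative - vel2 x y) (at x)"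
proof -
  obtain U where U: "open U" "convex U" "x \<in> U" "U \<subseteq> - {0}" using convex_nbhd_nonzero[OF assms] .
  then show ?thesis unfolding stream_def vel2_def minus_minus
    by (intro primitive_leibniz[of U] speed_deriv_x continuous_speed_slice
      continuous_on_subset[OF continuous_speed_x(1)]) auto
qed

lemma vel2_deriv_x:
  assumes "x \<noteq> 0" shows "((\<lambda>x. vel2 x y) has_real_derivative vel2_x x y) (at x)"
proof -
  obtain U where U: "open U" "convex U" "x \<in> U" "U \<subseteq> - {0}" using convex_nbhd_nonzero[OF assms] .
  then show ?thesis unfolding vel2_def vel2_x_def
    by (intro DERIV_minus primitive_leibniz[of U] speed_x_deriv continuous_speed_x_slice
      continuous_on_subset[OF continuous_speed_x(2)]) auto
qed

lemma vel2_powr_bound: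
  assumes "x \<noteq> 0" and e: "0 < e" "e < 1"
  shows "\<bar>vel2 x y\<bar> \<le> 5 * (4 + 4 / e)\<^sup>2 * \<bar>x\<bar> powr (1 - 2 * e) * \<bar>y\<bar> powr e / e"
  unfolding vel2_def abs_minus_cancel
proof (rule primitive_powr_bound[OF continuous_speed_x_slice e(1)])
  fix s :: real assume "s \<noteq> 0"
  have "\<bar>speed_x x s\<bar> \<le> 5 * \<bar>x\<bar> * ((4 + 4 / e)\<^sup>2 * \<bar>x\<bar> powr (- 2 * e) * \<bar>s\<bar> powr (e - 1))"
    using mult_left_mono[OF kappa_powr_bound_abs[OF assms(1) \<open>s \<noteq> 0\<close> e], of "5 * \<bar>x\<bar>"]
      speed_x_bound[of x s] by simp
  also have "\<dots> = 5 * (4 + 4 / e)\<^sup>2 * (\<bar>x\<bar> powr 1 * \<bar>x\<bar> powr (- 2 * e)) * \<bar>s\<bar> powr (e - 1)" by simp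
  also have "\<bar>x\<bar> powr 1 * \<bar>x\<bar> powr (- 2 * e) = \<bar>x\<bar> powr (1 - 2 * e)" unfolding powr_add[symmetric] by simp
  finally show "\<bar>speed_x x s\<bar> \<le> 5 * (4 + 4 / e)\<^sup>2 * \<bar>x\<bar> powr (1 - 2 * e) * \<bar>s\<bar> powr (e - 1)" .
qed

text \<open>As an integral along a vertical segment that starts on the first axis, this derivative
  is controlled by a power of \<open>\<bar>x\<bar>\<close> and not by the distance from the origin.
  The exponent is arbitrarily close to 0, which suffices for every \<open>p\<close>.\<close>

lemma vel2_x_powr_bound:
  assumes "x \<noteq> 0" and e: "0 < e" "e < 1"
  shows "\<bar>vel2_x x y\<bar> \<le> 40 * (4 + 4 / e)\<^sup>2 * \<bar>x\<bar> powr (- 2 * e) * \<bar>y\<bar> powr e / e"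
  unfolding vel2_x_def abs_minus_cancel
proof (rule primitive_powr_bound[OF continuous_speed_xx_slice[OF assms(1)] e(1)])
  fix s :: real assume "s \<noteq> 0"
  then show "\<bar>speed_xx x s\<bar> \<le> 40 * (4 + 4 / e)\<^sup>2 * \<bar>x\<bar> powr (- 2 * e) * \<bar>s\<bar> powr (e - 1)"
    using kappa_powr_bound_abs[OF assms(1) \<open>s \<noteq> 0\<close> e] speed_xx_bound[OF assms(1), of s] by simp
qed

text \<open>\<open>kappa t \<le> 16 / t\<close> turns the bound of \<open>speed_x\<close> into a
  multiple of the Poisson kernel \<open>\<bar>x\<bar> / (x\<^sup>2 + s\<^sup>2)\<close>, whose
  integral over any segment is at most \<open>pi\<close>, uniformly in \<open>x\<close>.\<close>

lemma vel2_bound: "\<bar>vel2 x y\<bar> \<le> 80 * pi"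
proof (cases "x = 0")
  case False
  have bd: "\<bar>speed_x x s\<bar> \<le> 80 * (\<bar>x\<bar> / (x\<^sup>2 + s\<^sup>2))" for s
  proof -
    have "\<bar>speed_x x s\<bar> \<le> 5 * \<bar>x\<bar> * (16 / (x\<^sup>2 + s\<^sup>2))"
      using speed_x_bound[of x s] mult_left_mono[OF kappa_le[of "x\<^sup>2 + s\<^sup>2"], of "5 * \<bar>x\<bar>"]
        sum_sq_pos[of x s] False by simp
    then show ?thesis by simp
  qed
  have i: "((\<lambda>u. 80 * (\<bar>x\<bar> / (x\<^sup>2 + (u * y)\<^sup>2) * \<bar>y\<bar>)) has_integral
      80 * arctan (1 * \<bar>y\<bar> / \<bar>x\<bar>) - 80 * arctan (0 * \<bar>y\<bar> / \<bar>x\<bar>)) {0..1}"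
  proof (rule fundamental_theorem_of_calculus)
    fix u :: real
    have "((\<lambda>u. u * \<bar>y\<bar> / \<bar>x\<bar>) has_real_derivative \<bar>y\<bar> / \<bar>x\<bar>) (at u within {0..1})"
      using DERIV_cdivide[OF DERIV_cmult_right[OF DERIV_ident[of "at u within {0..1}"], of "\<bar>y\<bar>"], of "\<bar>x\<bar>"] by simp
    from DERIV_cmult[OF DERIV_chain2[OF DERIV_arctan this], of 80]
    have "((\<lambda>u. 80 * arctan (u * \<bar>y\<bar> / \<bar>x\<bar>)) has_real_derivative
      80 * (1 / (1 + (u * \<bar>y\<bar> / \<bar>x\<bar>)\<^sup>2) * (\<bar>y\<bar> / \<bar>x\<bar>))) (at u within {0..1})"
      by (simp add: inverse_eq_divide)
    moreover have "1 / (1 + (u * \<bar>y\<bar> / \<bar>x\<bar>)\<^sup>2) * (\<bar>y\<bar> / \<bar>x\<bar>) = \<bar>x\<bar> / (x\<^sup>2 + (u * y)\<^sup>2) * \<bar>y\<bar>"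
    proof -
      have "x\<^sup>2 + (u * y)\<^sup>2 \<noteq> 0" using sum_sq_pos[of x "u * y"] False by simp
      moreover have "1 + (u * \<bar>y\<bar> / \<bar>x\<bar>)\<^sup>2 = (x\<^sup>2 + (u * y)\<^sup>2) / x\<^sup>2"
        using False by (simp add: field_simps power_mult_distrib)
      moreover have "x\<^sup>2 = \<bar>x\<bar> * \<bar>x\<bar>" by (simp add: power2_eq_square)
      moreover have "\<bar>x\<bar> \<noteq> 0" using False by simp
      ultimately show ?thesis by (simp add: divide_simps)
    qed
    ultimately show "((\<lambda>u. 80 * arctan (u * \<bar>y\<bar> / \<bar>x\<bar>)) has_vector_derivative
       80 * (\<bar>x\<bar> / (x\<^sup>2 + (u * y)\<^sup>2) * \<bar>y\<bar>)) (at u within {0..1})"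
      by (simp only: has_real_derivative_iff_has_vector_derivative)
  qed simp
  have "norm (integral {0..1} (\<lambda>u. y * speed_x x (u * y))) \<le> integral {0..1} (\<lambda>u. 80 * (\<bar>x\<bar> / (x\<^sup>2 + (u * y)\<^sup>2) * \<bar>y\<bar>))"
  proof (rule integral_norm_bound_integral)
    show "(\<lambda>u. y * speed_x x (u * y)) integrable_on {0..1}"
      by (rule integrable_continuous_interval)
        (intro continuous_intros continuous_on_compose2[OF continuous_speed_x_slice], auto)
    show "(\<lambda>u. 80 * (\<bar>x\<bar> / (x\<^sup>2 + (u * y)\<^sup>2) * \<bar>y\<bar>)) integrable_on {0..1}"
      using has_integral_integrable[OF i] .
    show "norm (y * speed_x x (u * y)) \<le> 80 * (\<bar>x\<bar> / (x\<^sup>2 + (u * y)\<^sup>2) * \<bar>y\<bar>)" for u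
      using mult_right_mono[OF bd[of "u * y"], of "\<bar>y\<bar>"]
      unfolding real_norm_def abs_mult mult.assoc mult.commute[of "\<bar>y\<bar>"] by simp
  qed
  also have "\<dots> = 80 * arctan (\<bar>y\<bar> / \<bar>x\<bar>)"
    unfolding integral_unique[OF i]
    by (simp only: mult_1 mult_zero_left div_0 arctan_zero_zero mult_zero_right diff_zero)
  also have "\<dots> \<le> 80 * pi" using arctan_ubound[of "\<bar>y\<bar> / \<bar>x\<bar>"] pi_gt_zero by linarith
  finally have "norm (integral {0..1} (\<lambda>u. y * speed_x x (u * y))) \<le> 80 * pi" .
  then show ?thesis by (simp add: vel2_def primitive_def)
qed simp

lemma continuous_stream: "continuous_on UNIV (\<lambda>(x, y). stream x y)"
  using primitive_continuous[of UNIV speed] continuous_speed by (simp add: stream_def)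

lemma vel2_sqrt_bound: "\<bar>vel2 x y\<bar> \<le> 8000 * \<bar>x\<bar> powr (1 / 2) * \<bar>y\<bar> powr (1 / 4)"
  using vel2_powr_bound[of x "1/4" y] by (cases "x = 0") auto

text \<open>The integrand \<open>speed_x\<close> is controlled as a function of two variables only
  off the second axis. On that axis \<open>vel2\<close> vanishes, and the bound by a power of
  \<open>\<bar>x\<bar>\<close> gives continuity.\<close>

lemma continuous_vel2: "continuous_on UNIV (\<lambda>(x, y). vel2 x y)"
proof -
  have off: "continuous_on ((- {0}) \<times> UNIV) (\<lambda>(x, y). vel2 x y)"
    using continuous_on_minus[OF primitive_continuous[OF continuous_speed_x(1)]]
    by (simp add: vel2_def case_prod_unfold)
  have "isCont (\<lambda>(x, y). vel2 x y) (x0, y0)" for x0 y0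
  proof (cases "x0 = 0")
    case False
    moreover have "open ((- {0::real}) \<times> (UNIV :: real set))" by (intro open_Times) auto
    ultimately show ?thesis
      using off by (subst (asm) continuous_on_eq_continuous_at) auto
  next
    case True
    have "((\<lambda>z. 8000 * \<bar>fst z\<bar> powr (1 / 2) * \<bar>snd z\<bar> powr (1 / 4)) \<longlongrightarrow>
       8000 * 0 * \<bar>y0\<bar> powr (1 / 4)) (at (0::real, y0))"
    proof -
      have "((\<lambda>z. \<bar>fst z\<bar>) \<longlongrightarrow> 0) (at (0::real, y0))" by (auto intro!: tendsto_eq_intros)
      from tendsto_zero_powrI[OF this tendsto_const[of "1/2"]]
      have 1: "((\<lambda>z. \<bar>fst z\<bar> powr (1 / 2)) \<longlongrightarrow> 0) (at (0::real, y0))" by auto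
      have "((\<lambda>z. \<bar>snd z\<bar>) \<longlongrightarrow> \<bar>y0\<bar>) (at (0::real, y0))" by (auto intro!: tendsto_eq_intros)
      then have 2: "((\<lambda>z. \<bar>snd z\<bar> powr (1 / 4)) \<longlongrightarrow> \<bar>y0\<bar> powr (1 / 4)) (at (0::real, y0))"
        by (intro tendsto_powr') (auto intro!: always_eventually)
      show ?thesis by (rule tendsto_mult[OF tendsto_mult[OF tendsto_const 1] 2])
    qed
    then have t: "((\<lambda>z. 8000 * \<bar>fst z\<bar> powr (1 / 2) * \<bar>snd z\<bar> powr (1 / 4)) \<longlongrightarrow> 0) (at (0::real, y0))"
      by simp
    have "norm (case z of (x, y) \<Rightarrow> vel2 x y) \<le> 8000 * \<bar>fst z\<bar> powr (1 / 2) * \<bar>snd z\<bar> powr (1 / 4)" for z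
      using vel2_sqrt_bound[of "fst z" "snd z"] by (simp add: case_prod_unfold)
    then have "((\<lambda>(x, y). vel2 x y) \<longlongrightarrow> 0) (at (0, y0))"
      by (intro Lim_null_comparison[OF always_eventually t] allI)
    then show ?thesis using True by (simp add: isCont_def)
  qed
  then show ?thesis by (intro continuous_at_imp_continuous_on) auto
qed

text \<open>The derivative in \<open>x\<close> is so far known for \<open>x \<noteq> 0\<close>,
  which is enough for the mean value theorem between 0 and \<open>x\<close>. The order 3/2 yields
  differentiability at 0 and later limits how far a level line strays from a stagnation
  point.\<close>

lemma stream_x_bound: "\<bar>stream x y - stream 0 y\<bar> \<le> 8000 * \<bar>y\<bar> powr (1 / 4) * (\<bar>x\<bar> * \<bar>x\<bar> powr (1 / 2))"
proof (cases "x = 0")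
  case False
  have c: "continuous_on A (\<lambda>x. stream x y)" for A
    by (rule continuous_on_case_prod_compose[OF continuous_stream]) (auto intro!: continuous_intros)
  have "\<exists>z. \<bar>z\<bar> \<le> \<bar>x\<bar> \<and> stream x y - stream 0 y = x * (- vel2 z y)"
  proof (cases "x > 0")
    case True
    have "\<exists>l z. 0 < z \<and> z < x \<and> ((\<lambda>x. stream x y) has_real_derivative l) (at z) \<and> stream x y - stream 0 y = (x - 0) * l"
      by (rule MVT[OF True c]) (rule real_differentiableI, rule stream_deriv_x_off, simp)
    then obtain l z where z: "0 < z" "z < x" "((\<lambda>x. stream x y) has_real_derivative l) (at z)"
      "stream x y - stream 0 y = x * l" by auto
    moreover have "l = - vel2 z y" using DERIV_unique[OF z(3)] stream_deriv_x_off[of z y] z by simp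
    ultimately show ?thesis by (intro exI[of _ z]) auto
  next
    case f: False
    have "x < 0" using f False by simp
    have "\<exists>l z. x < z \<and> z < 0 \<and> ((\<lambda>x. stream x y) has_real_derivative l) (at z) \<and> stream 0 y - stream x y = (0 - x) * l"
      by (rule MVT[OF \<open>x < 0\<close> c]) (rule real_differentiableI, rule stream_deriv_x_off, simp)
    then obtain l z where z: "x < z" "z < 0" "((\<lambda>x. stream x y) has_real_derivative l) (at z)"
      "stream 0 y - stream x y = (0 - x) * l" by auto
    moreover have "l = - vel2 z y" using DERIV_unique[OF z(3)] stream_deriv_x_off[of z y] z by simp
    ultimately show ?thesis by (intro exI[of _ z]) auto
  qed
  then obtain z where z: "\<bar>z\<bar> \<le> \<bar>x\<bar>" "stream x y - stream 0 y = x * (- vel2 z y)" by blast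
  have "\<bar>vel2 z y\<bar> \<le> 8000 * \<bar>z\<bar> powr (1 / 2) * \<bar>y\<bar> powr (1 / 4)" by (rule vel2_sqrt_bound)
  also have "\<dots> \<le> 8000 * \<bar>x\<bar> powr (1 / 2) * \<bar>y\<bar> powr (1 / 4)"
    using z by (intro mult_mono powr_mono2) auto
  finally have "\<bar>x\<bar> * \<bar>vel2 z y\<bar> \<le> \<bar>x\<bar> * (8000 * \<bar>x\<bar> powr (1 / 2) * \<bar>y\<bar> powr (1 / 4))"
    by (rule mult_left_mono) simp
  then show ?thesis unfolding z(2) by (simp add: abs_mult mult_ac)
qed simp

lemma stream_deriv_x: "((\<lambda>x. stream x y) has_real_derivative - vel2 x y) (at x)"
proof (cases "x = 0")
  case True
  have "((\<lambda>h. 8000 * \<bar>y\<bar> powr (1 / 4) * \<bar>h\<bar> powr (1 / 2)) \<longlongrightarrow> 0) (at (0::real))"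
  proof -
    have "((\<lambda>z. \<bar>z\<bar>) \<longlongrightarrow> 0) (at (0::real))" by (auto intro!: tendsto_eq_intros)
    from tendsto_zero_powrI[OF this tendsto_const[of "1/2"]] show ?thesis by (auto intro!: tendsto_eq_intros)
  qed
  moreover have "norm ((stream (0 + h) y - stream 0 y) / h) \<le> 8000 * \<bar>y\<bar> powr (1 / 4) * \<bar>h\<bar> powr (1 / 2)"
    if "h \<noteq> 0" for h
    using stream_x_bound[of h y] that by (simp add: field_simps)
  then have "eventually (\<lambda>h. norm ((stream (0 + h) y - stream 0 y) / h) \<le> 8000 * \<bar>y\<bar> powr (1 / 4) * \<bar>h\<bar> powr (1 / 2)) (at 0)"
    unfolding eventually_at_filter by (blast intro: always_eventually)
  ultimately have "((\<lambda>h. (stream (0 + h) y - stream 0 y) / h) \<longlongrightarrow> 0) (at 0)"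
    by (rule Lim_null_comparison[rotated])
  then show ?thesis using True by (simp add: DERIV_def)
qed (rule stream_deriv_x_off)

lemma stream_has_derivative:
  "((\<lambda>(x, y). stream x y) has_derivative (\<lambda>(u, v). u * (- vel2 x y) + v * speed x y)) (at (x, y))"
proof -
  have "((\<lambda>(x, y). stream x y) has_derivative
    (\<lambda>(tx, ty). tx * (- vel2 x y) + blinfun_apply (blinfun_scaleR_left (speed x y)) ty)) (at (x, y) within UNIV \<times> UNIV)"
  proof (rule has_derivative_partialsI)
    show "((\<lambda>x. stream x y) has_derivative (\<lambda>tx. tx * (- vel2 x y))) (at x within UNIV)"
      using stream_deriv_x[of y x] unfolding has_field_derivative_def
      by (rule has_derivative_eq_rhs) (simp add: fun_eq_iff mult.commute)
    show "(stream x has_derivative blinfun_apply (blinfun_scaleR_left (speed x y))) (at y within UNIV)" for x y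
      using stream_deriv_y[of x y] by (simp add: has_field_derivative_def mult_commute_abs)
    have "isCont (\<lambda>(x, y). speed x y) (x, y)"
      using continuous_speed by (simp add: continuous_on_eq_continuous_at)
    then show "continuous (at (x, y) within UNIV \<times> UNIV) (\<lambda>(x, y). blinfun_scaleR_left (speed x y))"
      unfolding case_prod_unfold UNIV_Times_UNIV
      by (rule bounded_linear.continuous[OF bounded_linear_blinfun_scaleR_left])
  qed auto
  then show ?thesis by simp
qed

section \<open>The vector field\<close>

definition field :: "real^2 \<Rightarrow> real^2" where
  "field z = vec2 (speed (z $ 1) (z $ 2)) (vel2 (z $ 1) (z $ 2))"

text \<open>The axes are null sets on which the classical derivatives may fail to exist; the value 0
  there, also in \<open>field_d2\<close>, keeps the functions Borel measurable.\<close>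

definition field_d1 :: "real^2 \<Rightarrow> real^2" where
  "field_d1 z = (if z $ 1 = 0 \<or> z $ 2 = 0 then 0 else vec2 (speed_x (z $ 1) (z $ 2)) (vel2_x (z $ 1) (z $ 2)))"

definition field_d2 :: "real^2 \<Rightarrow> real^2" where
  "field_d2 z = (if z $ 1 = 0 \<or> z $ 2 = 0 then 0 else vec2 (speed_y (z $ 1) (z $ 2)) (- speed_x (z $ 1) (z $ 2)))"

lemma field_nth [simp]: "field z $ 1 = speed (z $ 1) (z $ 2)" "field z $ 2 = vel2 (z $ 1) (z $ 2)"
  by (simp_all add: field_def)

lemma continuous_field: "continuous_on UNIV field"
  unfolding field_def[abs_def]
  by (intro continuous_vec2 continuous_on_case_prod_compose[OF continuous_speed]
    continuous_on_case_prod_compose[OF continuous_vel2] continuous_intros) auto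

lemma field_bounded: "norm (field z) \<le> 16 + 80 * pi"
  using norm_vec2_le[of "field z"] speed_le[of "z $ 1" "z $ 2"] speed_nonneg[of "z $ 1" "z $ 2"]
    vel2_bound[of "z $ 1" "z $ 2"] by simp

lemma open_off_axes: "open {z::real^2. z $ 1 \<noteq> 0 \<and> z $ 2 \<noteq> 0}"
  by (intro open_Collect_conj open_Collect_neq continuous_intros)

lemma borel_measurable_off_axes:
  fixes f :: "real^2 \<Rightarrow> real"
  assumes "continuous_on {z. z $ 1 \<noteq> 0 \<and> z $ 2 \<noteq> 0} f"
  shows "(\<lambda>z. if z $ 1 = 0 \<or> z $ 2 = 0 then 0 else f z) \<in> borel_measurable borel"
proof -
  have "(\<lambda>z. if z \<in> {z. z $ 1 \<noteq> 0 \<and> z $ 2 \<noteq> 0} then f z else 0) \<in> borel_measurable borel"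
    by (rule borel_measurable_continuous_on_if) (auto intro: assms borel_open open_off_axes)
  moreover have "(\<lambda>z. if z \<in> {z. z $ 1 \<noteq> 0 \<and> z $ 2 \<noteq> 0} then f z else 0)
      = (\<lambda>z. if z $ 1 = 0 \<or> z $ 2 = 0 then 0 else f z)" by (auto simp: fun_eq_iff)
  ultimately show ?thesis by simp
qed

lemma continuous_vel2_x: "continuous_on ((- {0}) \<times> UNIV) (\<lambda>(x, y). vel2_x x y)"
  using continuous_on_minus[OF primitive_continuous[OF continuous_speed_x(2)]]
  by (simp add: vel2_x_def case_prod_unfold)

lemma continuous_speed_y: "continuous_on {z::real^2. z $ 1 \<noteq> 0 \<and> z $ 2 \<noteq> 0} (\<lambda>z. speed_y (z $ 1) (z $ 2))"
proof -
  let ?S = "{z::real^2. z $ 1 \<noteq> 0 \<and> z $ 2 \<noteq> 0}"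
  have c: "continuous_on ?S (\<lambda>z. (z $ 1)\<^sup>2 + (z $ 2)\<^sup>2)" "continuous_on ?S (\<lambda>z. (z $ 2)\<^sup>2)" by (intro continuous_intros)+
  have i: "(\<lambda>z. (z $ 1)\<^sup>2 + (z $ 2)\<^sup>2) ` ?S \<subseteq> {0<..}" "(\<lambda>z. (z $ 2)\<^sup>2) ` ?S \<subseteq> {0<..}"
    using sum_sq_pos by auto
  note k = continuous_on_compose2[OF continuous_kappa(1) c(1) i(1)] continuous_on_compose2[OF continuous_kappa(2) c(1) i(1)]
  have m: "continuous_on ?S (\<lambda>z. osc_sq (z $ 2))"
    by (rule continuous_on_compose2[OF continuous_osc_sq]) (auto intro!: continuous_intros)
  have "continuous_on {0<..} vlog"
    using vlog_deriv DERIV_isCont by (intro continuous_at_imp_continuous_on) blast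
  note v = continuous_on_compose2[OF this c(2) i(2)]
  have nz: "\<And>z. z \<in> ?S \<Longrightarrow> 1 + (z $ 2)\<^sup>2 \<noteq> 0" by (metis add_pos_nonneg less_irrefl zero_le_power2 zero_less_one)
  have m': "continuous_on ?S (\<lambda>z. osc_sq' (z $ 2))"
    unfolding osc_sq'_def by (intro continuous_intros v) (use nz in auto)
  show ?thesis unfolding speed_y_def by (intro continuous_intros k m m')
qed

lemma continuous_slices:
  "continuous_on {z::real^2. z $ 1 \<noteq> 0 \<and> z $ 2 \<noteq> 0} (\<lambda>z. speed_x (z $ 1) (z $ 2))"
  "continuous_on {z::real^2. z $ 1 \<noteq> 0 \<and> z $ 2 \<noteq> 0} (\<lambda>z. vel2_x (z $ 1) (z $ 2))"
  by (intro continuous_on_case_prod_compose[OF continuous_speed_x(1)] continuous_on_case_prod_compose[OF continuous_vel2_x]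
    continuous_intros; simp)+

lemma field_d_nth:
  "field_d1 z $ 1 = (if z $ 1 = 0 \<or> z $ 2 = 0 then 0 else speed_x (z $ 1) (z $ 2))"
  "field_d1 z $ 2 = (if z $ 1 = 0 \<or> z $ 2 = 0 then 0 else vel2_x (z $ 1) (z $ 2))"
  "field_d2 z $ 1 = (if z $ 1 = 0 \<or> z $ 2 = 0 then 0 else speed_y (z $ 1) (z $ 2))"
  "field_d2 z $ 2 = (if z $ 1 = 0 \<or> z $ 2 = 0 then 0 else - speed_x (z $ 1) (z $ 2))"
  by (simp_all add: field_d1_def field_d2_def)

lemma measurable_field_d_nth:
  "(\<lambda>z. field_d1 z $ 1) \<in> borel_measurable borel" "(\<lambda>z. field_d1 z $ 2) \<in> borel_measurable borel"
  "(\<lambda>z. field_d2 z $ 1) \<in> borel_measurable borel" "(\<lambda>z. field_d2 z $ 2) \<in> borel_measurable borel"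
  unfolding field_d_nth
  by (intro borel_measurable_off_axes continuous_slices continuous_speed_y continuous_on_minus)+

lemma measurable_field_d: "field_d1 \<in> borel_measurable borel" "field_d2 \<in> borel_measurable borel"
proof -
  have "field_d1 = (\<lambda>z. vec2 (field_d1 z $ 1) (field_d1 z $ 2))" "field_d2 = (\<lambda>z. vec2 (field_d2 z $ 1) (field_d2 z $ 2))"
    by simp_all
  then show "field_d1 \<in> borel_measurable borel" "field_d2 \<in> borel_measurable borel"
    using measurable_vec2[OF measurable_field_d_nth(1,2)] measurable_vec2[OF measurable_field_d_nth(3,4)] by simp_all
qed

lemma field_d_bound:
  assumes a: "0 < a" "a < 1" and M: "M > 0" and z: "\<bar>z $ 2\<bar> \<le> M" "z $ 1 \<noteq> 0"
  defines "C \<equiv> (11 * (4 + 4 / a)\<^sup>2 + 40 * (4 + 8 / a)\<^sup>2 * M powr (a / 2) / (a / 2))"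
  shows "norm (field_d1 z) \<le> C * \<bar>z $ 1\<bar> powr (- a)" "norm (field_d2 z) \<le> C * \<bar>z $ 1\<bar> powr (- a)"
proof -
  define D where "D = (4 + 4 / a)\<^sup>2 * \<bar>z $ 1\<bar> powr (- a)"
  define E where "E = 40 * (4 + 8 / a)\<^sup>2 * M powr (a / 2) / (a / 2) * \<bar>z $ 1\<bar> powr (- a)"
  have D0: "D \<ge> 0" "E \<ge> 0" using a by (auto simp: D_def E_def)
  have CDE: "C * \<bar>z $ 1\<bar> powr (- a) = 11 * D + E" by (simp add: C_def D_def E_def algebra_simps)
  have 1: "\<bar>speed_x (z $ 1) (z $ 2)\<bar> \<le> 5 * D"
    using speed_x_bound[of "z $ 1" "z $ 2"] abs_kappa_bound[OF z(2) a, of "z $ 1" "z $ 2"] by (simp add: D_def)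
  have 2: "\<bar>speed_y (z $ 1) (z $ 2)\<bar> \<le> 6 * D"
    using speed_y_bound[of "z $ 1" "z $ 2"] abs_kappa_bound[OF z(2) a, of "z $ 2" "z $ 2"] by (simp add: D_def)
  \<comment> \<open>The bound of \<open>vel2_x\<close> has the exponent \<open>- 2 * e\<close>, so
    \<open>e = a / 2\<close> yields \<open>- a\<close>. This is the origin of \<open>8 / a\<close>
    in \<open>C\<close>.\<close>
  have a2: "0 < a / 2" "a / 2 < 1" using a by auto
  have "\<bar>vel2_x (z $ 1) (z $ 2)\<bar> \<le> 40 * (4 + 4 / (a / 2))\<^sup>2 * \<bar>z $ 1\<bar> powr (- 2 * (a / 2)) * \<bar>z $ 2\<bar> powr (a / 2) / (a / 2)"
    by (rule vel2_x_powr_bound[OF z(2) a2])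
  also have "\<dots> \<le> 40 * (4 + 4 / (a / 2))\<^sup>2 * \<bar>z $ 1\<bar> powr (- 2 * (a / 2)) * M powr (a / 2) / (a / 2)"
    using z a by (intro divide_right_mono mult_left_mono powr_mono2) auto
  also have "\<dots> = E" by (simp add: E_def)
  finally have 3: "\<bar>vel2_x (z $ 1) (z $ 2)\<bar> \<le> E" .
  show "norm (field_d1 z) \<le> C * \<bar>z $ 1\<bar> powr (- a)" "norm (field_d2 z) \<le> C * \<bar>z $ 1\<bar> powr (- a)"
    unfolding CDE
    using norm_vec2_le[of "field_d1 z"] norm_vec2_le[of "field_d2 z"] 1 2 3 D0
    by (auto simp: field_d_nth split: if_splits)
qed

section \<open>Sobolev regularity and vanishing divergence\<close>

lemma compact_box_bound:
  fixes K :: "(real^2) set" assumes "compact K"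
  obtains M where "M > 0" "K \<subseteq> {z. \<bar>z $ 1\<bar> \<le> M \<and> \<bar>z $ 2\<bar> \<le> M}"
proof -
  obtain M where M: "M > 0" "\<And>z. z \<in> K \<Longrightarrow> norm z \<le> M"
    using compact_imp_bounded[OF assms] by (auto simp: bounded_pos)
  have "\<bar>z $ 1\<bar> \<le> M \<and> \<bar>z $ 2\<bar> \<le> M" if "z \<in> K" for z
    using component_le_norm_cart[of z 1] component_le_norm_cart[of z 2] M(2)[OF that] by linarith
  then show ?thesis using that M(1) by blast
qed

lemma set_integrable_lebesgueI:
  fixes f :: "'a::euclidean_space \<Rightarrow> 'b::euclidean_space"
  assumes "f \<in> borel_measurable borel" "set_integrable lborel B f" "compact K" "K \<subseteq> B"
  shows "set_integrable lebesgue K f"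
proof -
  have K: "K \<in> sets borel" using assms(3) by (simp add: borel_compact)
  have "set_integrable lborel K f"
    by (rule set_integrable_subset[OF assms(2) _ assms(4)]) (use K in simp)
  then show ?thesis unfolding set_integrable_def
    using assms(1) K by (subst integrable_completion) auto
qed

text \<open>The bound is used with \<open>a = 1 / (2 * p)\<close>, so that the \<open>p\<close>-th
  power has the integrable singularity \<open>\<bar>x\<bar> powr (- 1 / 2)\<close>.\<close>

lemma Lp_loc_singular:
  fixes f :: "real^2 \<Rightarrow> real^2"
  assumes m: "f \<in> borel_measurable borel" and p: "p \<ge> 1"
    and b: "\<And>M a. 0 < a \<Longrightarrow> a < 1 \<Longrightarrow> M > 0 \<Longrightarrow> \<exists>C\<ge>0. \<forall>z. \<bar>z $ 1\<bar> \<le> M \<longrightarrow> \<bar>z $ 2\<bar> \<le> M \<longrightarrow> z $ 1 \<noteq> 0 \<longrightarrow> norm (f z) \<le> C * \<bar>z $ 1\<bar> powr (- a)"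
  shows "f \<in> Lp_loc p"
  unfolding Lp_loc_def
proof (intro CollectI conjI allI impI)
  show "f \<in> borel_measurable lebesgue" using m by (intro measurable_completion) simp
  have m': "(\<lambda>x. norm (f x) powr p) \<in> borel_measurable borel" using m by measurable
  fix K :: "(real^2) set" assume K: "compact K"
  obtain M where M: "M > 0" "K \<subseteq> {z. \<bar>z $ 1\<bar> \<le> M \<and> \<bar>z $ 2\<bar> \<le> M}" using compact_box_bound[OF K] .
  obtain C where C: "C \<ge> 0" "\<And>z. \<bar>z $ 1\<bar> \<le> M \<Longrightarrow> \<bar>z $ 2\<bar> \<le> M \<Longrightarrow> z $ 1 \<noteq> 0 \<Longrightarrow> norm (f z) \<le> C * \<bar>z $ 1\<bar> powr (- (1 / (2 * p)))"
    using b[of "1 / (2 * p)" M] p M by auto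
  have "set_integrable lborel {z. \<bar>z $ 1\<bar> \<le> M \<and> \<bar>z $ 2\<bar> \<le> M} (\<lambda>x. norm (f x) powr p)"
  proof (rule singular_integrable[OF m' M(1)])
    fix z :: "real^2" assume z: "\<bar>z $ 1\<bar> \<le> M" "\<bar>z $ 2\<bar> \<le> M" "z $ 1 \<noteq> 0"
    have "norm (f z) powr p \<le> (C * \<bar>z $ 1\<bar> powr (- (1 / (2 * p)))) powr p"
      using C(2)[OF z] p by (intro powr_mono2) auto
    also have "\<dots> = C powr p * \<bar>z $ 1\<bar> powr (- 1 / 2)"
      using C(1) p by (simp add: powr_mult powr_powr)
    finally show "\<bar>norm (f z) powr p\<bar> \<le> C powr p * \<bar>z $ 1\<bar> powr (- 1 / 2)" by simp
  qed
  then show "set_integrable lebesgue K (\<lambda>x. norm (f x) powr p)"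
    using set_integrable_lebesgueI[OF m' _ K M(2)] by blast
qed

lemma locally_integrable_continuous:
  fixes f :: "'a::euclidean_space \<Rightarrow> 'b::euclidean_space"
  assumes "continuous_on UNIV f" shows "locally_integrable_on U f"
  unfolding locally_integrable_on_def
proof (intro allI impI)
  fix K assume K: "compact K \<and> K \<subseteq> U"
  have "f \<in> borel_measurable borel" using assms by (rule borel_measurable_continuous_onI)
  moreover have "set_integrable lborel K f" unfolding set_integrable_def
    using borel_integrable_compact[of K f] K continuous_on_subset[OF assms] by auto
  ultimately show "set_integrable lebesgue K f" using set_integrable_lebesgueI K by blast
qed

lemma field_in_Lp: "p \<ge> 1 \<Longrightarrow> field \<in> Lp_loc p"
proof -
  assume p: "p \<ge> 1"
  have m: "field \<in> borel_measurable borel" by (rule borel_measurable_continuous_onI[OF continuous_field])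
  have c: "continuous_on UNIV (\<lambda>x. norm (field x) powr p)"
    by (intro continuous_on_powr' continuous_on_norm continuous_field continuous_on_const) (use p in auto)
  show ?thesis unfolding Lp_loc_def
    using locally_integrable_continuous[OF c, of UNIV] m
    by (auto simp: locally_integrable_on_def intro: measurable_completion)
qed

lemma field_d_powr_bound:
  assumes "0 < a" "a < 1" "M > 0"
  shows "\<exists>C\<ge>0. \<forall>z. \<bar>z $ 1\<bar> \<le> M \<longrightarrow> \<bar>z $ 2\<bar> \<le> M \<longrightarrow> z $ 1 \<noteq> 0 \<longrightarrow> norm (field_d1 z) \<le> C * \<bar>z $ 1\<bar> powr (- a)"
    "\<exists>C\<ge>0. \<forall>z. \<bar>z $ 1\<bar> \<le> M \<longrightarrow> \<bar>z $ 2\<bar> \<le> M \<longrightarrow> z $ 1 \<noteq> 0 \<longrightarrow> norm (field_d2 z) \<le> C * \<bar>z $ 1\<bar> powr (- a)"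
  using field_d_bound[OF assms] assms
  by (intro exI[of _ "11 * (4 + 4 / a)\<^sup>2 + 40 * (4 + 8 / a)\<^sup>2 * M powr (a / 2) / (a / 2)"]; simp)+

lemma field_d_in_Lp: "p \<ge> 1 \<Longrightarrow> field_d1 \<in> Lp_loc p" "p \<ge> 1 \<Longrightarrow> field_d2 \<in> Lp_loc p"
  by (rule Lp_loc_singular[OF measurable_field_d(1) _ field_d_powr_bound(1)]; assumption)
    (rule Lp_loc_singular[OF measurable_field_d(2) _ field_d_powr_bound(2)]; assumption)

lemma norm_nth_le: "\<bar>z $ i\<bar> \<le> norm z" for z :: "real^2" by (rule component_le_norm_cart)

lemma field_d_nth_integrable:
  assumes "M > 0"
  shows "set_integrable lborel {z. \<bar>z $ 1\<bar> \<le> M \<and> \<bar>z $ 2\<bar> \<le> M} (\<lambda>z. field_d1 z $ i)"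
    "set_integrable lborel {z. \<bar>z $ 1\<bar> \<le> M \<and> \<bar>z $ 2\<bar> \<le> M} (\<lambda>z. field_d2 z $ i)"
proof -
  obtain C1 where C1: "\<And>z. \<bar>z $ 1\<bar> \<le> M \<Longrightarrow> \<bar>z $ 2\<bar> \<le> M \<Longrightarrow> z $ 1 \<noteq> 0 \<Longrightarrow> norm (field_d1 z) \<le> C1 * \<bar>z $ 1\<bar> powr (- (1 / 2))"
    using field_d_powr_bound(1)[of "1/2" M] assms by auto
  obtain C2 where C2: "\<And>z. \<bar>z $ 1\<bar> \<le> M \<Longrightarrow> \<bar>z $ 2\<bar> \<le> M \<Longrightarrow> z $ 1 \<noteq> 0 \<Longrightarrow> norm (field_d2 z) \<le> C2 * \<bar>z $ 1\<bar> powr (- (1 / 2))"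
    using field_d_powr_bound(2)[of "1/2" M] assms by auto
  have [measurable]: "field_d1 \<in> borel_measurable borel" "field_d2 \<in> borel_measurable borel" by (fact measurable_field_d)+
  have m: "(\<lambda>z. field_d1 z $ i) \<in> borel_measurable borel" "(\<lambda>z. field_d2 z $ i) \<in> borel_measurable borel"
    by (auto intro: measurable_compose[OF measurable_field_d(1) measurable_nth_real2] measurable_compose[OF measurable_field_d(2) measurable_nth_real2])
  show "set_integrable lborel {z. \<bar>z $ 1\<bar> \<le> M \<and> \<bar>z $ 2\<bar> \<le> M} (\<lambda>z. field_d1 z $ i)"
    using C1 norm_nth_le order_trans by (intro singular_integrable[OF m(1) assms, of C1]) fastforce
  show "set_integrable lborel {z. \<bar>z $ 1\<bar> \<le> M \<and> \<bar>z $ 2\<bar> \<le> M} (\<lambda>z. field_d2 z $ i)"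
    using C2 norm_nth_le order_trans by (intro singular_integrable[OF m(2) assms, of C2]) fastforce
qed

lemma integral_vec2:
  assumes "integrable M a" "integrable M b"
  shows "integrable M (\<lambda>z. vec2 (a z) (b z))" "(\<integral>z. vec2 (a z) (b z) \<partial>M) = vec2 (\<integral>z. a z \<partial>M) (\<integral>z. b z \<partial>M)"
  unfolding vec2_eq_add using assms by auto

text \<open>Almost every line parallel to \<open>i\<close> meets the axes in a single point, and
  \<open>f\<close> is continuous there. So no jump contributes, and the fundamental theorem of
  calculus applies on that line. The disjunction lets one proof serve both directions.\<close>

lemma weak_derivative_components:
  fixes f g \<phi> :: "real^2 \<Rightarrow> real"
  assumes \<phi>: "\<phi> \<in> test_functions" and f: "continuous_on UNIV f"
    and g: "g \<in> borel_measurable borel"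
    and gi: "\<And>M. M > 0 \<Longrightarrow> set_integrable lborel {z. \<bar>z $ 1\<bar> \<le> M \<and> \<bar>z $ 2\<bar> \<le> M} g"
    and i: "i = axis 1 1 \<and> (\<forall>x y. x \<noteq> 0 \<longrightarrow> y \<noteq> 0 \<longrightarrow> ((\<lambda>x. f (vec2 x y)) has_real_derivative g (vec2 x y)) (at x)) \<or>
            i = axis 2 1 \<and> (\<forall>x y. x \<noteq> 0 \<longrightarrow> y \<noteq> 0 \<longrightarrow> ((\<lambda>y. f (vec2 x y)) has_real_derivative g (vec2 x y)) (at y))"
  shows "integrable lborel (\<lambda>z. partial_deriv i \<phi> z * f z)"
    "integrable lborel (\<lambda>z. \<phi> z * g z)"
    "(\<integral>z. partial_deriv i \<phi> z * f z \<partial>lborel) = - (\<integral>z. \<phi> z * g z \<partial>lborel)"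
proof -
  have iB: "i \<in> Basis" using i by (auto simp: Basis_real2)
  note \<phi>c = test_functionD(1)[OF \<phi>] and dc = test_functionD(2)[OF \<phi> iB] and \<phi>d = test_functionD(3)[OF \<phi>]
  obtain M where M: "M > 0" "\<And>z. M \<le> \<bar>z $ 1\<bar> \<or> M \<le> \<bar>z $ 2\<bar> \<Longrightarrow> \<phi> z = 0 \<and> (\<forall>i. partial_deriv i \<phi> z = 0)"
    using test_functionD(4)[OF \<phi>] by blast
  let ?K = "{z::real^2. \<bar>z $ 1\<bar> \<le> M \<and> \<bar>z $ 2\<bar> \<le> M}"
  have Keq: "?K = cbox (vec2 (-M) (-M)) (vec2 M M)"
    by (auto simp: mem_box_cart forall_2 abs_le_iff)
  have K: "compact ?K" unfolding Keq by (rule compact_cbox)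
  have [measurable]: "\<phi> \<in> borel_measurable borel" "partial_deriv i \<phi> \<in> borel_measurable borel" "f \<in> borel_measurable borel"
    "g \<in> borel_measurable borel"
    using \<phi>c dc f g by (auto intro: borel_measurable_continuous_onI)
  have Kb[measurable]: "?K \<in> sets borel" using K by (simp add: borel_compact)
  have "integrable lborel (\<lambda>z. indicator ?K z *\<^sub>R (partial_deriv i \<phi> z * f z))"
    by (rule borel_integrable_compact[OF K])
      (intro continuous_on_mult continuous_on_subset[OF dc] continuous_on_subset[OF f] subset_UNIV)
  moreover have "indicator ?K z *\<^sub>R (partial_deriv i \<phi> z * f z) = partial_deriv i \<phi> z * f z" for z
  proof (cases "z \<in> ?K")
    case False
    then have "M \<le> \<bar>z $ 1\<bar> \<or> M \<le> \<bar>z $ 2\<bar>" by auto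
    then show ?thesis using M(2)[of z] by simp
  qed simp
  ultimately show I1: "integrable lborel (\<lambda>z. partial_deriv i \<phi> z * f z)" by (simp only:)
  have "bounded (\<phi> ` ?K)"
    by (intro compact_imp_bounded compact_continuous_image continuous_on_subset[OF \<phi>c] K subset_UNIV)
  then obtain C where C: "\<And>z. z \<in> ?K \<Longrightarrow> \<bar>\<phi> z\<bar> \<le> C" by (auto simp: bounded_iff)
  have "integrable lborel (\<lambda>z. C * (indicator ?K z *\<^sub>R g z))"
    using gi[OF M(1)] unfolding set_integrable_def by (rule integrable_mult_right)
  then show I2: "integrable lborel (\<lambda>z. \<phi> z * g z)"
  proof (rule Bochner_Integration.integrable_bound)
    show "AE z in lborel. norm (\<phi> z * g z) \<le> norm (C * (indicator ?K z *\<^sub>R g z))"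
    proof (rule AE_I2)
      fix z :: "real^2"
      show "norm (\<phi> z * g z) \<le> norm (C * (indicator ?K z *\<^sub>R g z))"
      proof (cases "z \<in> ?K")
        case True
        have "\<bar>\<phi> z\<bar> \<le> \<bar>C\<bar>" using C[OF True] by linarith
        then show ?thesis using True by (simp add: abs_mult mult_right_mono)
      next
        case False
        then have "M \<le> \<bar>z $ 1\<bar> \<or> M \<le> \<bar>z $ 2\<bar>" by auto
        then have "\<phi> z = 0" using M(2)[of z] by simp
        then show ?thesis by simp
      qed
    qed
  qed measurable
  \<comment> \<open>On a line in direction \<open>i\<close>, \<open>w\<close> is the derivative of
    \<open>\<phi> * f\<close> off the axes, and \<open>\<phi>\<close> has compact support.\<close>
  define w where "w z = partial_deriv i \<phi> z * f z + \<phi> z * g z" for z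
  have wi: "integrable lborel w" unfolding w_def using I1 I2 by simp
  have w0: "w z = 0" if "M \<le> \<bar>z $ 1\<bar> \<or> M \<le> \<bar>z $ 2\<bar>" for z using M(2)[OF that] by (simp add: w_def)
  have "(\<integral>z. w z \<partial>lborel) = 0"
  proof (rule integral_zero_real2[OF wi])
    show "(AE x in lborel. integrable lborel (\<lambda>y. w (vec2 x y)) \<longrightarrow> (\<integral>y. w (vec2 x y) \<partial>lborel) = 0) \<or>
         (AE y in lborel. integrable lborel (\<lambda>x. w (vec2 x y)) \<longrightarrow> (\<integral>x. w (vec2 x y) \<partial>lborel) = 0)"
      using i
    proof
      assume i: "i = axis 1 1 \<and> (\<forall>x y. x \<noteq> 0 \<longrightarrow> y \<noteq> 0 \<longrightarrow> ((\<lambda>x. f (vec2 x y)) has_real_derivative g (vec2 x y)) (at x))"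
      have "AE y in lborel. integrable lborel (\<lambda>x. w (vec2 x y)) \<longrightarrow> (\<integral>x. w (vec2 x y) \<partial>lborel) = 0"
        using AE_lborel_singleton[of 0]
      proof eventually_elim
        case (elim y)
        show ?case
        proof
          assume "integrable lborel (\<lambda>x. w (vec2 x y))"
          then show "(\<integral>x. w (vec2 x y) \<partial>lborel) = 0"
          proof (rule integral_derivative_zero[where S="{0}" and M=M and F="\<lambda>x. \<phi> (vec2 x y) * f (vec2 x y)"])
            show "continuous_on {-M..M} (\<lambda>x. \<phi> (vec2 x y) * f (vec2 x y))"
              by (intro continuous_on_mult continuous_on_compose2[OF \<phi>c] continuous_on_compose2[OF f]
                continuous_intros subset_UNIV)
            fix x :: real
            { assume x: "x \<in> {-M<..<M} - {0}"
              have "((\<lambda>x. f (vec2 x y)) has_real_derivative g (vec2 x y)) (at x)" using i x elim by auto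
              from DERIV_mult[OF partial_deriv_line(1)[OF \<phi>d] this]
              show "((\<lambda>x. \<phi> (vec2 x y) * f (vec2 x y)) has_real_derivative w (vec2 x y)) (at x)"
                using i by (simp add: w_def mult.commute add.commute) }
            show "w (vec2 x y) = 0" if "x \<notin> {-M..M}" using that by (intro w0) auto
          qed (use M in auto)
        qed
      qed
      then show ?thesis ..
    next
      assume i: "i = axis 2 1 \<and> (\<forall>x y. x \<noteq> 0 \<longrightarrow> y \<noteq> 0 \<longrightarrow> ((\<lambda>y. f (vec2 x y)) has_real_derivative g (vec2 x y)) (at y))"
      have "AE x in lborel. integrable lborel (\<lambda>y. w (vec2 x y)) \<longrightarrow> (\<integral>y. w (vec2 x y) \<partial>lborel) = 0"
        using AE_lborel_singleton[of 0]
      proof eventually_elim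
        case (elim x)
        show ?case
        proof
          assume "integrable lborel (\<lambda>y. w (vec2 x y))"
          then show "(\<integral>y. w (vec2 x y) \<partial>lborel) = 0"
          proof (rule integral_derivative_zero[where S="{0}" and M=M and F="\<lambda>y. \<phi> (vec2 x y) * f (vec2 x y)"])
            show "continuous_on {-M..M} (\<lambda>y. \<phi> (vec2 x y) * f (vec2 x y))"
              by (intro continuous_on_mult continuous_on_compose2[OF \<phi>c] continuous_on_compose2[OF f]
                continuous_intros subset_UNIV)
            fix y :: real
            { assume y: "y \<in> {-M<..<M} - {0}"
              have "((\<lambda>y. f (vec2 x y)) has_real_derivative g (vec2 x y)) (at y)" using i y elim by auto
              from DERIV_mult[OF partial_deriv_line(2)[OF \<phi>d] this]
              show "((\<lambda>y. \<phi> (vec2 x y) * f (vec2 x y)) has_real_derivative w (vec2 x y)) (at y)"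
                using i by (simp add: w_def mult.commute add.commute) }
            show "w (vec2 x y) = 0" if "y \<notin> {-M..M}" using that by (intro w0) auto
          qed (use M in auto)
        qed
      qed
      then show ?thesis ..
    qed
  qed
  then show "(\<integral>z. partial_deriv i \<phi> z * f z \<partial>lborel) = - (\<integral>z. \<phi> z * g z \<partial>lborel)"
    unfolding w_def using I1 I2 by simp
qed

lemma field_weak_components:
  assumes \<phi>: "\<phi> \<in> test_functions"
  shows "integrable lborel (\<lambda>z. partial_deriv (axis 1 1) \<phi> z * field z $ j)"
    "integrable lborel (\<lambda>z. \<phi> z * field_d1 z $ j)"
    "(\<integral>z. partial_deriv (axis 1 1) \<phi> z * field z $ j \<partial>lborel) = - (\<integral>z. \<phi> z * field_d1 z $ j \<partial>lborel)"
    "integrable lborel (\<lambda>z. partial_deriv (axis 2 1) \<phi> z * field z $ j)"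
    "integrable lborel (\<lambda>z. \<phi> z * field_d2 z $ j)"
    "(\<integral>z. partial_deriv (axis 2 1) \<phi> z * field z $ j \<partial>lborel) = - (\<integral>z. \<phi> z * field_d2 z $ j \<partial>lborel)"
proof -
  have f: "continuous_on UNIV (\<lambda>z. field z $ j)" by (intro continuous_intros continuous_field)
  have m: "(\<lambda>z. field_d1 z $ j) \<in> borel_measurable borel" "(\<lambda>z. field_d2 z $ j) \<in> borel_measurable borel"
    by (auto intro: measurable_compose[OF measurable_field_d(1) measurable_nth_real2] measurable_compose[OF measurable_field_d(2) measurable_nth_real2])
  have j: "j = 1 \<or> j = 2" by (rule exhaust_2)
  have 1: "((\<lambda>x. field (vec2 x y) $ j) has_real_derivative field_d1 (vec2 x y) $ j) (at x)"
    "((\<lambda>y. field (vec2 x y) $ j) has_real_derivative field_d2 (vec2 x y) $ j) (at y)"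
    if "x \<noteq> 0" "y \<noteq> 0" for x y
    using j that speed_deriv_x[of x y] speed_deriv_y[of y x] vel2_deriv_x[of x y] vel2_deriv_y[of x y]
    by (auto simp: field_d_nth)
  note a = weak_derivative_components[OF \<phi> f m(1) field_d_nth_integrable(1), of "axis 1 1"]
  note b = weak_derivative_components[OF \<phi> f m(2) field_d_nth_integrable(2), of "axis 2 1"]
  show "integrable lborel (\<lambda>z. partial_deriv (axis 1 1) \<phi> z * field z $ j)"
    "integrable lborel (\<lambda>z. \<phi> z * field_d1 z $ j)"
    "(\<integral>z. partial_deriv (axis 1 1) \<phi> z * field z $ j \<partial>lborel) = - (\<integral>z. \<phi> z * field_d1 z $ j \<partial>lborel)"
    using a 1(1) by simp_all
  show "integrable lborel (\<lambda>z. partial_deriv (axis 2 1) \<phi> z * field z $ j)"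
    "integrable lborel (\<lambda>z. \<phi> z * field_d2 z $ j)"
    "(\<integral>z. partial_deriv (axis 2 1) \<phi> z * field z $ j \<partial>lborel) = - (\<integral>z. \<phi> z * field_d2 z $ j \<partial>lborel)"
    using b 1(2) by simp_all
qed

lemma locally_integrable_field: "locally_integrable_on U field"
  by (rule locally_integrable_continuous[OF continuous_field])

lemma locally_integrable_field_d:
  "locally_integrable_on UNIV field_d1" "locally_integrable_on UNIV field_d2"
proof -
  have *: "locally_integrable_on UNIV f"
    if m: "f \<in> borel_measurable borel" and i: "\<And>M i. M > 0 \<Longrightarrow> set_integrable lborel {z. \<bar>z $ 1\<bar> \<le> M \<and> \<bar>z $ 2\<bar> \<le> M} (\<lambda>z. f z $ i)"
    for f :: "real^2 \<Rightarrow> real^2"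
    unfolding locally_integrable_on_def
  proof (intro allI impI)
    fix K :: "(real^2) set" assume K: "compact K \<and> K \<subseteq> UNIV"
    obtain M where M: "M > 0" "K \<subseteq> {z. \<bar>z $ 1\<bar> \<le> M \<and> \<bar>z $ 2\<bar> \<le> M}" using compact_box_bound K by blast
    let ?B = "{z::real^2. \<bar>z $ 1\<bar> \<le> M \<and> \<bar>z $ 2\<bar> \<le> M}"
    have "integrable lborel (\<lambda>z. vec2 (indicator ?B z *\<^sub>R f z $ 1) (indicator ?B z *\<^sub>R f z $ 2))"
      using i[OF M(1)] unfolding set_integrable_def by (intro integral_vec2(1))
    moreover have "vec2 (indicator ?B z *\<^sub>R f z $ 1) (indicator ?B z *\<^sub>R f z $ 2) = indicator ?B z *\<^sub>R f z" for z
      by (simp add: vec_eq_iff forall_2)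
    ultimately have "set_integrable lborel ?B f" by (simp add: set_integrable_def)
    then show "set_integrable lebesgue K f" using set_integrable_lebesgueI[OF m _ _ M(2)] K by blast
  qed
  show "locally_integrable_on UNIV field_d1" "locally_integrable_on UNIV field_d2"
    by (rule *[OF measurable_field_d(1) field_d_nth_integrable(1)] *[OF measurable_field_d(2) field_d_nth_integrable(2)]; assumption)+
qed

lemma field_weak_partial:
  "has_weak_partial_deriv (axis 1 1) field field_d1"
  "has_weak_partial_deriv (axis 2 1) field field_d2"
proof -
  have *: "(\<integral>x. partial_deriv i \<phi> x *\<^sub>R field x \<partial>lebesgue) = - (\<integral>x. \<phi> x *\<^sub>R g x \<partial>lebesgue)"
    if \<phi>: "\<phi> \<in> test_functions" and i: "i \<in> Basis" and g: "g \<in> borel_measurable borel" and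
      I: "\<And>j. integrable lborel (\<lambda>z. partial_deriv i \<phi> z * field z $ j)"
      "\<And>j. integrable lborel (\<lambda>z. \<phi> z * g z $ j)"
      "\<And>j. (\<integral>z. partial_deriv i \<phi> z * field z $ j \<partial>lborel) = - (\<integral>z. \<phi> z * g z $ j \<partial>lborel)"
    for \<phi> :: "real^2 \<Rightarrow> real" and i g
  proof -
    have [measurable]: "\<phi> \<in> borel_measurable borel" "partial_deriv i \<phi> \<in> borel_measurable borel" "field \<in> borel_measurable borel"
      "g \<in> borel_measurable borel"
      using g test_functionD(1)[OF \<phi>] test_functionD(2)[OF \<phi> i] continuous_field by (auto intro: borel_measurable_continuous_onI)
    have s: "c *\<^sub>R z = vec2 (c * z $ 1) (c * z $ 2)" for c and z :: "real^2" by (simp add: vec_eq_iff forall_2)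
    have "(\<integral>x. partial_deriv i \<phi> x *\<^sub>R field x \<partial>lebesgue) = (\<integral>x. partial_deriv i \<phi> x *\<^sub>R field x \<partial>lborel)"
      by (rule integral_completion) measurable
    also have "\<dots> = vec2 (- (\<integral>z. \<phi> z * g z $ 1 \<partial>lborel)) (- (\<integral>z. \<phi> z * g z $ 2 \<partial>lborel))"
      unfolding s integral_vec2(2)[OF I(1) I(1)] I(3) ..
    also have "\<dots> = - vec2 (\<integral>z. \<phi> z * g z $ 1 \<partial>lborel) (\<integral>z. \<phi> z * g z $ 2 \<partial>lborel)"
      by (simp add: vec_eq_iff forall_2)
    also have "\<dots> = - (\<integral>x. \<phi> x *\<^sub>R g x \<partial>lborel)"
      unfolding s integral_vec2(2)[OF I(2) I(2)] ..
    also have "(\<integral>x. \<phi> x *\<^sub>R g x \<partial>lborel) = (\<integral>x. \<phi> x *\<^sub>R g x \<partial>lebesgue)"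
      by (rule integral_completion[symmetric]) measurable
    finally show ?thesis .
  qed
  have B: "axis 1 1 \<in> (Basis :: (real^2) set)" "axis 2 1 \<in> (Basis :: (real^2) set)" by (auto simp: Basis_real2)
  show "has_weak_partial_deriv (axis 1 1) field field_d1" "has_weak_partial_deriv (axis 2 1) field field_d2"
    unfolding has_weak_partial_deriv_def
    using *[OF _ B(1) measurable_field_d(1) field_weak_components(1,2,3)] *[OF _ B(2) measurable_field_d(2) field_weak_components(4,5,6)]
      locally_integrable_field locally_integrable_field_d by blast+
qed

lemma field_in_W1p: "p \<ge> 1 \<Longrightarrow> field \<in> W1p_loc p"
  unfolding W1p_loc_def Basis_real2
  using field_in_Lp field_d_in_Lp field_weak_partial by blast

lemma field_divergence_free: "divergence_free field"
  unfolding divergence_free_def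
proof (intro conjI ballI locally_integrable_field)
  fix \<phi> :: "real^2 \<Rightarrow> real" assume \<phi>: "\<phi> \<in> test_functions"
  have B: "axis 1 1 \<in> (Basis :: (real^2) set)" "axis 2 1 \<in> (Basis :: (real^2) set)" by (auto simp: Basis_real2)
  have [measurable]: "partial_deriv (axis 1 1) \<phi> \<in> borel_measurable borel" "partial_deriv (axis 2 1) \<phi> \<in> borel_measurable borel"
    "field \<in> borel_measurable borel"
    using test_functionD(2)[OF \<phi>] B continuous_field by (auto intro: borel_measurable_continuous_onI)
  note c = field_weak_components[OF \<phi>]
  have "(\<integral>x. (\<Sum>i\<in>Basis. (field x \<bullet> i) * partial_deriv i \<phi> x) \<partial>lebesgue)
    = (\<integral>x. partial_deriv (axis 1 1) \<phi> x * field x $ 1 + partial_deriv (axis 2 1) \<phi> x * field x $ 2 \<partial>lebesgue)"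
    by (simp add: Basis_real2 axis_real2_neq mult.commute)
  also have "\<dots> = (\<integral>x. partial_deriv (axis 1 1) \<phi> x * field x $ 1 + partial_deriv (axis 2 1) \<phi> x * field x $ 2 \<partial>lborel)"
    by (rule integral_completion) measurable
  also have "\<dots> = - (\<integral>z. \<phi> z * field_d1 z $ 1 \<partial>lborel) - (\<integral>z. \<phi> z * field_d2 z $ 2 \<partial>lborel)"
    using c(1)[of 1] c(4)[of 2] c(3)[of 1] c(6)[of 2] by simp
  \<comment> \<open>The mixed second derivatives of \<open>stream\<close> cancel pointwise: the two
    entries are \<open>speed_x\<close> and \<open>- speed_x\<close>.\<close>
  also have "(\<integral>z. \<phi> z * field_d2 z $ 2 \<partial>lborel) = (\<integral>z. - (\<phi> z * field_d1 z $ 1) \<partial>lborel)"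
    by (rule Bochner_Integration.integral_cong) (auto simp: field_d_nth)
  finally show "(\<integral>x. (\<Sum>i\<in>Basis. (field x \<bullet> i) * partial_deriv i \<phi> x) \<partial>lebesgue) = 0"
    by simp
qed

lemma AE_field_pos: "AE z in lebesgue. field z \<bullet> axis 1 1 > 0"
proof -
  have "AE z in (lborel :: (real^2) measure). z $ 1 \<noteq> 0"
  proof (rule AE_real2I)
    show "AE x in lborel. AE y in lborel. vec2 x y $ 1 \<noteq> 0"
      using AE_lborel_singleton[of 0] by eventually_elim auto
    show "{z::real^2. \<not> z $ 1 \<noteq> 0} \<in> sets borel"
      by (auto intro!: borel_closed closed_Collect_eq continuous_intros)
  qed
  then have "AE z in lebesgue. (z::real^2) $ 1 \<noteq> 0" by (rule AE_completion)
  then show ?thesis by eventually_elim (auto intro: speed_pos)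
qed

section \<open>Lower bounds for the speed and growth of the stream function\<close>

lemma cos_sq_ge_quarter:
  assumes "\<bar>x\<bar> \<le> 1" shows "1 / 4 \<le> (cos (x::real))\<^sup>2"
proof -
  have "cos (pi / 3) \<le> cos \<bar>x\<bar>"
    using assms pi_gt3 by (intro cos_monotone_0_pi_le) auto
  then have "1 / 2 \<le> cos x" by (simp add: cos_60)
  then have "(1 / 2)\<^sup>2 \<le> (cos x)\<^sup>2" by (intro power_mono) auto
  then show ?thesis by (simp add: power2_eq_square)
qed

text \<open>Either the oscillating factor keeps a quarter of \<open>y\<^sup>2\<close>, or, in the
  cone \<open>\<bar>y\<bar> \<le> \<bar>x\<bar>\<close>, the term \<open>x\<^sup>2\<close> alone is
  at least half of \<open>x\<^sup>2 + y\<^sup>2\<close>.\<close>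

lemma speed_ge_rho:
  assumes "1 / 4 \<le> (cos (vlog (y\<^sup>2) / 5))\<^sup>2 \<or> \<bar>y\<bar> \<le> \<bar>x\<bar>"
  shows "rho (x\<^sup>2 + y\<^sup>2) / 4 \<le> speed x y"
proof -
  have "(x\<^sup>2 + y\<^sup>2) / 4 \<le> x\<^sup>2 + osc_sq y"
    using assms
  proof
    assume "1 / 4 \<le> (cos (vlog (y\<^sup>2) / 5))\<^sup>2"
    then have "y\<^sup>2 * (1 / 4) \<le> osc_sq y" unfolding osc_sq_def power_mult_distrib by (intro mult_left_mono) auto
    moreover have "(x\<^sup>2 + y\<^sup>2) / 4 = x\<^sup>2 / 4 + y\<^sup>2 * (1 / 4)" by (simp add: add_divide_distrib)
    moreover have "x\<^sup>2 / 4 \<le> x\<^sup>2" using zero_le_power2[of x] by linarith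
    ultimately show ?thesis by linarith
  next
    assume "\<bar>y\<bar> \<le> \<bar>x\<bar>"
    then have "y\<^sup>2 \<le> x\<^sup>2" by (simp add: abs_le_square_iff)
    moreover have "0 \<le> x\<^sup>2" by simp
    moreover have "(x\<^sup>2 + y\<^sup>2) / 4 = x\<^sup>2 / 4 + y\<^sup>2 / 4" by (simp add: add_divide_distrib)
    ultimately show ?thesis using osc_sq_nonneg[of y] by linarith
  qed
  then have "kappa (x\<^sup>2 + y\<^sup>2) * ((x\<^sup>2 + y\<^sup>2) / 4) \<le> kappa (x\<^sup>2 + y\<^sup>2) * (x\<^sup>2 + osc_sq y)"
    using kappa_pos[of "x\<^sup>2 + y\<^sup>2"] by (intro mult_left_mono) auto
  then show ?thesis by (simp add: speed_def rho_def mult.commute)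
qed

text \<open>As \<open>vlog 1 = ln 2\<close> is below 1, the phase is at most 1/5 here. The bound
  makes \<open>stream x\<close> grow at least linearly in both directions, hence surjective.\<close>

lemma speed_ge_far: "\<bar>y\<bar> \<ge> 1 \<Longrightarrow> rho 1 / 4 \<le> speed x y"
proof -
  assume y: "\<bar>y\<bar> \<ge> 1"
  then have y2: "1 \<le> y\<^sup>2" using abs_le_square_iff[of 1 y] by simp
  have "vlog (y\<^sup>2) \<le> vlog 1" using y2 by (intro vlog_antimono) auto
  also have "\<dots> \<le> 1" using ln_add_one_self_le_self[of 1] by (simp add: vlog_def)
  finally have "vlog (y\<^sup>2) \<le> 1" .
  moreover have "0 \<le> vlog (y\<^sup>2)" by (rule vlog_nonneg) simp
  ultimately have "1 / 4 \<le> (cos (vlog (y\<^sup>2) / 5))\<^sup>2" by (intro cos_sq_ge_quarter) auto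
  then have "rho (x\<^sup>2 + y\<^sup>2) / 4 \<le> speed x y" by (intro speed_ge_rho) simp
  moreover have "rho 1 \<le> rho (x\<^sup>2 + y\<^sup>2)" using y2 by (intro rho_mono) (auto intro: add_increasing)
  ultimately show ?thesis by simp
qed

lemma stream_mono: "a \<le> b \<Longrightarrow> stream x a \<le> stream x b"
  by (rule DERIV_nonneg_imp_nondecreasing[of a b "stream x"], assumption)
    (rule exI, rule conjI, rule stream_deriv_y, rule speed_nonneg)

text \<open>The speed has zeros on the second axis, but no interval of them: there
  \<open>osc\<close> and its derivative would vanish, hence both the cosine and the sine of the
  phase.\<close>

lemma stream_strict_mono:
  assumes "a < b" shows "stream x a < stream x b"
proof (cases "x = 0")
  case False
  show ?thesis
    by (rule DERIV_pos_imp_increasing[OF assms, of "stream x"])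
      (rule exI, rule conjI, rule stream_deriv_y, rule speed_pos, rule disjI1, rule False)
next
  case True
  show ?thesis
  proof (rule ccontr)
    assume "\<not> stream x a < stream x b"
    then have eq: "stream x y = stream x a" if "y \<in> {a..b}" for y
      using stream_mono[of a y x] stream_mono[of y b x] that by auto
    have osc0: "osc y = 0" if y: "y \<in> {a<..<b}" for y
    proof -
      have "((\<lambda>y. stream x y) has_real_derivative 0) (at y)"
        by (rule has_field_derivative_transform_within_open[OF DERIV_const[of "stream x a"], of "{a<..<b}"])
          (use y in simp_all, rule eq[symmetric], simp)
      then have "speed x y = 0" by (rule DERIV_unique[OF stream_deriv_y])
      then have "osc_sq y = 0" using speed_pos[of x y] by auto
      then show ?thesis by (simp add: osc_sq_eq)
    qed
    \<comment> \<open>\<open>osc_deriv\<close> excludes 0; if the midpoint is 0, another point of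
      the interval is taken.\<close>
    obtain y where y: "y \<in> {a<..<b}" "y \<noteq> 0"
    proof (cases "(a + b) / 2 = 0")
      case True then show ?thesis using that[of "(a + 2 * b) / 3"] assms by auto
    next
      case False then show ?thesis using that[of "(a + b) / 2"] assms by auto
    qed
    have c: "cos (vlog (y\<^sup>2) / 5) = 0" using osc0[OF y(1)] y(2) by (simp add: osc_def)
    then have s: "sin (vlog (y\<^sup>2) / 5) \<noteq> 0" using sin_cos_squared_add[of "vlog (y\<^sup>2) / 5"] by auto
    have "(osc has_real_derivative 0) (at y)"
      by (rule has_field_derivative_transform_within_open[OF DERIV_const[of 0], of "{a<..<b}"])
        (rule open_greaterThanLessThan, rule y(1), rule osc0[symmetric])
    then have "cos (vlog (y\<^sup>2) / 5) + 2 / 5 * sin (vlog (y\<^sup>2) / 5) / (1 + y\<^sup>2) = 0"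
      by (rule DERIV_unique[OF osc_deriv[OF y(2)]])
    moreover have "1 + y\<^sup>2 > 0" by (simp add: add_pos_nonneg)
    ultimately show False using c s by simp
  qed
qed

lemma stream_less_iff [simp]: "stream x a < stream x b \<longleftrightarrow> a < b"
  using stream_strict_mono[of a b x] stream_mono[of b a x] by linarith

lemma stream_inj: "stream x a = stream x b \<Longrightarrow> a = b"
  using stream_strict_mono[of a b x] stream_strict_mono[of b a x] by force

lemma derivative_ge_imp_growth:
  fixes f :: "real \<Rightarrow> real"
  assumes "a \<le> b" "continuous_on {a..b} f"
    and "\<And>x. a < x \<Longrightarrow> x < b \<Longrightarrow> (f has_real_derivative f' x) (at x) \<and> c \<le> f' x"
  shows "c * (b - a) \<le> f b - f a"
proof (cases "a = b")
  case False
  with assms have ab: "a < b" by simp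
  have "\<exists>l z. a < z \<and> z < b \<and> (f has_real_derivative l) (at z) \<and> f b - f a = (b - a) * l"
    by (rule MVT[OF ab assms(2)]) (rule real_differentiableI, rule conjunct1[OF assms(3)])
  then obtain l z where z: "a < z" "z < b" "(f has_real_derivative l) (at z)" "f b - f a = (b - a) * l"
    by blast
  have "l = f' z" by (rule DERIV_unique[OF z(3) conjunct1[OF assms(3)[OF z(1,2)]]])
  then have "c \<le> l" using assms(3)[OF z(1,2)] by simp
  then show ?thesis unfolding z(4) using ab by (simp add: mult.commute mult_left_mono)
qed simp

lemma derivative_le_imp_growth:
  fixes f :: "real \<Rightarrow> real"
  assumes "a \<le> b" "continuous_on {a..b} f"
    and "\<And>x. a < x \<Longrightarrow> x < b \<Longrightarrow> (f has_real_derivative f' x) (at x) \<and> f' x \<le> c"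
  shows "f b - f a \<le> c * (b - a)"
proof -
  have "(- c) * (b - a) \<le> (- f b) - (- f a)"
  proof (rule derivative_ge_imp_growth[where f' = "\<lambda>x. - f' x"])
    fix x assume x: "a < x" "x < b"
    show "((\<lambda>x. - f x) has_real_derivative - f' x) (at x) \<and> - c \<le> - f' x"
      using assms(3)[OF x] by (simp add: DERIV_minus)
  qed (use assms(1,2) in \<open>auto intro!: continuous_on_minus\<close>)
  then show ?thesis by simp
qed

lemma continuous_stream_slice: "continuous_on A (stream x)" "continuous_on A (\<lambda>x. stream x y)"
  by (rule continuous_on_case_prod_compose[OF continuous_stream]; auto intro!: continuous_intros)+

lemma stream_top: "filterlim (stream x) at_top at_top" and stream_bot: "filterlim (stream x) at_bot at_bot"
proof -
  have r: "rho 1 / 4 > 0" using rho_pos[of 1] by simp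
  have up: "rho 1 / 4 * (y - 1) + stream x 1 \<le> stream x y" if "y \<ge> 1" for y
  proof -
    have "rho 1 / 4 * (y - 1) \<le> stream x y - stream x 1"
      by (rule derivative_ge_imp_growth[OF that continuous_stream_slice(1)], rule conjI[OF stream_deriv_y speed_ge_far]) simp
    then show ?thesis by simp
  qed
  have dn: "stream x y \<le> stream x (-1) + rho 1 / 4 * (y + 1)" if "y \<le> -1" for y
  proof -
    have "rho 1 / 4 * (- 1 - y) \<le> stream x (- 1) - stream x y"
      by (rule derivative_ge_imp_growth[OF that continuous_stream_slice(1)], rule conjI[OF stream_deriv_y speed_ge_far]) simp
    then show ?thesis by (simp add: field_simps)
  qed
  show "filterlim (stream x) at_top at_top"
    unfolding filterlim_at_top
  proof
    fix Z
    have "Z \<le> stream x y" if "y \<ge> max 1 (1 + (Z - stream x 1) / (rho 1 / 4))" for y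
    proof -
      have "(Z - stream x 1) / (rho 1 / 4) \<le> y - 1" using that by simp
      then have "Z - stream x 1 \<le> rho 1 / 4 * (y - 1)" using r by (simp only: pos_divide_le_eq mult.commute)
      then show ?thesis using up[of y] that by simp
    qed
    then show "eventually (\<lambda>y. Z \<le> stream x y) at_top" unfolding eventually_at_top_linorder by blast
  qed
  show "filterlim (stream x) at_bot at_bot"
    unfolding filterlim_at_bot
  proof
    fix Z
    have "stream x y \<le> Z" if "y \<le> min (-1) (- 1 + (Z - stream x (-1)) / (rho 1 / 4))" for y
    proof -
      have "y + 1 \<le> (Z - stream x (-1)) / (rho 1 / 4)" using that by simp
      then have "rho 1 / 4 * (y + 1) \<le> Z - stream x (-1)" using r by (simp only: pos_le_divide_eq mult.commute)
      then show ?thesis using dn[of y] that by simp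
    qed
    then show "eventually (\<lambda>y. stream x y \<le> Z) at_bot" unfolding eventually_at_bot_linorder by blast
  qed
qed

lemma real_function_surj:
  fixes f :: "real \<Rightarrow> real"
  assumes "filterlim f at_top at_top" "filterlim f at_bot at_bot" "continuous_on UNIV f"
  shows "\<exists>x. f x = y"
proof -
  have "eventually (\<lambda>x. f x \<le> y) at_bot" using assms(2) unfolding filterlim_at_bot by blast
  then obtain a where a: "\<And>x. x \<le> a \<Longrightarrow> f x \<le> y" unfolding eventually_at_bot_linorder by blast
  have "eventually (\<lambda>x. y \<le> f x) at_top" using assms(1) unfolding filterlim_at_top by blast
  then obtain b where b: "\<And>x. b \<le> x \<Longrightarrow> y \<le> f x" unfolding eventually_at_top_linorder by blast
  have "\<exists>x. min a b \<le> x \<and> x \<le> max a b \<and> f x = y"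
    by (rule IVT') (simp_all add: a b continuous_on_subset[OF assms(3)])
  then show ?thesis by blast
qed

section \<open>Level lines as graphs over the first axis\<close>

definition level :: "real \<Rightarrow> real \<Rightarrow> real" where
  "level x h = (THE y. stream x y = h)"

lemma stream_level [simp]: "stream x (level x h) = h"
proof -
  obtain y where "stream x y = h"
    using real_function_surj[OF stream_top stream_bot continuous_stream_slice(1)] by blast
  then have "\<exists>!y. stream x y = h" using stream_inj by blast
  then show ?thesis unfolding level_def by (rule theI')
qed

lemma level_stream [simp]: "level x (stream x y) = y"
  by (rule stream_inj[of x]) simp

lemma level_less_iff: "level x h < a \<longleftrightarrow> h < stream x a"
  using stream_less_iff[of x "level x h" a] by simp

lemma less_level_iff: "a < level x h \<longleftrightarrow> stream x a < h"
  using stream_less_iff[of x a "level x h"] by simp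

lemma continuous_level: "continuous_on UNIV (\<lambda>x. level x h)"
proof -
  have "((\<lambda>x. level x h) \<longlongrightarrow> level x0 h) (at x0)" for x0
  proof (rule order_tendstoI)
    have lim: "((\<lambda>x. stream x a) \<longlongrightarrow> stream x0 a) (at x0)" for a
      using continuous_stream_slice(2)[of UNIV a] by (simp add: continuous_on_def)
    show "eventually (\<lambda>x. a < level x h) (at x0)" if "a < level x0 h" for a
      using order_tendstoD(2)[OF lim[of a], of h] that by (simp add: less_level_iff)
    show "eventually (\<lambda>x. level x h < a) (at x0)" if "level x0 h < a" for a
      using order_tendstoD(1)[OF lim[of a], of h] that by (simp add: level_less_iff)
  qed
  then show ?thesis by (simp add: continuous_on_def)
qed

text \<open>The implicit function theorem at one point: \<open>stream\<close> is differentiable in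
  \<open>x\<close> there, and by the mean value theorem in \<open>y\<close> its vertical difference
  quotient is \<open>speed x (\<xi> x)\<close> with \<open>\<xi> x\<close> tending to
  \<open>y0\<close>. Dividing one by the other gives the slope.\<close>

lemma level_deriv:
  assumes p: "speed x0 (level x0 h) > 0"
  shows "((\<lambda>x. level x h) has_real_derivative vel2 x0 (level x0 h) / speed x0 (level x0 h)) (at x0)"
proof -
  define y0 where "y0 = level x0 h"
  have "\<exists>\<xi>. \<bar>\<xi> - y0\<bar> \<le> \<bar>level x h - y0\<bar> \<and> stream x (level x h) - stream x y0 = speed x \<xi> * (level x h - y0)" for x
  proof (rule linorder_cases[of y0 "level x h"])
    assume lt: "y0 < level x h"
    obtain z where "y0 < z" "z < level x h" "stream x (level x h) - stream x y0 = (level x h - y0) * speed x z"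
      using MVT2[OF lt stream_deriv_y] by blast
    then show ?thesis by (intro exI[of _ z]) (simp add: mult.commute)
  next
    assume lt: "level x h < y0"
    obtain z where "level x h < z" "z < y0" "stream x y0 - stream x (level x h) = (y0 - level x h) * speed x z"
      using MVT2[OF lt stream_deriv_y] by blast
    then show ?thesis by (intro exI[of _ z]) (simp add: algebra_simps)
  qed simp
  then have "\<forall>x. \<exists>\<xi>. \<bar>\<xi> - y0\<bar> \<le> \<bar>level x h - y0\<bar> \<and> stream x (level x h) - stream x y0 = speed x \<xi> * (level x h - y0)" ..
  from choice[OF this] obtain \<xi> where "\<forall>x. \<bar>\<xi> x - y0\<bar> \<le> \<bar>level x h - y0\<bar> \<and>
    stream x (level x h) - stream x y0 = speed x (\<xi> x) * (level x h - y0)" ..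
  then have \<xi>: "\<bar>\<xi> x - y0\<bar> \<le> \<bar>level x h - y0\<bar>"
    "stream x (level x h) - stream x y0 = speed x (\<xi> x) * (level x h - y0)" for x by simp_all
  have lev: "((\<lambda>x. level x h) \<longlongrightarrow> y0) (at x0)"
    using continuous_level[of h] by (simp add: continuous_on_def y0_def)
  then have "((\<lambda>x. \<bar>level x h - y0\<bar>) \<longlongrightarrow> 0) (at x0)"
    by (intro tendsto_rabs_zero LIM_zero)
  then have "((\<lambda>x. \<xi> x - y0) \<longlongrightarrow> 0) (at x0)"
    by (rule Lim_null_comparison[rotated]) (simp add: \<xi>(1))
  then have "(\<xi> \<longlongrightarrow> y0) (at x0)" by (rule LIM_zero_cancel)
  then have pair: "((\<lambda>x. (x, \<xi> x)) \<longlongrightarrow> (x0, y0)) (at x0)" by (intro tendsto_Pair tendsto_ident_at)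
  have "isCont (\<lambda>(x, y). speed x y) (x0, y0)"
    using continuous_speed by (simp add: continuous_on_eq_continuous_at)
  from isCont_tendsto_compose[OF this pair]
  have sp: "((\<lambda>x. speed x (\<xi> x)) \<longlongrightarrow> speed x0 y0) (at x0)" by simp
  then have pos: "eventually (\<lambda>x. speed x (\<xi> x) > 0) (at x0)"
    using order_tendstoD(1)[OF sp, of 0] p by (simp add: y0_def)
  have "((\<lambda>x. (stream x y0 - stream x0 y0) / (x - x0)) \<longlongrightarrow> - vel2 x0 y0) (at x0)"
    using stream_deriv_x[of y0 x0] by (simp add: has_field_derivative_iff)
  from tendsto_divide[OF tendsto_minus[OF this] sp]
  have "((\<lambda>x. - ((stream x y0 - stream x0 y0) / (x - x0)) / speed x (\<xi> x)) \<longlongrightarrow> vel2 x0 y0 / speed x0 y0) (at x0)"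
    using p by (simp add: y0_def)
  then have "((\<lambda>x. (level x h - level x0 h) / (x - x0)) \<longlongrightarrow> vel2 x0 y0 / speed x0 y0) (at x0)"
  proof (rule Lim_transform_eventually)
    show "eventually (\<lambda>x. - ((stream x y0 - stream x0 y0) / (x - x0)) / speed x (\<xi> x)
       = (level x h - level x0 h) / (x - x0)) (at x0)"
      using pos
    proof eventually_elim
      case (elim x)
      have "stream x0 y0 = h" by (simp add: y0_def)
      then have "- (stream x y0 - stream x0 y0) = speed x (\<xi> x) * (level x h - y0)" using \<xi>(2)[of x] by simp
      then have "- ((stream x y0 - stream x0 y0) / (x - x0)) = speed x (\<xi> x) * (level x h - y0) / (x - x0)"
        unfolding minus_divide_left by simp
      then show ?case using elim by (simp add: y0_def)
    qed
  qed
  then show ?thesis by (simp add: has_field_derivative_iff y0_def)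
qed

section \<open>The flow\<close>

text \<open>Off the second axis the speed is positive, so whether a level line contains a stagnation
  point is decided at its single crossing with that axis.\<close>

definition regular_level :: "real \<Rightarrow> bool" where
  "regular_level h \<longleftrightarrow> osc_sq (level 0 h) \<noteq> 0"

lemma regular_level_speed_pos: "regular_level h \<Longrightarrow> speed x (level x h) > 0"
  by (cases "x = 0") (auto simp: regular_level_def intro: speed_pos)

text \<open>Only countably many levels are irregular; the value \<open>1\<close> is arbitrary.\<close>

definition slowness :: "real \<Rightarrow> real \<Rightarrow> real" where
  "slowness h x = (if regular_level h then 1 / speed x (level x h) else 1)"

lemma continuous_slowness: "continuous_on UNIV (slowness h)"
proof (cases "regular_level h")
  case True
  have "continuous_on UNIV (\<lambda>x. speed x (level x h))"
    by (rule continuous_on_case_prod_compose[OF continuous_speed]) (auto intro!: continuous_intros continuous_level)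
  then show ?thesis
    using regular_level_speed_pos[OF True] unfolding slowness_def[abs_def]
    by (auto intro!: continuous_intros simp: True less_imp_neq[symmetric])
qed (simp add: slowness_def[abs_def])

lemma slowness_ge: "slowness h x \<ge> 1 / 16"
  using speed_le[of x "level x h"] regular_level_speed_pos[of h x] by (auto simp: slowness_def field_simps)

lemma slowness_pos: "slowness h x > 0" using slowness_ge[of h x] by linarith

definition travel_time :: "real \<Rightarrow> real \<Rightarrow> real" where
  "travel_time h = primitive (slowness h)"

lemma travel_time_deriv: "(travel_time h has_real_derivative slowness h x) (at x)"
  unfolding travel_time_def by (rule primitive_deriv[OF continuous_slowness])

lemma travel_time_strict_mono: "a < b \<Longrightarrow> travel_time h a < travel_time h b"
  by (rule DERIV_pos_imp_increasing, assumption) (rule exI, rule conjI, rule travel_time_deriv, rule slowness_pos)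

lemma travel_time_less_iff [simp]: "travel_time h a < travel_time h b \<longleftrightarrow> a < b"
  using travel_time_strict_mono[of a b h] travel_time_strict_mono[of b a h]
  by (cases a b rule: linorder_cases) auto

lemma travel_time_inj: "travel_time h a = travel_time h b \<Longrightarrow> a = b"
  using travel_time_strict_mono[of a b h] travel_time_strict_mono[of b a h]
  by (cases a b rule: linorder_cases) auto

lemma continuous_travel_time: "continuous_on A (travel_time h)"
  by (intro continuous_at_imp_continuous_on ballI) (rule DERIV_isCont[OF travel_time_deriv])

text \<open>Speed at most 16 means that an infinite distance takes an infinite time. Hence
  \<open>position h\<close> is defined for all times and trajectories do not escape.\<close>

lemma travel_time_top: "filterlim (travel_time h) at_top at_top"
  and travel_time_bot: "filterlim (travel_time h) at_bot at_bot"
proof -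
  have up: "x / 16 \<le> travel_time h x" if "x \<ge> 0" for x
  proof -
    have "1 / 16 * (x - 0) \<le> travel_time h x - travel_time h 0"
      by (rule derivative_ge_imp_growth[OF that continuous_travel_time], rule conjI[OF travel_time_deriv slowness_ge])
    then show ?thesis by (simp add: travel_time_def)
  qed
  have dn: "travel_time h x \<le> x / 16" if "x \<le> 0" for x
  proof -
    have "1 / 16 * (0 - x) \<le> travel_time h 0 - travel_time h x"
      by (rule derivative_ge_imp_growth[OF that continuous_travel_time], rule conjI[OF travel_time_deriv slowness_ge])
    then show ?thesis by (simp add: travel_time_def)
  qed
  show "filterlim (travel_time h) at_top at_top"
    unfolding filterlim_at_top
  proof
    fix Z
    have "Z \<le> travel_time h x" if "x \<ge> max 0 (16 * Z)" for x using up[of x] that by simp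
    then show "eventually (\<lambda>x. Z \<le> travel_time h x) at_top" unfolding eventually_at_top_linorder by blast
  qed
  show "filterlim (travel_time h) at_bot at_bot"
    unfolding filterlim_at_bot
  proof
    fix Z
    have "travel_time h x \<le> Z" if "x \<le> min 0 (16 * Z)" for x using dn[of x] that by simp
    then show "eventually (\<lambda>x. travel_time h x \<le> Z) at_bot" unfolding eventually_at_bot_linorder by blast
  qed
qed

definition position :: "real \<Rightarrow> real \<Rightarrow> real" where
  "position h s = (THE x. travel_time h x = s)"

lemma travel_time_position [simp]: "travel_time h (position h s) = s"
proof -
  obtain x where x: "travel_time h x = s"
    using real_function_surj[OF travel_time_top travel_time_bot continuous_travel_time] by blast
  have "\<exists>!x. travel_time h x = s"
    using x travel_time_inj by blast
  then show ?thesis unfolding position_def by (rule theI')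
qed

lemma position_travel_time [simp]: "position h (travel_time h x) = x"
  by (rule travel_time_inj[of h]) simp

lemma position_less_iff: "position h s < a \<longleftrightarrow> s < travel_time h a"
  using travel_time_less_iff[of h "position h s" a] by simp

lemma position_deriv: "(position h has_real_derivative 1 / slowness h (position h s)) (at s)"
proof -
  have "isCont (position h) s"
  proof -
    have "((position h) \<longlongrightarrow> position h s) (at s)"
    proof (rule order_tendstoI)
      fix a assume "a < position h s"
      then have "travel_time h a < s" using travel_time_less_iff[of h a "position h s"] by simp
      then have "eventually (\<lambda>r. travel_time h a < r) (at s)" by (rule order_tendstoD(1)[OF tendsto_ident_at])
      then show "eventually (\<lambda>r. a < position h r) (at s)"
        using travel_time_less_iff[of h a "position h _"] by (simp add: eventually_mono)
    next
      fix a assume "position h s < a"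
      then have "s < travel_time h a" by (simp add: position_less_iff)
      then have "eventually (\<lambda>r. r < travel_time h a) (at s)" by (rule order_tendstoD(2)[OF tendsto_ident_at])
      then show "eventually (\<lambda>r. position h r < a) (at s)" by (simp add: position_less_iff)
    qed
    then show ?thesis by (simp add: isCont_def)
  qed
  then have "(position h has_real_derivative inverse (slowness h (position h s))) (at s)"
    by (intro DERIV_inverse_function[where f="travel_time h" and a="s - 1" and b="s + 1"] travel_time_deriv)
      (use slowness_pos[of h "position h s"] in auto)
  then show ?thesis by (simp add: inverse_eq_divide)
qed

definition flow :: "real \<Rightarrow> real^2 \<Rightarrow> real^2" where
  "flow t z = (let h = stream (z $ 1) (z $ 2); x = position h (travel_time h (z $ 1) + t) in vec2 x (level x h))"

text \<open>Coordinates in which the flow is a translation of \<open>s\<close>. By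
  \<open>nn_integral_chart\<close> they preserve Lebesgue measure, hence so does the flow.\<close>

definition chart :: "real \<Rightarrow> real \<Rightarrow> real^2" where
  "chart h s = vec2 (position h s) (level (position h s) h)"

lemma flow_eq: "flow t z = chart (stream (z $ 1) (z $ 2)) (travel_time (stream (z $ 1) (z $ 2)) (z $ 1) + t)"
  by (simp add: flow_def chart_def Let_def)

lemma flow_zero [simp]: "flow 0 z = z"
  by (simp add: flow_def Let_def)

lemma flow_chart [simp]: "flow t (chart h s) = chart h (s + t)"
  by (simp add: flow_eq) (simp add: chart_def)

section \<open>Measurability of the flow\<close>

lemma measurable_less_iffI:
  fixes f :: "'a \<Rightarrow> real"
  assumes "\<And>a. {x \<in> space M. f x < a} \<in> sets M"
  shows "f \<in> borel_measurable M"
  using assms by (subst borel_measurable_iff_less) auto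

lemma measurable_stream [measurable]: "(\<lambda>(x, y). stream x y) \<in> borel_measurable (borel \<Otimes>\<^sub>M borel)"
  using borel_measurable_continuous_onI[OF continuous_stream] by (simp add: borel_prod)

lemma measurable_speed: "(\<lambda>(x, y). speed x y) \<in> borel_measurable (borel \<Otimes>\<^sub>M borel)"
  using borel_measurable_continuous_onI[OF continuous_speed] by (simp add: borel_prod)

text \<open>Sublevel sets of an inverse function are conditions on the function itself:
  \<open>level x h < a\<close> means \<open>h < stream x a\<close>, which is continuous in
  \<open>x\<close> for fixed \<open>a\<close>. \<open>position\<close> is treated in the same
  way.\<close>

lemma measurable_level: "(\<lambda>(x, h). level x h) \<in> borel_measurable (borel \<Otimes>\<^sub>M borel)"
proof (rule measurable_less_iffI)
  fix a :: real
  have m: "(\<lambda>(x::real, h::real). stream x a - h) \<in> borel_measurable (borel \<Otimes>\<^sub>M borel)"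
  proof -
    have "(\<lambda>x. stream x a) \<in> borel_measurable borel"
      by (rule borel_measurable_continuous_onI[OF continuous_stream_slice(2)])
    then show ?thesis unfolding case_prod_unfold by measurable
  qed
  have "{z \<in> space (borel \<Otimes>\<^sub>M borel). (case z of (x, h) \<Rightarrow> level x h) < a}
     = {z \<in> space (borel \<Otimes>\<^sub>M borel). 0 < (case z of (x, h) \<Rightarrow> stream x a - h)}"
    by (auto simp: level_less_iff)
  then show "{z \<in> space (borel \<Otimes>\<^sub>M borel). (case z of (x, h) \<Rightarrow> level x h) < a} \<in> sets (borel \<Otimes>\<^sub>M borel)"
    using m by simp
qed

lemma measurable_level' [measurable]:
  assumes "f \<in> borel_measurable M" "g \<in> borel_measurable M"
  shows "(\<lambda>z. level (f z) (g z)) \<in> borel_measurable M"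
  using measurable_compose[OF measurable_Pair[OF assms] measurable_level] by simp

lemma measurable_speed' [measurable]:
  assumes "f \<in> borel_measurable M" "g \<in> borel_measurable M"
  shows "(\<lambda>z. speed (f z) (g z)) \<in> borel_measurable M"
  using measurable_compose[OF measurable_Pair[OF assms] measurable_speed] by simp

lemma measurable_stream' [measurable]:
  assumes "f \<in> borel_measurable M" "g \<in> borel_measurable M"
  shows "(\<lambda>z. stream (f z) (g z)) \<in> borel_measurable M"
  using measurable_compose[OF measurable_Pair[OF assms] measurable_stream] by simp

lemma measurable_regular_level [measurable]: "Measurable.pred borel regular_level"
proof -
  have [measurable]: "osc_sq \<in> borel_measurable borel" by (rule borel_measurable_continuous_onI[OF continuous_osc_sq])
  show ?thesis unfolding regular_level_def by measurable
qed

lemma measurable_slowness [measurable]: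
  assumes [measurable]: "f \<in> borel_measurable M" "g \<in> borel_measurable M"
  shows "(\<lambda>z. slowness (f z) (g z)) \<in> borel_measurable M"
  unfolding slowness_def by measurable

text \<open>Over the fixed measure \<open>lborel\<close> the integrand is jointly measurable in the
  parameters and \<open>u\<close>, which yields measurability of \<open>travel_time\<close> in both
  arguments.\<close>

lemma travel_time_eq_lborel:
  "travel_time h x = x * (\<integral>u. indicator {0..1} u * slowness h (u * x) \<partial>lborel)"
proof -
  have c: "continuous_on {0..1} (\<lambda>u. slowness h (u * x))"
    by (rule continuous_on_compose2[OF continuous_slowness]) (auto intro!: continuous_intros)
  have "set_integrable lborel {0..1} (\<lambda>u. slowness h (u * x))"
    unfolding set_integrable_def by (rule borel_integrable_compact) (use c in auto)
  then have "(LINT u:{0..1}|lborel. slowness h (u * x)) = integral {0..1} (\<lambda>u. slowness h (u * x))"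
    by (rule set_borel_integral_eq_integral)
  then show ?thesis by (simp add: travel_time_def primitive_def set_lebesgue_integral_def)
qed

lemma measurable_travel_time [measurable]:
  assumes [measurable]: "f \<in> borel_measurable M" "g \<in> borel_measurable M"
  shows "(\<lambda>z. travel_time (f z) (g z)) \<in> borel_measurable M"
proof -
  have "(\<lambda>(h, x). travel_time h x) \<in> borel_measurable (borel \<Otimes>\<^sub>M borel)"
    unfolding travel_time_eq_lborel by measurable
  from measurable_compose[OF measurable_Pair[OF assms] this] show ?thesis by simp
qed

lemma measurable_position [measurable]:
  assumes [measurable]: "f \<in> borel_measurable M" "g \<in> borel_measurable M"
  shows "(\<lambda>z. position (f z) (g z)) \<in> borel_measurable M"
proof (rule measurable_less_iffI)
  fix a :: real
  show "{z \<in> space M. position (f z) (g z) < a} \<in> sets M" unfolding position_less_iff by measurable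
qed

lemma measurable_chart [measurable]:
  assumes [measurable]: "f \<in> borel_measurable M" "g \<in> borel_measurable M"
  shows "(\<lambda>z. chart (f z) (g z)) \<in> borel_measurable M"
  unfolding chart_def by measurable

lemma measurable_flow [measurable]: "flow t \<in> borel_measurable borel"
  unfolding flow_eq[abs_def] by measurable

section \<open>Irregular levels and invariance of Lebesgue measure\<close>

lemma countable_zeros_osc_sq: "countable {y. osc_sq y = 0}"
proof -
  have c: "countable {u::real. cos (u / 5) = 0}"
  proof -
    have "{u::real. cos (u / 5) = 0} \<subseteq> range (\<lambda>i::int. 5 * (of_int i * (pi / 2)))"
    proof
      fix u :: real assume "u \<in> {u. cos (u / 5) = 0}"
      then obtain i :: int where "u / 5 = of_int i * (pi / 2)" by (auto simp: cos_zero_iff_int)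
      then show "u \<in> range (\<lambda>i::int. 5 * (of_int i * (pi / 2)))" by (intro image_eqI[of _ _ i]) (auto simp: field_simps)
    qed
    then show ?thesis by (rule countable_subset) simp
  qed
  define A where "A = {y::real. y > 0 \<and> osc_sq y = 0}"
  have "inj_on (\<lambda>y. vlog (y\<^sup>2)) A"
  proof (rule inj_onI)
    fix a b assume ab: "a \<in> A" "b \<in> A" "vlog (a\<^sup>2) = vlog (b\<^sup>2)"
    then have pos: "a > 0" "b > 0" by (auto simp: A_def)
    have "\<not> a < b" using vlog_strict_antimono[of "a\<^sup>2" "b\<^sup>2"] pos ab(3) by (auto simp: power_strict_mono)
    moreover have "\<not> b < a" using vlog_strict_antimono[of "b\<^sup>2" "a\<^sup>2"] pos ab(3) by (auto simp: power_strict_mono)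
    ultimately show "a = b" by simp
  qed
  moreover have "(\<lambda>y. vlog (y\<^sup>2)) ` A \<subseteq> {u. cos (u / 5) = 0}" by (auto simp: A_def osc_sq_def)
  then have "countable ((\<lambda>y. vlog (y\<^sup>2)) ` A)" using c by (rule countable_subset)
  ultimately have A: "countable A" by (rule countable_image_inj_on[rotated])
  have "{y. osc_sq y = 0} \<subseteq> insert 0 (A \<union> uminus ` A)"
  proof
    fix y assume y: "y \<in> {y. osc_sq y = 0}"
    consider "y = 0" | "y > 0" | "- y > 0" by linarith
    then show "y \<in> insert 0 (A \<union> uminus ` A)"
    proof cases
      case 3
      then have "- y \<in> A" using y by (simp add: A_def osc_sq_even)
      then have "- (- y) \<in> uminus ` A" by (rule imageI)
      then show ?thesis by simp
    qed (use y in \<open>auto simp: A_def\<close>)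
  qed
  then show ?thesis by (rule countable_subset) (use A in simp)
qed

lemma countable_irregular: "countable {h. \<not> regular_level h}"
proof -
  have "{h. \<not> regular_level h} \<subseteq> stream 0 ` {y. osc_sq y = 0}"
  proof
    fix h assume "h \<in> {h. \<not> regular_level h}"
    then show "h \<in> stream 0 ` {y. osc_sq y = 0}"
      by (intro image_eqI[of _ _ "level 0 h"]) (auto simp: regular_level_def)
  qed
  then show ?thesis by (rule countable_subset) (use countable_zeros_osc_sq in simp)
qed

lemma AE_countable: "countable S \<Longrightarrow> AE x in (lborel :: real measure). x \<notin> S"
  using countable_imp_null_set_lborel by (intro AE_not_in)

lemma AE_regular: "AE h in lborel. regular_level h"
  using AE_countable[OF countable_irregular] by simp

text \<open>A vertical line meets every level exactly once, so it contains only countably many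
  irregular points.\<close>

lemma AE_regular_point: "AE z in (lborel :: (real^2) measure). regular_level (stream (z $ 1) (z $ 2))"
proof (rule AE_real2I)
  have "Measurable.pred borel (\<lambda>z::real^2. \<not> regular_level (stream (z $ 1) (z $ 2)))" by measurable
  then show "{z::real^2. \<not> regular_level (stream (z $ 1) (z $ 2))} \<in> sets borel" by (simp add: pred_def)
  show "AE x in lborel. AE y in lborel. regular_level (stream (vec2 x y $ 1) (vec2 x y $ 2))"
  proof (rule AE_I2)
    fix x :: real
    have "{y. \<not> regular_level (stream x y)} \<subseteq> level x ` {h. \<not> regular_level h}"
    proof
      fix y assume "y \<in> {y. \<not> regular_level (stream x y)}"
      then show "y \<in> level x ` {h. \<not> regular_level h}" by (intro image_eqI[of _ _ "stream x y"]) auto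
    qed
    then have "countable {y. \<not> regular_level (stream x y)}"
      by (rule countable_subset) (use countable_irregular in simp)
    then show "AE y in lborel. regular_level (stream (vec2 x y $ 1) (vec2 x y $ 2))"
      using AE_countable by fastforce
  qed
qed

text \<open>The Jacobian of \<open>(x, h) \<mapsto> (x, level x h)\<close> is \<open>slowness h x\<close>, which is also the derivative of
  \<open>travel_time h\<close>; the two cancel.\<close>

lemma nn_integral_chart:
  fixes f :: "real^2 \<Rightarrow> ennreal"
  assumes [measurable]: "f \<in> borel_measurable borel"
  shows "(\<integral>\<^sup>+z. f z \<partial>lborel) = (\<integral>\<^sup>+h. \<integral>\<^sup>+s. f (chart h s) \<partial>lborel \<partial>lborel)"
proof -
  have 1: "(\<integral>\<^sup>+y. f (vec2 x y) \<partial>lborel) = (\<integral>\<^sup>+h. f (vec2 x (level x h)) * ennreal (slowness h x) \<partial>lborel)"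
    if x: "x \<noteq> 0" for x
  proof -
    define F where "F h = f (vec2 x (level x h)) * ennreal (1 / speed x (level x h))" for h
    have Fm: "F \<in> borel_measurable borel" unfolding F_def by measurable
    have pos: "speed x y > 0" for y using speed_pos x by simp
    have "(\<integral>\<^sup>+y. F (stream x y) * ennreal (speed x y) \<partial>lborel) = (\<integral>\<^sup>+h. F h \<partial>lborel)"
      by (rule nn_integral_substitution_real_line[OF Fm stream_deriv_y continuous_speed_slice pos stream_top stream_bot])
    moreover have "F (stream x y) * ennreal (speed x y) = f (vec2 x y)" for y
      using pos[of y] by (simp add: F_def mult.assoc ennreal_mult[symmetric])
    moreover have "(\<integral>\<^sup>+h. F h \<partial>lborel) = (\<integral>\<^sup>+h. f (vec2 x (level x h)) * ennreal (slowness h x) \<partial>lborel)"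
    proof (rule nn_integral_cong_AE)
      show "AE h in lborel. F h = f (vec2 x (level x h)) * ennreal (slowness h x)"
        using AE_regular by eventually_elim (simp add: F_def slowness_def)
    qed
    ultimately show ?thesis by simp
  qed
  have "(\<integral>\<^sup>+z. f z \<partial>lborel) = (\<integral>\<^sup>+x. \<integral>\<^sup>+y. f (vec2 x y) \<partial>lborel \<partial>lborel)" by (rule nn_integral_real2) measurable
  also have "\<dots> = (\<integral>\<^sup>+x. \<integral>\<^sup>+h. f (vec2 x (level x h)) * ennreal (slowness h x) \<partial>lborel \<partial>lborel)"
  proof (rule nn_integral_cong_AE)
    show "AE x in lborel. (\<integral>\<^sup>+y. f (vec2 x y) \<partial>lborel) = (\<integral>\<^sup>+h. f (vec2 x (level x h)) * ennreal (slowness h x) \<partial>lborel)"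
      using AE_lborel_singleton[of 0] by eventually_elim (rule 1)
  qed
  also have "\<dots> = (\<integral>\<^sup>+h. \<integral>\<^sup>+x. f (vec2 x (level x h)) * ennreal (slowness h x) \<partial>lborel \<partial>lborel)"
    by (rule lborel_pair.Fubini') measurable
  also have "\<dots> = (\<integral>\<^sup>+h. \<integral>\<^sup>+s. f (chart h s) \<partial>lborel \<partial>lborel)"
  proof (rule nn_integral_cong)
    fix h :: real
    have m: "(\<lambda>s. f (chart h s)) \<in> borel_measurable borel" by measurable
    have "(\<integral>\<^sup>+x. f (chart h (travel_time h x)) * ennreal (slowness h x) \<partial>lborel) = (\<integral>\<^sup>+s. f (chart h s) \<partial>lborel)"
      by (rule nn_integral_substitution_real_line[OF m travel_time_deriv continuous_slowness slowness_pos travel_time_top travel_time_bot])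
    then show "(\<integral>\<^sup>+x. f (vec2 x (level x h)) * ennreal (slowness h x) \<partial>lborel) = (\<integral>\<^sup>+s. f (chart h s) \<partial>lborel)"
      by (simp add: chart_def)
  qed
  finally show ?thesis .
qed

lemma nn_integral_flow:
  fixes f :: "real^2 \<Rightarrow> ennreal"
  assumes [measurable]: "f \<in> borel_measurable borel"
  shows "(\<integral>\<^sup>+z. f (flow t z) \<partial>lborel) = (\<integral>\<^sup>+z. f z \<partial>lborel)"
proof -
  have "(\<integral>\<^sup>+z. f (flow t z) \<partial>lborel) = (\<integral>\<^sup>+h. \<integral>\<^sup>+s. f (flow t (chart h s)) \<partial>lborel \<partial>lborel)"
    by (rule nn_integral_chart) measurable
  also have "\<dots> = (\<integral>\<^sup>+h. \<integral>\<^sup>+s. f (chart h s) \<partial>lborel \<partial>lborel)"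
  proof (rule nn_integral_cong)
    fix h :: real
    have m: "(\<lambda>s. f (chart h s)) \<in> borel_measurable borel" by measurable
    show "(\<integral>\<^sup>+s. f (flow t (chart h s)) \<partial>lborel) = (\<integral>\<^sup>+s. f (chart h s) \<partial>lborel)"
      using nn_integral_real_affine[OF m, of 1 t] by (simp add: add.commute)
  qed
  also have "\<dots> = (\<integral>\<^sup>+z. f z \<partial>lborel)" by (rule nn_integral_chart[symmetric]) measurable
  finally show ?thesis .
qed

lemma flow_measure_preserving:
  assumes "A \<in> sets borel"
  shows "emeasure (distr lebesgue borel (flow t)) A = emeasure lborel A"
proof -
  have fm: "flow t \<in> borel_measurable lebesgue" by (intro measurable_completion) simp
  have v: "flow t -` A \<in> sets borel" using measurable_sets[OF measurable_flow assms] by simp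
  have "emeasure (distr lebesgue borel (flow t)) A = emeasure lebesgue (flow t -` A)"
    using emeasure_distr[OF fm assms] by simp
  also have "\<dots> = emeasure lborel (flow t -` A)" using v by simp
  also have "\<dots> = (\<integral>\<^sup>+z. indicator (flow t -` A) z \<partial>lborel)" using v by simp
  also have "\<dots> = (\<integral>\<^sup>+z. indicator A (flow t z) \<partial>lborel)"
    by (rule nn_integral_cong) (simp add: indicator_def)
  also have "\<dots> = (\<integral>\<^sup>+z. indicator A z \<partial>lborel)"
    by (rule nn_integral_flow) (use assms in simp)
  also have "\<dots> = emeasure lborel A" using assms by simp
  finally show ?thesis .
qed

lemma flow_has_derivative:
  assumes "regular_level (stream (z $ 1) (z $ 2))"
  shows "((\<lambda>s. flow s z) has_vector_derivative field (flow t z)) (at t)"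
proof -
  define h where "h = stream (z $ 1) (z $ 2)"
  define x where "x t = position h (travel_time h (z $ 1) + t)" for t
  have flow: "flow t z = vec2 (x t) (level (x t) h)" for t by (simp add: flow_def Let_def x_def h_def)
  have p: "speed (x t) (level (x t) h) > 0" using regular_level_speed_pos assms by (simp add: h_def)
  have sl: "1 / slowness h (x t) = speed (x t) (level (x t) h)" using assms by (simp add: slowness_def h_def)
  have dx: "(x has_real_derivative speed (x t) (level (x t) h)) (at t)"
    unfolding sl[symmetric] unfolding x_def
    by (rule DERIV_cong, rule DERIV_chain2[OF position_deriv]) (auto intro!: derivative_eq_intros)
  have dy: "((\<lambda>t. level (x t) h) has_real_derivative vel2 (x t) (level (x t) h)) (at t)"
    using DERIV_chain2[OF level_deriv[OF p] dx] p by simp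
  have "((\<lambda>s. x s *\<^sub>R axis 1 1 + level (x s) h *\<^sub>R axis 2 1) has_vector_derivative
     speed (x t) (level (x t) h) *\<^sub>R axis 1 1 + vel2 (x t) (level (x t) h) *\<^sub>R (axis 2 1 :: real^2)) (at t)"
    using dx dy by (intro has_vector_derivative_add has_vector_derivative_scaleR[where g="\<lambda>_. c" and g'=0 for c, simplified])
      (auto intro!: derivative_eq_intros)
  then show ?thesis unfolding flow field_def vec2_nth unfolding vec2_eq_add .
qed

lemma flow_lipschitz:
  assumes "regular_level (stream (z $ 1) (z $ 2))" "u \<le> v"
  shows "norm (flow v z - flow u z) \<le> (16 + 80 * pi) * (v - u)"
proof -
  have "norm (flow v z - flow u z) \<le> (16 + 80 * pi) * norm (v - u)"
  proof (rule differentiable_bound[where S=UNIV and f'="\<lambda>t h. h *\<^sub>R field (flow t z)"])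
    show "((\<lambda>s. flow s z) has_derivative (\<lambda>h. h *\<^sub>R field (flow t z))) (at t within UNIV)" for t
      using flow_has_derivative[OF assms(1), of t] by (simp add: has_vector_derivative_def)
    show "onorm (\<lambda>h. h *\<^sub>R field (flow t z)) \<le> 16 + 80 * pi" for t
      by (rule onorm_le) (use field_bounded[of "flow t z"] in \<open>simp add: mult.commute[of _ "\<bar>_\<bar>"] mult_left_mono\<close>)
  qed auto
  then show ?thesis using assms(2) by simp
qed

lemma field_flow_exists: "regular_lagrangian_flow \<infinity> (\<lambda>_. field) flow"
  unfolding regular_lagrangian_flow_def
proof (intro conjI)
  have "continuous_on UNIV (\<lambda>(t::real, x). field x)"
    unfolding case_prod_unfold by (rule continuous_on_compose2[OF continuous_field]) (auto intro!: continuous_intros)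
  then show "locally_integrable_on ({t. 0 < t \<and> ereal t < \<infinity>} \<times> UNIV) (\<lambda>(t, x). field x)"
    by (rule locally_integrable_continuous)
  have s: "{t. 0 \<le> t \<and> ereal t < \<infinity>} = {0..}" by auto
  have "AE z in lebesgue. regular_level (stream ((z::real^2) $ 1) (z $ 2))"
    by (rule AE_completion[OF AE_regular_point])
  then show "AE x in lebesgue. abs_continuous_on {t. 0 \<le> t \<and> ereal t < \<infinity>} (\<lambda>t. flow t x) \<and> flow 0 x = x \<and>
    (AE t in lebesgue. 0 < t \<and> ereal t < \<infinity> \<longrightarrow> ((\<lambda>s. flow s x) has_vector_derivative field (flow t x)) (at t))"
  proof eventually_elim
    case (elim z)
    \<comment> \<open>As the difference of 0 and its negative, the Lipschitz curve falls under
      \<open>abs_continuous_on_diff_lipschitz\<close>.\<close>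
    have "abs_continuous_on {0..} (\<lambda>t. (0::real^2) - (- flow t z))"
    proof (rule abs_continuous_on_diff_lipschitz[where L="16 + 80 * pi"])
      show "abs_continuous_on {0..} (\<lambda>_. 0::real^2)" by (auto simp: abs_continuous_on_def intro: exI[of _ 1])
      show "norm (- flow v z - - flow u z) \<le> (16 + 80 * pi) * (v - u)" if "u \<le> v" for u v
        using flow_lipschitz[OF elim that] by (simp add: norm_minus_commute)
    qed simp
    then show ?case using flow_has_derivative[OF elim] unfolding s by simp
  qed
  show "\<exists>L>0. \<forall>t. 0 \<le> t \<and> ereal t < \<infinity> \<longrightarrow> flow t \<in> borel_measurable lebesgue \<and>
     (\<forall>A\<in>sets borel. emeasure (distr lebesgue borel (flow t)) A \<le> ennreal L * emeasure lborel A)"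
    by (intro exI[of _ 1] conjI allI impI ballI measurable_completion) (simp_all add: flow_measure_preserving)
qed

section \<open>Trajectories that pass and trajectories that get stuck\<close>

text \<open>Taken within \<open>{0..}\<close>, the derivative is one-sided at time 0, so that
  conservation of \<open>stream\<close> includes the initial point.\<close>

definition trajectory :: "(real \<Rightarrow> real^2) \<Rightarrow> bool" where
  "trajectory Z \<longleftrightarrow> (\<forall>t\<ge>0. (Z has_vector_derivative field (Z t)) (at t within {0..}))"

lemma AE_trajectory:
  assumes "regular_lagrangian_flow \<infinity> (\<lambda>_. field) X"
  shows "AE z in lebesgue. X 0 z = z \<and> trajectory (\<lambda>t. X t z)"
proof -
  have s: "{t. 0 \<le> t \<and> ereal t < \<infinity>} = {0..}" by auto
  have "AE x in lebesgue. abs_continuous_on {0..} (\<lambda>t. X t x) \<and> X 0 x = x \<and>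
    (AE t in lebesgue. 0 < t \<longrightarrow> ((\<lambda>s. X s x) has_vector_derivative field (X t x)) (at t))"
    using assms unfolding regular_lagrangian_flow_def s by simp
  then show ?thesis
  proof eventually_elim
    case (elim z)
    show ?case unfolding trajectory_def
      using elim ae_solution_classical[OF _ continuous_field field_bounded] by blast
  qed
qed

context
  fixes Z :: "real \<Rightarrow> real^2"
  assumes Z: "trajectory Z"
begin

lemma trajectory_deriv_within:
  assumes "t \<ge> 0"
  shows "((\<lambda>t. Z t $ i) has_real_derivative field (Z t) $ i) (at t within {0..})"
proof -
  have "(Z has_derivative (\<lambda>h. h *\<^sub>R field (Z t))) (at t within {0..})"
    using Z assms by (simp add: trajectory_def has_vector_derivative_def)
  from bounded_linear.has_derivative[OF bounded_linear_vec_nth this]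
  show ?thesis by (simp add: has_field_derivative_def mult_commute_abs)
qed

lemma trajectory_deriv:
  assumes "t > 0"
  shows "((\<lambda>t. Z t $ 1) has_real_derivative speed (Z t $ 1) (Z t $ 2)) (at t)"
proof -
  have "t \<in> interior {0..}" using assms by (simp add: interior_real_atLeast)
  from at_within_interior[OF this] show ?thesis
    using trajectory_deriv_within[of t 1] assms by simp
qed

lemma trajectory_continuous: "a \<ge> 0 \<Longrightarrow> continuous_on {a..b} (\<lambda>t. Z t $ 1)"
proof -
  assume "a \<ge> 0"
  have "continuous_on {0..} (\<lambda>t. Z t $ 1)"
    by (rule DERIV_continuous_on) (use trajectory_deriv_within[of _ 1] in simp)
  then show ?thesis by (rule continuous_on_subset) (use \<open>a \<ge> 0\<close> in auto)
qed

lemma trajectory_level: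
  assumes "t \<ge> 0"
  shows "stream (Z t $ 1) (Z t $ 2) = stream (Z 0 $ 1) (Z 0 $ 2)"
proof -
  have "((\<lambda>t. stream (Z t $ 1) (Z t $ 2)) has_derivative (\<lambda>h. 0)) (at t within {0..})" if t: "t \<in> {0..}" for t
  proof -
    have 1: "((\<lambda>t. (Z t $ 1, Z t $ 2)) has_derivative (\<lambda>h. (h * field (Z t) $ 1, h * field (Z t) $ 2))) (at t within {0..})"
      using trajectory_deriv_within[of t 1] trajectory_deriv_within[of t 2] t
      by (intro has_derivative_Pair) (simp_all add: has_field_derivative_def mult_commute_abs)
    have "((\<lambda>t. case (Z t $ 1, Z t $ 2) of (x, y) \<Rightarrow> stream x y) has_derivative
      (\<lambda>h. case (h * field (Z t) $ 1, h * field (Z t) $ 2) of (u, v) \<Rightarrow>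
        u * (- vel2 (Z t $ 1) (Z t $ 2)) + v * speed (Z t $ 1) (Z t $ 2))) (at t within {0..})"
      by (rule has_derivative_compose[OF 1 stream_has_derivative])
    then show ?thesis by (simp add: mult_ac)
  qed
  then obtain c where "\<And>s. s \<in> {0..} \<Longrightarrow> stream (Z s $ 1) (Z s $ 2) = c"
    using has_derivative_zero_constant[of "{0..}" "\<lambda>t. stream (Z t $ 1) (Z t $ 2)"] by auto
  then show ?thesis using assms by simp
qed

lemma trajectory_mono:
  assumes "0 \<le> s" "s \<le> t" shows "Z s $ 1 \<le> Z t $ 1"
proof -
  have "0 * (t - s) \<le> Z t $ 1 - Z s $ 1"
  proof (rule derivative_ge_imp_growth[OF assms(2) trajectory_continuous[OF assms(1)]])
    fix r assume "s < r"
    then have "r > 0" using assms(1) by simp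
    from trajectory_deriv[OF this] show "((\<lambda>t. Z t $ 1) has_real_derivative speed (Z r $ 1) (Z r $ 2)) (at r) \<and> 0 \<le> speed (Z r $ 1) (Z r $ 2)"
      by (simp add: speed_nonneg)
  qed
  then show ?thesis by simp
qed

end

text \<open>Up to a constant factor, the time needed to go from \<open>0\<close> to \<open>x\<close> at speed \<open>rho (x\<^sup>2)\<close>.\<close>

definition crossing_time :: "real \<Rightarrow> real" where
  "crossing_time x = sgn x / (4 + vlog (x\<^sup>2))"

text \<open>\<open>4 + vlog (x\<^sup>2)\<close> is at least \<open>- 2 * ln \<bar>x\<bar>\<close>,
  hence at least \<open>1 / e\<close> when \<open>\<bar>x\<bar> \<le> exp (- 1 / e)\<close>. This
  determines how close to the second axis the trajectories have to start.\<close>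

lemma crossing_time_small:
  assumes e: "e > 0" and x: "\<bar>x\<bar> \<le> exp (- 1 / e)"
  shows "\<bar>crossing_time x\<bar> \<le> e"
proof (cases "x = 0")
  case False
  have "- ln \<bar>x\<bar> \<ge> 1 / e"
    using x False ln_le_cancel_iff[of "\<bar>x\<bar>" "exp (- 1 / e)"] by simp
  moreover have "vlog (x\<^sup>2) \<ge> - ln (x\<^sup>2)" using False vlog_eq[of "x\<^sup>2"] by simp
  moreover have "ln (x\<^sup>2) = 2 * ln \<bar>x\<bar>" using False ln_realpow[of "\<bar>x\<bar>" 2] by simp
  moreover have "1 / e > 0" using e by simp
  ultimately have v: "4 + vlog (x\<^sup>2) \<ge> 1 / e" by linarith
  have p: "0 < 4 + vlog (x\<^sup>2)" using v \<open>1 / e > 0\<close> by linarith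
  with v have "1 / (4 + vlog (x\<^sup>2)) \<le> 1 / (1 / e)" using e by (intro divide_left_mono mult_pos_pos) auto
  then show ?thesis using False p by (simp add: crossing_time_def abs_divide abs_sgn_eq)
qed (use e in \<open>simp add: crossing_time_def\<close>)

lemma crossing_time_mono_pos:
  assumes "0 < x" "x \<le> y" shows "crossing_time x \<le> crossing_time y"
proof -
  have "x\<^sup>2 \<le> y\<^sup>2" "0 < x\<^sup>2" using assms by (simp_all add: power_mono)
  then have "vlog (y\<^sup>2) \<le> vlog (x\<^sup>2)" by (intro vlog_antimono)
  moreover have "0 \<le> vlog (y\<^sup>2)" by (rule vlog_nonneg) simp
  ultimately have "1 / (4 + vlog (x\<^sup>2)) \<le> 1 / (4 + vlog (y\<^sup>2))" by (intro frac_le) linarith+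
  then show ?thesis using assms by (simp add: crossing_time_def)
qed

lemma crossing_time_odd: "crossing_time (- x) = - crossing_time x"
  by (simp add: crossing_time_def sgn_minus)

lemma crossing_time_nonpos: "x \<le> 0 \<Longrightarrow> crossing_time x \<le> 0"
  unfolding crossing_time_def using vlog_nonneg[of "x\<^sup>2"] by (intro divide_nonpos_nonneg) (simp_all add: sgn_if)

lemma crossing_time_mono: "crossing_time x \<le> crossing_time y" if "x \<le> y"
proof -
  have p: "crossing_time z \<ge> 0" if "z \<ge> 0" for z using crossing_time_nonpos[of "- z"] that by (simp add: crossing_time_odd)
  consider "0 < x" | "y < 0" | "x \<le> 0" "0 \<le> y" using that by linarith
  then show ?thesis
  proof cases
    case 2 then show ?thesis using crossing_time_mono_pos[of "- y" "- x"] that by (simp add: crossing_time_odd)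
  next
    case 3 then show ?thesis using p[of y] crossing_time_nonpos[of x] by simp
  qed (use that crossing_time_mono_pos in blast)
qed

lemma crossing_time_deriv:
  assumes "x \<noteq> 0"
  shows "(crossing_time has_real_derivative 2 / (\<bar>x\<bar> * (1 + x\<^sup>2) * (4 + vlog (x\<^sup>2))\<^sup>2)) (at x)"
proof -
  have v: "4 + vlog (x\<^sup>2) \<noteq> 0" using vlog_nonneg[of "x\<^sup>2"] by simp
  have p: "1 + x\<^sup>2 \<noteq> 0" using zero_le_power2[of x] by linarith
  have "((\<lambda>x. s / (4 + vlog (x\<^sup>2))) has_real_derivative s * (2 / (x * (1 + x\<^sup>2))) / (4 + vlog (x\<^sup>2))\<^sup>2) (at x)" for s
    by (rule DERIV_cong, (rule derivative_intros vlog_sq_deriv assms v refl)+)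
      (simp add: power2_eq_square)
  from this[of "sgn x"] have d: "((\<lambda>z. sgn x / (4 + vlog (z\<^sup>2))) has_real_derivative 2 / (\<bar>x\<bar> * (1 + x\<^sup>2) * (4 + vlog (x\<^sup>2))\<^sup>2)) (at x)"
    by (rule DERIV_cong) (use assms in \<open>simp add: sgn_if abs_if divide_simps\<close>)
  show ?thesis
  proof (rule has_field_derivative_transform_within_open[OF d, of "if x > 0 then {0<..} else {..<0}"])
    fix z :: real assume "z \<in> (if x > 0 then {0<..} else {..<0})"
    then show "sgn x / (4 + vlog (z\<^sup>2)) = crossing_time z"
      using assms by (auto simp: crossing_time_def sgn_if split: if_splits)
  qed (use assms in auto)
qed

text \<open>The squared logarithm in the derivative of \<open>crossing_time\<close> cancels the one
  in \<open>rho\<close>. The remaining factor of \<open>rho (x\<^sup>2)\<close> is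
  \<open>\<bar>x\<bar> / sqrt (1 + x\<^sup>2)\<close>, at least \<open>\<bar>x\<bar> / 2\<close>. So
  \<open>crossing_time\<close> grows along a fast trajectory at a rate of at least 1/8, however
  close to the origin the trajectory passes.\<close>

lemma crossing_time_rate:
  assumes "x \<noteq> 0" "\<bar>x\<bar> \<le> 1" "rho (x\<^sup>2) / 4 \<le> s"
  shows "1 / 8 \<le> 2 / (\<bar>x\<bar> * (1 + x\<^sup>2) * (4 + vlog (x\<^sup>2))\<^sup>2) * s"
proof -
  define w E where "w = 4 + vlog (x\<^sup>2)" and "E = exp (- vlog (x\<^sup>2) / 2)"
  have w: "w > 0" using vlog_nonneg[of "x\<^sup>2"] by (simp add: w_def)
  have x2: "x\<^sup>2 > 0" "x\<^sup>2 \<le> 1" using assms by (auto simp: abs_square_le_1)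
  have p: "1 + x\<^sup>2 > 0" using x2 by linarith
  have "E\<^sup>2 = exp (- vlog (x\<^sup>2))" unfolding E_def power2_eq_square exp_add[symmetric] by simp
  also have "\<dots> = x\<^sup>2 / (1 + x\<^sup>2)"
    using x2 p by (simp add: vlog_eq exp_diff)
  finally have E2: "E\<^sup>2 = x\<^sup>2 / (1 + x\<^sup>2)" .
  have "(\<bar>x\<bar> / 2)\<^sup>2 \<le> E\<^sup>2"
  proof -
    have "x\<^sup>2 / 4 \<le> x\<^sup>2 / (1 + x\<^sup>2)" using x2 p by (intro divide_left_mono mult_pos_pos) auto
    then show ?thesis unfolding E2 by (simp add: power_divide)
  qed
  then have E: "\<bar>x\<bar> / 2 \<le> E" by (rule power2_le_imp_le) (simp add: E_def)
  have r: "rho (x\<^sup>2) = w\<^sup>2 * E" using rho_eq[OF x2(1)] by (simp add: w_def E_def)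
  have "1 / 2 \<le> 1 / (1 + x\<^sup>2)" using x2 p by (intro divide_left_mono) auto
  then have "(1 / 4) * (1 / 2) \<le> (1 / 4) * (1 / (1 + x\<^sup>2))" by (rule mult_left_mono) simp
  then have "1 / 8 \<le> (1 / 4) * (1 / (1 + x\<^sup>2))" by (simp only: times_divide_times_eq mult_1 numeral_times_numeral semiring_norm)
  also have "\<dots> = 2 / (\<bar>x\<bar> * (1 + x\<^sup>2)) * ((\<bar>x\<bar> / 2) / 4)"
    using assms(1) p by (simp add: divide_simps)
  also have "\<dots> \<le> 2 / (\<bar>x\<bar> * (1 + x\<^sup>2)) * (E / 4)"
    using E x2 by (intro mult_left_mono) auto
  also have "\<dots> = 2 / (\<bar>x\<bar> * (1 + x\<^sup>2) * w\<^sup>2) * (rho (x\<^sup>2) / 4)"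
    unfolding r using w by simp
  also have "\<dots> \<le> 2 / (\<bar>x\<bar> * (1 + x\<^sup>2) * w\<^sup>2) * s"
    using assms(3) x2 by (intro mult_left_mono) auto
  finally show ?thesis by (simp add: w_def)
qed

lemma isCont_crossing_time_0: "isCont crossing_time 0"
  unfolding isCont_def LIM_eq
proof (intro allI impI)
  fix r :: real assume r: "r > 0"
  show "\<exists>s>0. \<forall>x. x \<noteq> 0 \<and> norm (x - 0) < s \<longrightarrow> norm (crossing_time x - crossing_time 0) < r"
  proof (intro exI[of _ "exp (- 1 / (r / 2))"] conjI allI impI)
    fix x :: real assume "x \<noteq> 0 \<and> norm (x - 0) < exp (- 1 / (r / 2))"
    then have "\<bar>crossing_time x\<bar> \<le> r / 2" using r by (intro crossing_time_small) auto
    then show "norm (crossing_time x - crossing_time 0) < r" using r by (simp add: crossing_time_def[of 0])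
  qed simp
qed

lemma continuous_crossing_time: "continuous_on A crossing_time"
proof (intro continuous_at_imp_continuous_on ballI)
  fix x show "isCont crossing_time x"
    by (cases "x = 0") (use isCont_crossing_time_0 DERIV_isCont[OF crossing_time_deriv] in simp_all)
qed

text \<open>The bound is imposed on the whole line, so conservation of \<open>stream\<close> makes
  it available at every time. Positive \<open>y\<close> keeps the line off the origin, hence the
  speed on it strictly positive.\<close>

definition fast_level :: "real \<Rightarrow> bool" where
  "fast_level h \<longleftrightarrow> (\<forall>x y. stream x y = h \<longrightarrow> y > 0 \<and> rho (x\<^sup>2 + y\<^sup>2) / 4 \<le> speed x y)"

text \<open>Between \<open>- \<delta>\<close> and \<open>\<delta>\<close>,
  \<open>crossing_time\<close> increases by only \<open>2 * crossing_time \<delta> < t / 8\<close>,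
  whereas at rate 1/8 it gains \<open>t / 8\<close> in time \<open>t\<close>.\<close>

lemma trajectory_passes:
  assumes Z: "trajectory Z" and h: "fast_level (stream (Z 0 $ 1) (Z 0 $ 2))"
    and \<delta>: "0 < \<delta>" "\<delta> \<le> 1" "crossing_time \<delta> < t / 16" and x0: "Z 0 $ 1 \<ge> - \<delta>" and t: "t > 0"
  shows "Z t $ 1 \<ge> \<delta>"
proof (rule ccontr)
  assume "\<not> Z t $ 1 \<ge> \<delta>"
  then have lt: "Z t $ 1 < \<delta>" by simp
  define \<xi> where "\<xi> s = Z s $ 1" for s
  define g where "g s = crossing_time (\<xi> s)" for s
  have rate: "rho ((\<xi> s)\<^sup>2) / 4 \<le> speed (\<xi> s) (Z s $ 2)" "speed (\<xi> s) (Z s $ 2) > 0" if "s \<ge> 0" for s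
  proof -
    have f: "Z s $ 2 > 0" "rho ((\<xi> s)\<^sup>2 + (Z s $ 2)\<^sup>2) / 4 \<le> speed (\<xi> s) (Z s $ 2)"
      using h trajectory_level[OF Z that] unfolding fast_level_def \<xi>_def by auto
    moreover have "rho ((\<xi> s)\<^sup>2) \<le> rho ((\<xi> s)\<^sup>2 + (Z s $ 2)\<^sup>2)" by (rule rho_mono) auto
    ultimately show "rho ((\<xi> s)\<^sup>2) / 4 \<le> speed (\<xi> s) (Z s $ 2)" by linarith
    have "rho ((\<xi> s)\<^sup>2 + (Z s $ 2)\<^sup>2) > 0" using f(1) by (intro rho_pos) (simp add: add_nonneg_pos)
    then show "speed (\<xi> s) (Z s $ 2) > 0" using f(2) by linarith
  qed
  have bd: "\<bar>\<xi> s\<bar> \<le> 1" if "0 \<le> s" "s \<le> t" for s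
    using trajectory_mono[OF Z, of 0 s] trajectory_mono[OF Z, of s t] that x0 lt \<delta> by (simp add: \<xi>_def)
  have strict: "\<xi> a < \<xi> b" if "0 \<le> a" "a < b" for a b
    unfolding \<xi>_def
  proof (rule DERIV_pos_imp_increasing_open[OF that(2) _ trajectory_continuous[OF Z that(1)]])
    fix s assume "a < s"
    then have s: "s > 0" using that by simp
    show "\<exists>y. ((\<lambda>s. Z s $ 1) has_real_derivative y) (at s) \<and> 0 < y"
      using trajectory_deriv[OF Z s] rate(2)[of s] s unfolding \<xi>_def by (intro exI conjI) simp_all
  qed
  have cont: "continuous_on {a..b} g" if "a \<ge> 0" for a b
    unfolding g_def \<xi>_def by (rule continuous_on_compose2[OF continuous_crossing_time trajectory_continuous[OF Z that] subset_UNIV])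
  have grow: "1 / 8 * (b - a) \<le> g b - g a"
    if ab: "0 \<le> a" "a \<le> b" "b \<le> t" and nz: "\<And>s. a < s \<Longrightarrow> s < b \<Longrightarrow> \<xi> s \<noteq> 0" for a b
  proof (rule derivative_ge_imp_growth[OF ab(2) cont[OF ab(1)]])
    fix s assume s: "a < s" "s < b"
    have "(g has_real_derivative 2 / (\<bar>\<xi> s\<bar> * (1 + (\<xi> s)\<^sup>2) * (4 + vlog ((\<xi> s)\<^sup>2))\<^sup>2) * speed (\<xi> s) (Z s $ 2)) (at s)"
      unfolding g_def
    proof (rule DERIV_chain2[where f=crossing_time and g=\<xi>, OF crossing_time_deriv[OF nz[OF s]]])
      show "(\<xi> has_real_derivative speed (\<xi> s) (Z s $ 2)) (at s)"
        using trajectory_deriv[OF Z, of s] s ab(1) unfolding \<xi>_def by simp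
    qed
    moreover have "1 / 8 \<le> 2 / (\<bar>\<xi> s\<bar> * (1 + (\<xi> s)\<^sup>2) * (4 + vlog ((\<xi> s)\<^sup>2))\<^sup>2) * speed (\<xi> s) (Z s $ 2)"
      by (rule crossing_time_rate[OF nz[OF s] bd rate(1)]) (use s ab in auto)
    ultimately show "(g has_real_derivative 2 / (\<bar>\<xi> s\<bar> * (1 + (\<xi> s)\<^sup>2) * (4 + vlog ((\<xi> s)\<^sup>2))\<^sup>2) * speed (\<xi> s) (Z s $ 2)) (at s) \<and>
       1 / 8 \<le> 2 / (\<bar>\<xi> s\<bar> * (1 + (\<xi> s)\<^sup>2) * (4 + vlog ((\<xi> s)\<^sup>2))\<^sup>2) * speed (\<xi> s) (Z s $ 2)" ..
  qed
  \<comment> \<open>\<open>crossing_time\<close> is not differentiable at 0. As the first component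
    increases strictly, it vanishes at most once, and the time interval is split there.\<close>
  have "1 / 8 * (t - 0) \<le> g t - g 0"
  proof (cases "\<exists>s. 0 \<le> s \<and> s \<le> t \<and> \<xi> s = 0")
    case True
    then obtain s where s: "0 \<le> s" "s \<le> t" "\<xi> s = 0" by blast
    have "\<xi> r \<noteq> 0" if "0 \<le> r" "r \<noteq> s" for r
      using strict[of r s] strict[of s r] that s by (cases r s rule: linorder_cases) auto
    then have "1 / 8 * (s - 0) \<le> g s - g 0" "1 / 8 * (t - s) \<le> g t - g s"
      using s by (intro grow; simp)+
    then show ?thesis by simp
  next
    case False
    show ?thesis by (rule grow) (use t False in auto)
  qed
  moreover have "g 0 \<ge> - crossing_time \<delta>" using crossing_time_mono[OF x0] by (simp add: g_def \<xi>_def crossing_time_odd)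
  moreover have "g t \<le> crossing_time \<delta>" using crossing_time_mono[of "Z t $ 1" \<delta>] lt by (simp add: g_def \<xi>_def)
  ultimately show False using \<delta>(3) by simp
qed

section \<open>Levels near a maximum of the oscillating factor\<close>

lemma speed_ge_rho_between:
  assumes "\<bar>y\<bar> \<le> \<bar>x\<bar> \<or> 1 / 4 \<le> (cos (vlog (y\<^sup>2) / 5))\<^sup>2" "0 \<le> c" "c\<^sup>2 \<le> x\<^sup>2 + y\<^sup>2"
  shows "rho (c\<^sup>2) / 4 \<le> speed x y"
  using speed_ge_rho[of y x] rho_mono[of "c\<^sup>2" "x\<^sup>2 + y\<^sup>2"] assms by auto

text \<open>Heights within a ratio of 9 have squares within a ratio of 81, and
  \<open>81 \<le> exp 5\<close>. Their phases, which are \<open>vlog\<close> of the squares divided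
  by 5, thus differ by at most 1, which is below \<open>pi / 3\<close>.\<close>

lemma vlog_sq_diff:
  assumes "0 < a" "a \<le> b" "b \<le> 9 * a"
  shows "0 \<le> vlog (a\<^sup>2) - vlog (b\<^sup>2)" "vlog (a\<^sup>2) - vlog (b\<^sup>2) \<le> 5"
proof -
  have b: "b > 0" using assms by simp
  have ab: "a\<^sup>2 \<le> b\<^sup>2" using assms by (intro power_mono) auto
  show "0 \<le> vlog (a\<^sup>2) - vlog (b\<^sup>2)" using vlog_antimono[OF _ ab] assms by simp
  have "5 / 2 \<le> exp (1::real)" using exp_lower_Taylor_quadratic[of 1] by simp
  then have "(5 / 2) ^ 5 \<le> (exp (1::real)) ^ 5" by (intro power_mono) auto
  then have e: "81 \<le> exp (5::real)" using exp_of_nat_mult[of 5 "1::real"] by (simp add: power_divide)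
  have "b\<^sup>2 \<le> (9 * a)\<^sup>2" using assms b by (intro power_mono) auto
  then have ab2: "b\<^sup>2 \<le> 81 * a\<^sup>2" by (simp add: power_mult_distrib)
  have "(1 + 1 / a\<^sup>2) \<le> exp 5 * (1 + 1 / b\<^sup>2)"
  proof -
    have "1 / a\<^sup>2 \<le> 81 * (1 / b\<^sup>2)" using ab2 assms b by (simp add: field_simps)
    then have "1 + 1 / a\<^sup>2 \<le> 81 * (1 + 1 / b\<^sup>2)" by simp
    also have "\<dots> \<le> exp 5 * (1 + 1 / b\<^sup>2)" using e b by (intro mult_right_mono) auto
    finally show ?thesis .
  qed
  moreover have p: "0 < 1 + 1 / a\<^sup>2" "0 < 1 + 1 / b\<^sup>2" using assms b by (auto intro!: add_pos_pos)
  ultimately have "ln (1 + 1 / a\<^sup>2) \<le> ln (exp 5 * (1 + 1 / b\<^sup>2))" by (subst ln_le_cancel_iff) auto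
  also have "\<dots> = 5 + ln (1 + 1 / b\<^sup>2)" using p by (subst ln_mult) auto
  finally show "vlog (a\<^sup>2) - vlog (b\<^sup>2) \<le> 5" by (simp add: vlog_def)
qed

lemma cos_sq_band:
  assumes s: "sin (vlog (b\<^sup>2) / 5) = 0" and b: "b > 0" and y: "b / 9 \<le> y" "y \<le> 6 * b"
  shows "1 / 4 \<le> (cos (vlog (y\<^sup>2) / 5))\<^sup>2"
proof -
  define D where "D = (vlog (y\<^sup>2) - vlog (b\<^sup>2)) / 5"
  have "\<bar>D\<bar> \<le> 1"
  proof (cases "y \<le> b")
    case True
    then show ?thesis using vlog_sq_diff[of y b] b y by (simp add: D_def)
  next
    case False
    then show ?thesis using vlog_sq_diff[of b y] b y by (simp add: D_def)
  qed
  then have "1 / 4 \<le> (cos D)\<^sup>2" by (rule cos_sq_ge_quarter)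
  moreover have eq: "vlog (y\<^sup>2) / 5 = vlog (b\<^sup>2) / 5 + D" by (simp add: D_def diff_divide_distrib)
  have "cos (vlog (y\<^sup>2) / 5) = cos (vlog (b\<^sup>2) / 5) * cos D" unfolding eq cos_add s by simp
  moreover have "(cos (vlog (b\<^sup>2) / 5))\<^sup>2 = 1" using s sin_cos_squared_add[of "vlog (b\<^sup>2) / 5"] by simp
  ultimately show ?thesis by (simp add: power_mult_distrib)
qed

lemma stream_growth_ge:
  assumes "a \<le> b" "\<And>s. a < s \<Longrightarrow> s < b \<Longrightarrow> c \<le> speed x s"
  shows "c * (b - a) \<le> stream x b - stream x a"
  by (rule derivative_ge_imp_growth[OF assms(1) continuous_stream_slice(1)], rule conjI[OF stream_deriv_y assms(2)])

lemma stream_growth_le: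
  assumes "a \<le> b" "\<And>s. a < s \<Longrightarrow> s < b \<Longrightarrow> speed x s \<le> c"
  shows "stream x b - stream x a \<le> c * (b - a)"
proof (rule derivative_le_imp_growth[OF assms(1) continuous_stream_slice(1)])
  fix s assume "a < s" "s < b"
  then show "(stream x has_real_derivative speed x s) (at s) \<and> speed x s \<le> c"
    using stream_deriv_y assms(2) by simp
qed

text \<open>A streamline crossing the vertical axis near height \<open>b\<close>, where the oscillating factor is maximal,
  stays in the band \<open>b/9 \<le> y \<le> 6b\<close> as long as \<open>\<bar>x\<bar> < y\<close>.\<close>

lemma fast_level_near:
  assumes s: "sin (vlog (b\<^sup>2) / 5) = 0" and b: "b > 0"
  obtains d where "d > 0" "\<And>h. \<bar>h - stream 0 b\<bar> < d \<Longrightarrow> fast_level h"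
    "\<And>h x y. \<bar>h - stream 0 b\<bar> < d \<Longrightarrow> stream x y = h \<Longrightarrow> y \<le> max \<bar>x\<bar> (6 * b)"
proof -
  \<comment> \<open>\<open>R\<close> bounds the speed on the second axis from 0 to \<open>b\<close>.
    \<open>r\<close> bounds it from above in the disc of radius \<open>b / 2\<close>, and
    \<open>r / 4\<close> from below on the axis between \<open>b / 2\<close> and
    \<open>b\<close>.\<close>
  define R r where "R = rho (b\<^sup>2)" and "r = rho ((b / 2)\<^sup>2)"
  have Rr: "R > 0" "r > 0" using b by (auto simp: R_def r_def rho_pos)
  \<comment> \<open>\<open>b * r / 72\<close> is \<open>b * r / 8 - b * r / 9\<close>, the gap
    between the lower bound of \<open>stream 0 b\<close> and the values that
    \<open>stream x y\<close> can take when \<open>\<bar>x\<bar> < y < b / 9\<close>. The term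
    \<open>b * R / 4\<close> keeps the level below \<open>5 / 4 * (b * R)\<close>.\<close>
  define d where "d = min (b * R / 4) (b * r / 72)"
  have d: "d > 0" "d \<le> b * R / 4" "d \<le> b * r / 72" using b Rr by (auto simp: d_def)
  have up0: "stream 0 b \<le> b * R"
  proof -
    have "stream 0 b - stream 0 0 \<le> R * (b - 0)"
    proof (rule stream_growth_le)
      fix t assume t: "0 < t" "t < b"
      have "speed 0 t \<le> rho (0\<^sup>2 + t\<^sup>2)" by (rule speed_le_rho)
      also have "\<dots> \<le> R" unfolding R_def using t by (intro rho_mono) (auto intro: power_mono)
      finally show "speed 0 t \<le> R" .
    qed (use b in simp)
    then show ?thesis by (simp add: mult.commute)
  qed
  have lo0: "b * r / 8 \<le> stream 0 b"
  proof -
    have "(r / 4) * (b - b / 2) \<le> stream 0 b - stream 0 (b / 2)"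
    proof (rule stream_growth_ge)
      fix t assume t: "b / 2 < t" "t < b"
      show "r / 4 \<le> speed 0 t" unfolding r_def
        by (rule speed_ge_rho_between, rule disjI2, rule cos_sq_band[OF s b]) (use t b in \<open>auto intro: power_mono\<close>)
    qed (use b in simp)
    moreover have "stream 0 0 \<le> stream 0 (b / 2)" using b by (intro stream_mono) simp
    moreover have "(r / 4) * (b - b / 2) = b * r / 8" by simp
    ultimately show ?thesis by (simp only: stream_zero)
  qed
  have band: "y > 0 \<and> (\<bar>x\<bar> < y \<longrightarrow> b / 9 \<le> y \<and> y \<le> 6 * b)"
    if h: "\<bar>stream x y - stream 0 b\<bar> < d" for x y
  proof (intro conjI impI)
    have hlo: "stream x y > b * r / 9" using h d(3) lo0 unfolding abs_less_iff by linarith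
    have hup: "stream x y < 5 / 4 * (b * R)" using h d(2) up0 unfolding abs_less_iff by linarith
    have "b * r / 9 > 0" using b Rr by simp
    then have "stream x 0 < stream x y" using hlo by simp
    then show y: "y > 0" using stream_less_iff[of x 0 y] by simp
    assume xy: "\<bar>x\<bar> < y"
    show "b / 9 \<le> y"
    proof (rule ccontr)
      assume "\<not> b / 9 \<le> y"
      then have yb: "y < b / 9" by simp
      have "stream x y - stream x 0 \<le> r * (y - 0)"
      proof (rule stream_growth_le)
        fix t assume t: "0 < t" "t < y"
        have "x\<^sup>2 \<le> (b / 9)\<^sup>2" "t\<^sup>2 \<le> (b / 9)\<^sup>2" using xy yb t by (auto simp: abs_le_square_iff[symmetric])
        moreover have "(b / 9)\<^sup>2 + (b / 9)\<^sup>2 \<le> (b / 2)\<^sup>2" by (simp add: power_divide)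
        ultimately have "x\<^sup>2 + t\<^sup>2 \<le> (b / 2)\<^sup>2" by linarith
        then have "rho (x\<^sup>2 + t\<^sup>2) \<le> r" unfolding r_def by (intro rho_mono) auto
        then show "speed x t \<le> r" using speed_le_rho[of x t] by simp
      qed (use y in simp)
      also have "\<dots> \<le> r * (b / 9)" using yb Rr by simp
      finally show False using hlo by (simp add: mult.commute)
    qed
    \<comment> \<open>Origin of the factor 6: at speed at least \<open>R / 4\<close>, a vertical
      segment of length \<open>6 * b - b\<close> already accounts for
      \<open>5 / 4 * (b * R)\<close>, more than the level admits.\<close>
    show "y \<le> 6 * b"
    proof (rule ccontr)
      assume "\<not> y \<le> 6 * b"
      then have yb: "y > 6 * b" by simp
      show False
      proof (cases "6 * b \<le> \<bar>x\<bar>")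
        case True
        have "R / 4 * (\<bar>x\<bar> - 0) \<le> stream x \<bar>x\<bar> - stream x 0"
        proof (rule stream_growth_ge)
          fix t assume t: "0 < t" "t < \<bar>x\<bar>"
          have "b\<^sup>2 \<le> x\<^sup>2" using True b abs_le_square_iff[of b x] by simp
          then have "b\<^sup>2 \<le> x\<^sup>2 + t\<^sup>2" using zero_le_power2[of t] by linarith
          then show "R / 4 \<le> speed x t" unfolding R_def
            using t b by (intro speed_ge_rho_between) auto
        qed simp
        moreover have "stream x \<bar>x\<bar> \<le> stream x y" using xy by (intro stream_mono) simp
        moreover have "R / 4 * (6 * b) \<le> R / 4 * \<bar>x\<bar>" using True Rr by (intro mult_left_mono) auto
        moreover have "b * R > 0" using b Rr by simp
        ultimately show False using hup by (simp add: mult.commute)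
      next
        case False
        have "R / 4 * (6 * b - b) \<le> stream x (6 * b) - stream x b"
        proof (rule stream_growth_ge)
          fix t assume t: "b < t" "t < 6 * b"
          have "b\<^sup>2 \<le> t\<^sup>2" using t b by (intro power_mono) auto
          then have "b\<^sup>2 \<le> x\<^sup>2 + t\<^sup>2" using zero_le_power2[of x] by linarith
          then show "R / 4 \<le> speed x t" unfolding R_def
            using cos_sq_band[OF s b, of t] t b by (intro speed_ge_rho_between) auto
        qed (use b in simp)
        moreover have "stream x (6 * b) \<le> stream x y" using yb by (intro stream_mono) simp
        moreover have "stream x 0 \<le> stream x b" using b by (intro stream_mono) simp
        ultimately show False using hup by (simp add: mult.commute)
      qed
    qed
  qed
  show ?thesis
  proof (rule that[OF d(1)])
    fix h assume h: "\<bar>h - stream 0 b\<bar> < d"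
    show "fast_level h" unfolding fast_level_def
    proof (intro allI impI)
      fix x y assume xy: "stream x y = h"
      have *: "y > 0 \<and> (\<bar>x\<bar> < y \<longrightarrow> b / 9 \<le> y \<and> y \<le> 6 * b)"
        by (rule band) (use h xy in simp)
      then have "1 / 4 \<le> (cos (vlog (y\<^sup>2) / 5))\<^sup>2 \<or> \<bar>y\<bar> \<le> \<bar>x\<bar>"
        using cos_sq_band[OF s b, of y] by (cases "\<bar>x\<bar> < y") auto
      then show "y > 0 \<and> rho (x\<^sup>2 + y\<^sup>2) / 4 \<le> speed x y" using * speed_ge_rho by blast
    qed
    fix x y assume "stream x y = h"
    then have "y > 0 \<and> (\<bar>x\<bar> < y \<longrightarrow> b / 9 \<le> y \<and> y \<le> 6 * b)"
      by (intro band) (use h in simp)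
    then show "y \<le> max \<bar>x\<bar> (6 * b)" by auto
  qed
qed

section \<open>Levels near a stagnation point\<close>

lemma kappa_bounds_near:
  assumes a: "a > 0"
  obtains k K where "k > 0" "K > 0"
    "\<And>x y. \<bar>x\<bar> \<le> 1 \<Longrightarrow> a / 2 \<le> y \<Longrightarrow> y \<le> 2 * a \<Longrightarrow> k \<le> kappa (x\<^sup>2 + y\<^sup>2) \<and> kappa (x\<^sup>2 + y\<^sup>2) \<le> K"
proof -
  define T where "T = 1 + (2 * a)\<^sup>2"
  have T: "T > 0" by (simp add: T_def add_pos_nonneg)
  show ?thesis
  proof (rule that[of "rho ((a / 2)\<^sup>2) / T" "16 / (a / 2)\<^sup>2"])
    have r: "rho ((a / 2)\<^sup>2) > 0" using a by (intro rho_pos) simp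
    then show "rho ((a / 2)\<^sup>2) / T > 0" using T by simp
    show "16 / (a / 2)\<^sup>2 > 0" using a by simp
    fix x y :: real assume xy: "\<bar>x\<bar> \<le> 1" "a / 2 \<le> y" "y \<le> 2 * a"
    define t where "t = x\<^sup>2 + y\<^sup>2"
    have "x\<^sup>2 \<le> 1" using xy(1) by (simp add: abs_square_le_1)
    moreover have y2: "(a / 2)\<^sup>2 \<le> y\<^sup>2" "y\<^sup>2 \<le> (2 * a)\<^sup>2" using xy a by (intro power_mono; simp)+
    ultimately have t: "(a / 2)\<^sup>2 \<le> t" "t \<le> T" using zero_le_power2[of x] unfolding t_def T_def by linarith+
    have p: "0 < (a / 2)\<^sup>2" using a by simp
    then have t0: "t > 0" using t by linarith
    have "rho ((a / 2)\<^sup>2) / T \<le> rho t / t"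
      by (rule frac_le[OF _ _ t0 t(2)]) (use r p t rho_mono[of "(a / 2)\<^sup>2" t] in \<open>simp_all add: rho_nonneg less_imp_le[OF t0]\<close>)
    then have "rho ((a / 2)\<^sup>2) / T \<le> kappa t" using t0 by (simp add: rho_def)
    moreover have "kappa t \<le> 16 / t" by (rule kappa_le[OF t0])
    moreover have "16 / t \<le> 16 / (a / 2)\<^sup>2" by (rule divide_left_mono[OF t(1) _ mult_pos_pos[OF t0 p]]) simp
    ultimately show "rho ((a / 2)\<^sup>2) / T \<le> kappa (x\<^sup>2 + y\<^sup>2) \<and> kappa (x\<^sup>2 + y\<^sup>2) \<le> 16 / (a / 2)\<^sup>2"
      by (simp add: t_def)
  qed
qed

text \<open>The sine of the phase does not vanish together with the cosine, so \<open>a\<close> is a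
  simple zero of \<open>osc\<close>. Near it \<open>\<bar>osc s\<bar>\<close> lies between
  \<open>\<bar>D / 2 * (s - a)\<bar>\<close> and \<open>\<bar>2 * D * (s - a)\<bar>\<close>; the
  squares differ by the factor 16.\<close>

lemma osc_bounds_near:
  assumes a: "a > 0" and m: "osc_sq a = 0"
  obtains A \<eta> where "A > 0" "\<eta> > 0" "\<eta> \<le> a / 2"
    "\<And>s. \<bar>s - a\<bar> \<le> \<eta> \<Longrightarrow> A * (s - a)\<^sup>2 \<le> osc_sq s \<and> osc_sq s \<le> 16 * A * (s - a)\<^sup>2"
proof -
  define D where "D = cos (vlog (a\<^sup>2) / 5) + 2 / 5 * sin (vlog (a\<^sup>2) / 5) / (1 + a\<^sup>2)"
  have m0: "osc a = 0" using m by (simp add: osc_sq_eq)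
  then have c: "cos (vlog (a\<^sup>2) / 5) = 0" using a by (simp add: osc_def)
  then have "sin (vlog (a\<^sup>2) / 5) \<noteq> 0" using sin_cos_squared_add[of "vlog (a\<^sup>2) / 5"] by auto
  moreover have "1 + a\<^sup>2 > 0" by (simp add: add_pos_nonneg)
  ultimately have D: "D \<noteq> 0" using c by (simp add: D_def)
  have "(osc has_derivative times D) (at a)"
    using osc_deriv[of a] a by (simp add: D_def has_field_derivative_def)
  then have "\<forall>e>0. \<exists>d>0. \<forall>y\<in>UNIV. norm (y - a) < d \<longrightarrow> norm (osc y - osc a - D * (y - a)) \<le> e * norm (y - a)"
    unfolding has_derivative_within_alt by (rule conjunct2)
  from this[rule_format, of "\<bar>D\<bar> / 2"] obtain d where d: "d > 0"
    "\<And>y. \<bar>y - a\<bar> < d \<Longrightarrow> \<bar>osc y - D * (y - a)\<bar> \<le> \<bar>D\<bar> / 2 * \<bar>y - a\<bar>"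
    using D m0 by auto
  show ?thesis
  proof (rule that[of "(D / 2)\<^sup>2" "min (d / 2) (a / 2)"])
    fix s assume "\<bar>s - a\<bar> \<le> min (d / 2) (a / 2)"
    then have "\<bar>s - a\<bar> < d" using d(1) by simp
    then have e: "\<bar>osc s - D * (s - a)\<bar> \<le> \<bar>D\<bar> / 2 * \<bar>s - a\<bar>" by (rule d(2))
    have Da: "\<bar>D * (s - a)\<bar> = \<bar>D\<bar> * \<bar>s - a\<bar>" by (rule abs_mult)
    have "\<bar>D / 2 * (s - a)\<bar> \<le> \<bar>osc s\<bar>" "\<bar>osc s\<bar> \<le> \<bar>2 * D * (s - a)\<bar>"
    proof -
      have "\<bar>D / 2 * (s - a)\<bar> = \<bar>D\<bar> * \<bar>s - a\<bar> / 2" "\<bar>2 * D * (s - a)\<bar> = 2 * (\<bar>D\<bar> * \<bar>s - a\<bar>)"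
        by (simp_all add: abs_mult)
      then show "\<bar>D / 2 * (s - a)\<bar> \<le> \<bar>osc s\<bar>" "\<bar>osc s\<bar> \<le> \<bar>2 * D * (s - a)\<bar>"
        using e Da abs_ge_zero[of "s - a"] by linarith+
    qed
    then have "(D / 2 * (s - a))\<^sup>2 \<le> (osc s)\<^sup>2" "(osc s)\<^sup>2 \<le> (2 * D * (s - a))\<^sup>2"
      by (simp_all only: abs_le_square_iff)
    then show "(D / 2)\<^sup>2 * (s - a)\<^sup>2 \<le> osc_sq s \<and> osc_sq s \<le> 16 * (D / 2)\<^sup>2 * (s - a)\<^sup>2"
      by (simp add: osc_sq_eq power_mult_distrib power_divide)
  qed (use D d a in auto)
qed

text \<open>At \<open>a\<close> the function \<open>stream x\<close> grows at least cubically, while \<open>stream x a - stream 0 a\<close> is of order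
  \<open>\<bar>x\<bar> powr (3/2)\<close>. On a level that is \<open>e\<^sup>3\<close>-close to the stagnating one, \<open>\<bar>y - a\<bar>\<close> is therefore
  at most of order \<open>e + sqrt \<bar>x\<bar>\<close>.\<close>

lemma stagnation_estimate:
  assumes a: "a > 0" and m: "osc_sq a = 0"
  obtains C \<delta> c \<epsilon> where "C > 0" "0 < \<delta>" "\<delta> \<le> 1" "c > 0" "\<epsilon> > 0"
    "\<And>e x y. 0 < e \<Longrightarrow> e \<le> \<epsilon> \<Longrightarrow> \<bar>x\<bar> \<le> \<delta> \<Longrightarrow> \<bar>stream x y - stream 0 a\<bar> \<le> c * e ^ 3 \<Longrightarrow> speed x y \<le> C * (\<bar>x\<bar> + e\<^sup>2)"
proof -
  obtain k K where kK: "k > 0" "K > 0"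
    "\<And>x y. \<bar>x\<bar> \<le> 1 \<Longrightarrow> a / 2 \<le> y \<Longrightarrow> y \<le> 2 * a \<Longrightarrow> k \<le> kappa (x\<^sup>2 + y\<^sup>2) \<and> kappa (x\<^sup>2 + y\<^sup>2) \<le> K"
    using kappa_bounds_near[OF a] by blast
  obtain A \<eta> where A: "A > 0" "\<eta> > 0" "\<eta> \<le> a / 2"
    "\<And>s. \<bar>s - a\<bar> \<le> \<eta> \<Longrightarrow> A * (s - a)\<^sup>2 \<le> osc_sq s \<and> osc_sq s \<le> 16 * A * (s - a)\<^sup>2"
    using osc_bounds_near[OF a m] by blast
  \<comment> \<open>The coefficient in \<open>lower\<close> is \<open>3 * c\<close>, so that
    integration yields \<open>c * \<bar>y - a\<bar> ^ 3\<close>.\<close>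
  define c where "c = k * A / 3"
  have c: "c > 0" using kK A by (simp add: c_def)
  have lower: "3 * c * (s - a)\<^sup>2 \<le> speed x s" if "\<bar>x\<bar> \<le> 1" "\<bar>s - a\<bar> \<le> \<eta>" for x s
  proof -
    have "k \<le> kappa (x\<^sup>2 + s\<^sup>2)" using kK(3)[of x s] that A(3) a by auto
    moreover have "A * (s - a)\<^sup>2 \<le> x\<^sup>2 + osc_sq s" using A(4)[OF that(2)] zero_le_power2[of x] by linarith
    ultimately have "k * (A * (s - a)\<^sup>2) \<le> kappa (x\<^sup>2 + s\<^sup>2) * (x\<^sup>2 + osc_sq s)"
      using kK A by (intro mult_mono) auto
    then show ?thesis by (simp add: speed_def c_def)
  qed
  have cubic: "c * \<bar>y - a\<bar> ^ 3 \<le> \<bar>stream x y - stream x a\<bar>" if x: "\<bar>x\<bar> \<le> 1" and y: "\<bar>y - a\<bar> \<le> \<eta>" for x y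
  proof -
    have d: "((\<lambda>s. stream x s - c * (s - a) ^ 3) has_real_derivative speed x s - 3 * c * (s - a)\<^sup>2) (at s)" for s
      by (rule DERIV_cong, (rule derivative_intros stream_deriv_y refl)+) simp
    have co: "continuous_on B (\<lambda>s. stream x s - c * (s - a) ^ 3)" for B
      by (intro continuous_intros continuous_stream_slice)
    show ?thesis
    proof (cases "a \<le> y")
      case True
      have "0 * (y - a) \<le> (stream x y - c * (y - a) ^ 3) - (stream x a - c * (a - a) ^ 3)"
        by (rule derivative_ge_imp_growth[OF True co], rule conjI[OF d]) (use lower[OF x] y in auto)
      then show ?thesis using True by simp
    next
      case False
      then have ya: "y \<le> a" by simp
      have "0 * (a - y) \<le> (stream x a - c * (a - a) ^ 3) - (stream x y - c * (y - a) ^ 3)"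
        by (rule derivative_ge_imp_growth[OF ya co], rule conjI[OF d]) (use lower[OF x] y in auto)
      then have "- (c * (y - a) ^ 3) \<le> stream x a - stream x y" by simp
      moreover have "\<bar>y - a\<bar> = - (y - a)" using ya by simp
      then have "\<bar>y - a\<bar> ^ 3 = - ((y - a) ^ 3)" by (simp only: power3_eq_cube minus_mult_minus mult_minus_left mult_minus_right minus_minus)
      then have "c * \<bar>y - a\<bar> ^ 3 = - (c * (y - a) ^ 3)" by (simp only: mult_minus_right)
      moreover have "stream x a - stream x y \<le> \<bar>stream x y - stream x a\<bar>" by linarith
      ultimately show ?thesis by linarith
    qed
  qed
  define C0 where "C0 = 8000 * a powr (1 / 4)"
  have C0: "C0 \<ge> 0" by (simp add: C0_def)
  have horiz: "\<bar>stream x a - stream 0 a\<bar> \<le> C0 * (\<bar>x\<bar> powr (1 / 2)) ^ 3" for x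
  proof -
    have "\<bar>x\<bar> powr (1 / 2) * \<bar>x\<bar> powr (1 / 2) = \<bar>x\<bar>" unfolding powr_add[symmetric] by simp
    then have "(\<bar>x\<bar> powr (1 / 2)) ^ 3 = \<bar>x\<bar> * \<bar>x\<bar> powr (1 / 2)" by (simp add: power3_eq_cube)
    then show ?thesis using stream_x_bound[of x a] a by (simp add: C0_def)
  qed
  \<comment> \<open>If \<open>\<bar>y - a\<bar> > \<eta>\<close>, then \<open>stream x y\<close> and
    \<open>stream x a\<close> differ by at least \<open>c * \<eta> ^ 3\<close>. The choices of
    \<open>\<delta>\<close> and \<open>\<epsilon>\<close> limit the two contributions to this
    difference to 1/4 and 1/8 of that amount, which forces
    \<open>\<bar>y - a\<bar> \<le> \<eta>\<close>.\<close>
  define \<delta> where "\<delta> = min 1 (c * \<eta> ^ 3 / (4 * (C0 + 1)))"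
  have \<delta>: "0 < \<delta>" "\<delta> \<le> 1" using c A C0 by (auto simp: \<delta>_def)
  define \<epsilon> where "\<epsilon> = \<eta> / 2"
  have \<epsilon>: "\<epsilon> > 0" using A by (simp add: \<epsilon>_def)
  \<comment> \<open>\<open>C0 / c \<le> L \<le> L ^ 3\<close> bounds the sum of cubes by the cube of
    \<open>e + L * u\<close>, where \<open>u\<close> is the square root of
    \<open>\<bar>x\<bar>\<close>.\<close>
  define L where "L = 1 + C0 / c"
  have L: "L \<ge> 1" using C0 c by (simp add: L_def)
  define C where "C = K * (1 + 32 * A * (1 + L\<^sup>2))"
  have C: "C > 0" using kK A by (auto simp: C_def intro!: mult_pos_pos add_pos_nonneg)
  show ?thesis
  proof (rule that[OF C \<delta> c \<epsilon>])
    fix e x y :: real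
    assume e: "0 < e" "e \<le> \<epsilon>" and x: "\<bar>x\<bar> \<le> \<delta>" and h: "\<bar>stream x y - stream 0 a\<bar> \<le> c * e ^ 3"
    define u where "u = \<bar>x\<bar> powr (1 / 2)"
    have u: "u \<ge> 0" "u\<^sup>2 = \<bar>x\<bar>"
      unfolding u_def power2_eq_square powr_add[symmetric] by simp_all
    have x1: "\<bar>x\<bar> \<le> 1" using x \<delta> by simp
    have dist: "\<bar>stream x y - stream x a\<bar> \<le> c * e ^ 3 + C0 * u ^ 3"
      using h horiz[of x] unfolding u_def by linarith
    have near: "\<bar>y - a\<bar> \<le> \<eta>"
    proof (rule ccontr)
      assume far: "\<not> \<bar>y - a\<bar> \<le> \<eta>"
      have "c * \<eta> ^ 3 \<le> \<bar>stream x y - stream x a\<bar>"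
      proof (cases "a \<le> y")
        case True
        then have "stream x (a + \<eta>) \<le> stream x y" using far by (intro stream_mono) auto
        moreover have "stream x a \<le> stream x (a + \<eta>)" using A by (intro stream_mono) auto
        ultimately show ?thesis using cubic[OF x1, of "a + \<eta>"] A by auto
      next
        case False
        then have "stream x y \<le> stream x (a - \<eta>)" using far by (intro stream_mono) auto
        moreover have "stream x (a - \<eta>) \<le> stream x a" using A by (intro stream_mono) auto
        ultimately show ?thesis using cubic[OF x1, of "a - \<eta>"] A by auto
      qed
      moreover have "c * e ^ 3 \<le> c * \<eta> ^ 3 / 8"
      proof -
        have "e ^ 3 \<le> (\<eta> / 2) ^ 3" using e by (intro power_mono) (auto simp: \<epsilon>_def)
        then show ?thesis using c by (simp add: power_divide)
      qed
      moreover have "C0 * u ^ 3 \<le> c * \<eta> ^ 3 / 4"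
      proof -
        have "u \<le> 1" using u x1 by (metis abs_of_nonneg abs_square_le_1)
        then have "u ^ 3 \<le> \<bar>x\<bar>" using u mult_left_mono[of u 1 "u\<^sup>2"] by (simp add: power3_eq_cube power2_eq_square)
        also have "\<dots> \<le> c * \<eta> ^ 3 / (4 * (C0 + 1))" using x by (simp add: \<delta>_def)
        finally have "C0 * u ^ 3 \<le> C0 * (c * \<eta> ^ 3 / (4 * (C0 + 1)))" using C0 by (intro mult_left_mono)
        also have "\<dots> = (C0 / (C0 + 1)) * (c * \<eta> ^ 3 / 4)" by simp
        also have "\<dots> \<le> 1 * (c * \<eta> ^ 3 / 4)" using C0 c A by (intro mult_right_mono) auto
        finally show ?thesis by simp
      qed
      moreover have "c * \<eta> ^ 3 > 0" using c A by simp
      ultimately show False using dist by linarith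
    qed
    have "c * \<bar>y - a\<bar> ^ 3 \<le> c * e ^ 3 + C0 * u ^ 3" using cubic[OF x1 near] dist by linarith
    also have "\<dots> = c * (e ^ 3 + C0 / c * u ^ 3)" using c by (simp add: field_simps)
    finally have "\<bar>y - a\<bar> ^ 3 \<le> e ^ 3 + C0 / c * u ^ 3" using c by simp
    also have "\<dots> \<le> e ^ 3 + L ^ 3 * u ^ 3"
    proof -
      have "C0 / c \<le> L" by (simp add: L_def)
      also have "L \<le> L ^ 3" using L by (simp add: self_le_power)
      finally have "C0 / c * u ^ 3 \<le> L ^ 3 * u ^ 3" using u(1) by (intro mult_right_mono) simp_all
      then show ?thesis by linarith
    qed
    also have "\<dots> \<le> (e + L * u) ^ 3"
    proof -
      have "0 \<le> L * u" using L u by simp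
      then have "0 \<le> 3 * (e\<^sup>2 * (L * u)) + 3 * (e * (L * u)\<^sup>2)" using e by simp
      moreover have "(e + L * u) ^ 3 = e ^ 3 + (L * u) ^ 3 + (3 * (e\<^sup>2 * (L * u)) + 3 * (e * (L * u)\<^sup>2))"
        by (simp add: power3_eq_cube power2_eq_square algebra_simps)
      ultimately show ?thesis by (simp add: power_mult_distrib)
    qed
    finally have "\<bar>y - a\<bar> ^ 3 \<le> (e + L * u) ^ 3" .
    then have "\<bar>y - a\<bar> ^ Suc 2 \<le> (e + L * u) ^ Suc 2" unfolding numeral_3_eq_3 numeral_2_eq_2 .
    moreover have "0 \<le> e + L * u" using L u e by (intro add_nonneg_nonneg mult_nonneg_nonneg) linarith+
    ultimately have ya: "\<bar>y - a\<bar> \<le> e + L * u" by (rule power_le_imp_le_base)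
    have "(y - a)\<^sup>2 \<le> (e + L * u)\<^sup>2" using power_mono[OF ya abs_ge_zero, of 2] unfolding power2_abs .
    also have "\<dots> \<le> 2 * e\<^sup>2 + 2 * (L\<^sup>2 * \<bar>x\<bar>)"
    proof -
      have "0 \<le> (e - L * u)\<^sup>2" by simp
      then show ?thesis unfolding u(2)[symmetric] by (simp add: power2_eq_square algebra_simps)
    qed
    finally have sq: "(y - a)\<^sup>2 \<le> 2 * e\<^sup>2 + 2 * (L\<^sup>2 * \<bar>x\<bar>)" .
    have "speed x y \<le> K * (x\<^sup>2 + osc_sq y)"
      using kK(3)[OF x1, of y] near A(3) a osc_sq_nonneg[of y] unfolding speed_def by (intro mult_right_mono) auto
    also have "\<dots> \<le> K * (\<bar>x\<bar> + 16 * A * (2 * e\<^sup>2 + 2 * (L\<^sup>2 * \<bar>x\<bar>)))"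
    proof (intro mult_left_mono add_mono)
      show "x\<^sup>2 \<le> \<bar>x\<bar>" using x1 mult_left_mono[of "\<bar>x\<bar>" 1 "\<bar>x\<bar>"] by (simp add: power2_eq_square abs_mult[symmetric])
      have "osc_sq y \<le> 16 * A * (y - a)\<^sup>2" using A(4)[OF near] by simp
      also have "\<dots> \<le> 16 * A * (2 * e\<^sup>2 + 2 * (L\<^sup>2 * \<bar>x\<bar>))" using sq A by (intro mult_left_mono) auto
      finally show "osc_sq y \<le> 16 * A * (2 * e\<^sup>2 + 2 * (L\<^sup>2 * \<bar>x\<bar>))" .
    qed (use kK in simp)
    also have "\<dots> \<le> C * (\<bar>x\<bar> + e\<^sup>2)"
    proof -
      have "0 \<le> K * (A * (L\<^sup>2 * e\<^sup>2)) * 32 + K * e\<^sup>2 + K * (A * \<bar>x\<bar>) * 32" using kK A by simp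
      then show ?thesis by (simp add: C_def algebra_simps)
    qed
    finally show "speed x y \<le> C * (\<bar>x\<bar> + e\<^sup>2)" .
  qed
qed

text \<open>By the preceding estimate, reaching the second axis takes a time of order \<open>log (1 / e)\<close>.\<close>

lemma trajectory_stuck:
  assumes a: "a > 0" and m: "osc_sq a = 0" and T: "T > 0" and \<delta>': "\<delta>' > 0"
  obtains d where "d > 0"
    "\<And>Z. trajectory Z \<Longrightarrow> Z 0 $ 1 \<le> - \<delta>' \<Longrightarrow> \<bar>stream (Z 0 $ 1) (Z 0 $ 2) - stream 0 a\<bar> < d \<Longrightarrow> Z T $ 1 \<le> 0"
proof -
  obtain C \<delta> c \<epsilon> where *: "C > 0" "0 < \<delta>" "\<delta> \<le> 1" "c > 0" "\<epsilon> > 0"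
    "\<And>e x y. 0 < e \<Longrightarrow> e \<le> \<epsilon> \<Longrightarrow> \<bar>x\<bar> \<le> \<delta> \<Longrightarrow> \<bar>stream x y - stream 0 a\<bar> \<le> c * e ^ 3 \<Longrightarrow> speed x y \<le> C * (\<bar>x\<bar> + e\<^sup>2)"
    using stagnation_estimate[OF a m] by blast
  define \<delta>1 where "\<delta>1 = min \<delta> \<delta>'"
  have \<delta>1: "\<delta>1 > 0" "\<delta>1 \<le> \<delta>" "\<delta>1 \<le> \<delta>'" using * \<delta>' by (auto simp: \<delta>1_def)
  \<comment> \<open>The argument ends with
    \<open>e\<^sup>2 + \<delta>1 \<le> e\<^sup>2 * exp (C * T)\<close>, which is absurd once
    \<open>e\<^sup>2 * exp (C * T) \<le> \<delta>1\<close>; this determines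
    \<open>e\<close>.\<close>
  define e where "e = min \<epsilon> (sqrt (\<delta>1 * exp (- (C * T))))"
  have e: "e > 0" "e \<le> \<epsilon>" using * \<delta>1 by (auto simp: e_def)
  have "e\<^sup>2 \<le> (sqrt (\<delta>1 * exp (- (C * T))))\<^sup>2" using e by (intro power_mono) (auto simp: e_def)
  then have e2: "e\<^sup>2 \<le> \<delta>1 * exp (- (C * T))" using \<delta>1 by simp
  have e2p: "e\<^sup>2 > 0" using e by simp
  show ?thesis
  proof (rule that[of "c * e ^ 3"])
    show "c * e ^ 3 > 0" using * e by simp
    fix Z assume Z: "trajectory Z" and x0: "Z 0 $ 1 \<le> - \<delta>'"
      and h: "\<bar>stream (Z 0 $ 1) (Z 0 $ 2) - stream 0 a\<bar> < c * e ^ 3"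
    show "Z T $ 1 \<le> 0"
    proof (rule ccontr)
      assume "\<not> Z T $ 1 \<le> 0"
      then have T0: "0 \<le> Z T $ 1" by simp
      note co = trajectory_continuous[OF Z]
      obtain s1 where s1: "0 \<le> s1" "s1 \<le> T" "Z s1 $ 1 = - \<delta>1"
        using IVT'[of "\<lambda>t. Z t $ 1" 0 "- \<delta>1" T] co[of 0 T] x0 \<delta>1 T T0 by auto
      obtain s2 where s2: "s1 \<le> s2" "s2 \<le> T" "Z s2 $ 1 = 0"
        using IVT'[of "\<lambda>t. Z t $ 1" s1 0 T] co[OF s1(1), of T] s1 \<delta>1 T0 by auto
      have range: "- \<delta>1 \<le> Z s $ 1 \<and> Z s $ 1 \<le> 0" if "s1 \<le> s" "s \<le> s2" for s
        using trajectory_mono[OF Z s1(1) that(1)] trajectory_mono[OF Z _ that(2)] s1 s2 that by simp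
      \<comment> \<open>For a first component \<open>x \<le> 0\<close> the estimate says that the
        derivative of \<open>x\<close> is at most \<open>C * (e\<^sup>2 - x)\<close>, so the
        logarithm of \<open>e\<^sup>2 - x\<close> decreases at a rate of at most
        \<open>C\<close>.\<close>
      have "(- C) * (s2 - s1) \<le> ln (e\<^sup>2 - Z s2 $ 1) - ln (e\<^sup>2 - Z s1 $ 1)"
      proof (rule derivative_ge_imp_growth[OF s2(1)])
        have "e\<^sup>2 - Z s $ 1 > 0" if "s \<in> {s1..s2}" for s
        proof -
          have "Z s $ 1 \<le> 0" using range[of s] that by simp
          then show ?thesis using e2p by linarith
        qed
        then show "continuous_on {s1..s2} (\<lambda>s. ln (e\<^sup>2 - Z s $ 1))"
          by (intro continuous_on_ln continuous_on_diff continuous_on_const co[OF s1(1)]) (auto simp: less_imp_neq[symmetric])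
        fix s assume s: "s1 < s" "s < s2"
        have s0: "s > 0" using s s1 by simp
        have r: "- \<delta>1 \<le> Z s $ 1" "Z s $ 1 \<le> 0" using range[of s] s by auto
        have q: "e\<^sup>2 - Z s $ 1 > 0" using r e2p by linarith
        have "\<bar>stream (Z s $ 1) (Z s $ 2) - stream 0 a\<bar> \<le> c * e ^ 3"
          using h trajectory_level[OF Z, of s] s0 by simp
        then have sp: "speed (Z s $ 1) (Z s $ 2) \<le> C * (\<bar>Z s $ 1\<bar> + e\<^sup>2)"
          using r \<delta>1 e by (intro *(6)) auto
        have "((\<lambda>s. ln (e\<^sup>2 - Z s $ 1)) has_real_derivative (0 - speed (Z s $ 1) (Z s $ 2)) * (1 / (e\<^sup>2 - Z s $ 1))) (at s)"
        proof (rule DERIV_cong)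
          show "((\<lambda>s. ln (e\<^sup>2 - Z s $ 1)) has_real_derivative 1 / (e\<^sup>2 - Z s $ 1) * (0 - speed (Z s $ 1) (Z s $ 2))) (at s)"
            by (rule DERIV_chain2[where f=ln and g="\<lambda>s. e\<^sup>2 - Z s $ 1", OF DERIV_ln_divide[OF q]])
              (rule DERIV_diff[OF DERIV_const trajectory_deriv[OF Z s0]])
        qed simp
        moreover have "- C \<le> (0 - speed (Z s $ 1) (Z s $ 2)) * (1 / (e\<^sup>2 - Z s $ 1))"
          using sp r q by (simp add: field_simps)
        ultimately show "((\<lambda>s. ln (e\<^sup>2 - Z s $ 1)) has_real_derivative (0 - speed (Z s $ 1) (Z s $ 2)) * (1 / (e\<^sup>2 - Z s $ 1))) (at s)
          \<and> - C \<le> (0 - speed (Z s $ 1) (Z s $ 2)) * (1 / (e\<^sup>2 - Z s $ 1))" ..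
      qed
      then have "ln (e\<^sup>2 + \<delta>1) - ln (e\<^sup>2) \<le> C * (s2 - s1)" using s1 s2 by simp
      also have "\<dots> \<le> C * T" using s1 s2 * by (intro mult_left_mono) auto
      finally have "ln (e\<^sup>2 + \<delta>1) \<le> ln (e\<^sup>2) + C * T" by simp
      also have "\<dots> = ln (e\<^sup>2 * exp (C * T))" using e2p by (subst ln_mult) auto
      finally have "e\<^sup>2 + \<delta>1 \<le> e\<^sup>2 * exp (C * T)"
        using e2p \<delta>1 by (subst (asm) ln_le_cancel_iff) (auto intro: add_pos_pos)
      also have "\<dots> \<le> \<delta>1 * exp (- (C * T)) * exp (C * T)" using e2 by (intro mult_right_mono) auto
      also have "\<dots> = \<delta>1" by (simp add: mult.assoc exp_add[symmetric])
      finally show False using e2p by simp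
    qed
  qed
qed

section \<open>Smooth cut-off functions\<close>

text \<open>All derivatives of \<open>exp (- 1 / (1 - s\<^sup>2))\<close> have this form; the pair \<open>(P, k)\<close> of the n-th one is
  \<open>bump_data n\<close> below.\<close>

definition bump_fn :: "real poly \<Rightarrow> nat \<Rightarrow> real \<Rightarrow> real" where
  "bump_fn P k s = (if \<bar>s\<bar> < 1 then poly P s * (1 / (1 - s\<^sup>2)) ^ k * exp (- (1 / (1 - s\<^sup>2))) else 0)"

lemma power_times_exp_bound: "\<exists>B>0. \<forall>u>0. u ^ k * exp (- u) \<le> (B::real)"
proof (intro exI[of _ "fact k"] conjI allI impI)
  fix u :: real assume u: "u > 0"
  have "u ^ k / fact k \<le> exp u"
  proof -
    have "(\<Sum>n\<in>{k}. u ^ n /\<^sub>R fact n) \<le> (\<Sum>n. u ^ n /\<^sub>R fact n)"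
      using u by (intro sum_le_suminf summable_exp_generic) auto
    then show ?thesis by (simp add: exp_def field_simps)
  qed
  then show "u ^ k * exp (- u) \<le> fact k"
    by (simp add: exp_minus field_simps)
qed simp

text \<open>The exponential beats every power of \<open>1 / (1 - s\<^sup>2)\<close>. Quadratic decay
  at \<open>\<bar>s\<bar> = 1\<close> is what makes the derivative there exist and vanish.\<close>

lemma bump_fn_bound: "\<exists>B>0. \<forall>s. \<bar>bump_fn P k s\<bar> \<le> B * (1 - \<bar>s\<bar>)\<^sup>2"
proof -
  have "compact {-1..1::real}" by simp
  have "continuous_on {-1..1} (poly P)" by (intro continuous_intros)
  then have "bounded (poly P ` {-1..1})"
    by (intro compact_imp_bounded compact_continuous_image) auto
  then obtain A where A: "A > 0" "\<And>s. s \<in> {-1..1} \<Longrightarrow> \<bar>poly P s\<bar> \<le> A"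
    by (auto simp: bounded_pos)
  \<comment> \<open>The two extra powers of \<open>u = 1 / (1 - s\<^sup>2)\<close> are traded for
    the factor \<open>(1 - s\<^sup>2)\<^sup>2\<close>.\<close>
  obtain B where B: "B > 0" "\<And>u. u > 0 \<Longrightarrow> u ^ (k + 2) * exp (- u) \<le> (B::real)"
    using power_times_exp_bound[of "k + 2"] by blast
  have "\<bar>bump_fn P k s\<bar> \<le> (4 * A * B) * (1 - \<bar>s\<bar>)\<^sup>2" for s
  proof (cases "\<bar>s\<bar> < 1")
    case False
    then show ?thesis using A B by (simp add: bump_fn_def)
  next
    case True
    define u where "u = 1 / (1 - s\<^sup>2)"
    have s2: "1 - s\<^sup>2 = (1 - \<bar>s\<bar>) * (1 + \<bar>s\<bar>)" by (simp add: algebra_simps power2_eq_square)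
    have pos: "1 - s\<^sup>2 > 0" unfolding s2 using True by (intro mult_pos_pos) auto
    then have u: "u > 0" by (simp add: u_def)
    have "1 - s\<^sup>2 \<le> 2 * (1 - \<bar>s\<bar>)" unfolding s2 using True mult_left_mono[of "1 + \<bar>s\<bar>" 2 "1 - \<bar>s\<bar>"] by simp
    then have "(1 - s\<^sup>2)\<^sup>2 \<le> (2 * (1 - \<bar>s\<bar>))\<^sup>2" using pos by (intro power_mono) auto
    then have sq: "(1 - s\<^sup>2)\<^sup>2 \<le> 4 * (1 - \<bar>s\<bar>)\<^sup>2" unfolding power_mult_distrib by simp
    have "u ^ k * exp (- u) = u ^ (k + 2) * exp (- u) * (1 - s\<^sup>2)\<^sup>2"
    proof -
      have "u\<^sup>2 * (1 - s\<^sup>2)\<^sup>2 = (u * (1 - s\<^sup>2))\<^sup>2" by (simp add: power_mult_distrib)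
      also have "\<dots> = 1" using pos by (simp add: u_def)
      finally have *: "u\<^sup>2 * (1 - s\<^sup>2)\<^sup>2 = 1" .
      have "u ^ (k + 2) * exp (- u) * (1 - s\<^sup>2)\<^sup>2 = u ^ k * exp (- u) * (u\<^sup>2 * (1 - s\<^sup>2)\<^sup>2)"
        by (simp only: power_add mult_ac)
      then show ?thesis unfolding * by simp
    qed
    also have "\<dots> \<le> B * (4 * (1 - \<bar>s\<bar>)\<^sup>2)"
      using B u sq by (intro mult_mono) auto
    finally have uB: "u ^ k * exp (- u) \<le> B * (4 * (1 - \<bar>s\<bar>)\<^sup>2)" .
    have PA: "\<bar>poly P s\<bar> \<le> A" by (rule A(2)) (use True in \<open>simp add: abs_less_iff\<close>)
    have "\<bar>poly P s\<bar> * (u ^ k * exp (- u)) \<le> A * (B * (4 * (1 - \<bar>s\<bar>)\<^sup>2))"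
      by (rule mult_mono[OF PA uB]) (use A(1) u in simp_all)
    then show ?thesis using True u unfolding bump_fn_def u_def[symmetric]
      by (simp add: abs_mult mult_ac)
  qed
  then show ?thesis using A B by (intro exI[of _ "4 * A * B"]) auto
qed

text \<open>\<open>[:1, 0, -1:]\<close> is the polynomial \<open>1 - s\<^sup>2\<close>; its powers
  bring all terms of the derivative to the common exponent \<open>k + 2\<close>.\<close>

definition bump_poly' :: "real poly \<Rightarrow> nat \<Rightarrow> real poly" where
  "bump_poly' P k = pderiv P * [:1, 0, -1:]\<^sup>2 + smult (2 * real k) ([:0, 1:] * P * [:1, 0, -1:]) - smult 2 ([:0, 1:] * P)"

lemma bump_fn_deriv:
  "(bump_fn P k has_real_derivative bump_fn (bump_poly' P k) (k + 2) s) (at s)"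
proof -
  consider "\<bar>s\<bar> < 1" | "\<bar>s\<bar> = 1" | "\<bar>s\<bar> > 1" by linarith
  then show ?thesis
  proof cases
    case 1
    define u where "u = 1 / (1 - s\<^sup>2)"
    have pos: "1 - s\<^sup>2 > 0" using 1 by (simp add: abs_square_less_1)
    have du: "((\<lambda>s. 1 / (1 - s\<^sup>2)) has_real_derivative 2 * s * u\<^sup>2) (at s)"
      using pos by (auto intro!: derivative_eq_intros simp: u_def power2_eq_square)
    have "((\<lambda>s. poly P s * (1 / (1 - s\<^sup>2)) ^ k * exp (- (1 / (1 - s\<^sup>2)))) has_real_derivative
       (poly (pderiv P) s * u ^ k + poly P s * (real k * u ^ (k - 1) * (2 * s * u\<^sup>2))) * exp (- u)
       + poly P s * u ^ k * (exp (- u) * - (2 * s * u\<^sup>2))) (at s)"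
      unfolding u_def
      by (rule DERIV_cong, (rule derivative_intros poly_DERIV du refl)+)
        (simp add: u_def algebra_simps)
    moreover have "(poly (pderiv P) s * u ^ k + poly P s * (real k * u ^ (k - 1) * (2 * s * u\<^sup>2))) * exp (- u)
       + poly P s * u ^ k * (exp (- u) * - (2 * s * u\<^sup>2)) = poly (bump_poly' P k) s * u ^ (k + 2) * exp (- u)"
    proof -
      have 1: "u * (1 - s\<^sup>2) = 1" using pos by (simp add: u_def)
      have a: "u ^ k = (1 - s\<^sup>2)\<^sup>2 * u ^ (k + 2)"
      proof -
        have "(1 - s\<^sup>2)\<^sup>2 * u ^ (k + 2) = u ^ k * (u * (1 - s\<^sup>2))\<^sup>2"
          by (simp only: power_add power_mult_distrib mult_ac)
        then show ?thesis using 1 by simp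
      qed
      have b: "real k * u ^ (k - 1) * u\<^sup>2 = real k * ((1 - s\<^sup>2) * u ^ (k + 2))"
      proof (cases k)
        case (Suc m)
        have "(1 - s\<^sup>2) * u ^ (k + 2) = u ^ (m + 2) * (u * (1 - s\<^sup>2))" by (simp add: Suc)
        then show ?thesis unfolding 1 by (simp add: Suc power_add power2_eq_square mult_ac)
      qed simp
      have "(poly (pderiv P) s * u ^ k + poly P s * (real k * u ^ (k - 1) * (2 * s * u\<^sup>2)))
        + poly P s * u ^ k * (- (2 * s * u\<^sup>2)) = poly (pderiv P) s * u ^ k
         + 2 * s * poly P s * (real k * u ^ (k - 1) * u\<^sup>2) - 2 * s * poly P s * u ^ (k + 2)"
        by (simp add: algebra_simps power_add power2_eq_square)
      also have "\<dots> = poly (bump_poly' P k) s * u ^ (k + 2)"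
        unfolding a b by (simp add: bump_poly'_def algebra_simps power2_eq_square)
      finally have "((poly (pderiv P) s * u ^ k + poly P s * (real k * u ^ (k - 1) * (2 * s * u\<^sup>2)))
        + poly P s * u ^ k * (- (2 * s * u\<^sup>2))) * exp (- u) = poly (bump_poly' P k) s * u ^ (k + 2) * exp (- u)"
        by simp
      then show ?thesis by (simp add: algebra_simps)
    qed
    ultimately have d: "((\<lambda>s. poly P s * (1 / (1 - s\<^sup>2)) ^ k * exp (- (1 / (1 - s\<^sup>2)))) has_real_derivative
        bump_fn (bump_poly' P k) (k + 2) s) (at s)"
      using 1 by (simp add: bump_fn_def u_def)
    show ?thesis
      by (rule has_field_derivative_transform_within_open[OF d, of "{-1<..<1}"])
        (use 1 in \<open>auto simp: bump_fn_def\<close>)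
  next
    case 2
    obtain B where B: "B > 0" "\<And>s. \<bar>bump_fn P k s\<bar> \<le> B * (1 - \<bar>s\<bar>)\<^sup>2" using bump_fn_bound by blast
    have 0: "bump_fn P k s = 0" "bump_fn (bump_poly' P k) (k + 2) s = 0" using 2 by (auto simp: bump_fn_def)
    have bnd: "norm ((bump_fn P k (s + h) - bump_fn P k s) / h) \<le> B * \<bar>h\<bar>" for h
    proof (cases "h = 0")
      case False
      have "\<bar>1 - \<bar>s + h\<bar>\<bar> \<le> \<bar>h\<bar>" using 2 by linarith
      then have "(1 - \<bar>s + h\<bar>)\<^sup>2 \<le> h\<^sup>2" by (simp add: abs_le_square_iff)
      then have "\<bar>bump_fn P k (s + h)\<bar> \<le> B * h\<^sup>2"
        using B(2)[of "s + h"] B(1) mult_left_mono[of "(1 - \<bar>s + h\<bar>)\<^sup>2" "h\<^sup>2" B] by linarith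
      then show ?thesis using False 0
        by (simp add: abs_divide divide_le_eq power2_eq_square abs_mult_self_eq mult.assoc)
    qed (use 0 in simp)
    have lim: "((\<lambda>h. B * \<bar>h\<bar>) \<longlongrightarrow> 0) (at (0::real))" by (auto intro!: tendsto_eq_intros)
    have "((\<lambda>h. (bump_fn P k (s + h) - bump_fn P k s) / h) \<longlongrightarrow> 0) (at 0)"
      by (rule Lim_null_comparison[OF always_eventually lim]) (rule allI, rule bnd)
    then show ?thesis unfolding DERIV_def 0(2) .
  next
    case 3
    have "((\<lambda>_. 0) has_real_derivative 0) (at s)" by simp
    then have "(bump_fn P k has_real_derivative 0) (at s)"
      by (rule has_field_derivative_transform_within_open[of _ _ _ "- {-1..1}"])
        (use 3 in \<open>auto simp: bump_fn_def\<close>)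
    then show ?thesis using 3 by (simp add: bump_fn_def)
  qed
qed

primrec bump_data :: "nat \<Rightarrow> real poly \<times> nat" where
  "bump_data 0 = (1, 0)"
| "bump_data (Suc n) = (case bump_data n of (P, k) \<Rightarrow> (bump_poly' P k, k + 2))"

definition bump :: "nat \<Rightarrow> real \<Rightarrow> real" where
  "bump n = (case bump_data n of (P, k) \<Rightarrow> bump_fn P k)"

lemma bump_deriv: "(bump n has_real_derivative bump (Suc n) s) (at s)"
  using bump_fn_deriv by (simp add: bump_def case_prod_unfold)

lemma bump_0: "bump 0 s = (if \<bar>s\<bar> < 1 then exp (- (1 / (1 - s\<^sup>2))) else 0)"
  by (simp add: bump_def bump_fn_def)

lemma bump_zero: "\<bar>s\<bar> \<ge> 1 \<Longrightarrow> bump n s = 0"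
  by (simp add: bump_def bump_fn_def case_prod_unfold)

lemma continuous_bump: "continuous_on UNIV (bump n)"
  using bump_deriv DERIV_isCont by (intro continuous_at_imp_continuous_on) blast

lemma bump_nonneg: "0 \<le> bump 0 s" by (simp add: bump_0)

definition bump_mass :: real where "bump_mass = integral {-1..1} (bump 0)"

text \<open>As for \<open>bump\<close> and \<open>plateau\<close>, the first argument counts derivatives. The height is not normalised.\<close>

definition smooth_step :: "nat \<Rightarrow> real \<Rightarrow> real" where
  "smooth_step n s = (case n of 0 \<Rightarrow> integral {-1..s} (bump 0) | Suc m \<Rightarrow> bump m s)"

lemma smooth_step_0: "smooth_step 0 s = integral {-1..s} (bump 0)"
  and smooth_step_Suc: "smooth_step (Suc n) = bump n"
  by (simp_all add: smooth_step_def fun_eq_iff)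

lemma smooth_step_left: "s \<le> -1 \<Longrightarrow> smooth_step 0 s = 0"
  by (cases "s = -1") (auto simp: smooth_step_0)

lemma smooth_step_deriv: "(smooth_step n has_real_derivative smooth_step (Suc n) s) (at s)"
proof (cases n)
  case (Suc m) then show ?thesis by (simp add: smooth_step_Suc bump_deriv)
next
  case 0
  \<comment> \<open>The lower limit is moved to -2 so that differentiation at -1 takes place inside
    the interval of integration.\<close>
  have eq: "smooth_step 0 r = integral {-2..r} (bump 0)" for r
  proof (cases "r \<ge> -1")
    case True
    have "integral {-2..-1} (bump 0) = integral {-2..-1::real} (\<lambda>_. 0)"
      by (rule Henstock_Kurzweil_Integration.integral_cong) (auto intro: bump_zero)
    moreover have "integral {-2..-1} (bump 0) + integral {-1..r} (bump 0) = integral {-2..r} (bump 0)"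
      by (rule Henstock_Kurzweil_Integration.integral_combine)
        (use True in \<open>auto intro!: integrable_continuous_interval continuous_on_subset[OF continuous_bump]\<close>)
    ultimately show ?thesis by (simp add: smooth_step_0)
  next
    case False
    have "integral {-2..r} (bump 0) = integral {-2..r} (\<lambda>_. 0)"
      by (rule Henstock_Kurzweil_Integration.integral_cong) (use False in \<open>auto intro: bump_zero\<close>)
    then show ?thesis using False by (simp add: smooth_step_left)
  qed
  show ?thesis
  proof (cases "s > -2")
    case True
    have "((\<lambda>r. integral {-2..r} (bump 0)) has_real_derivative bump 0 s) (at s within {-2..s + 1})"
      by (rule integral_has_real_derivative) (use True in \<open>auto intro: continuous_on_subset[OF continuous_bump]\<close>)
    moreover have "at s within {-2..s + 1} = at s" using True by (intro at_within_Icc_at) auto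
    ultimately have "((\<lambda>r. integral {-2..r} (bump 0)) has_real_derivative bump 0 s) (at s)" by simp
    moreover have "smooth_step 0 = (\<lambda>r. integral {-2..r} (bump 0))" using eq by blast
    ultimately show ?thesis using 0 by (simp add: smooth_step_Suc)
  next
    case False
    have "((\<lambda>_. 0) has_real_derivative 0) (at s)" by simp
    then have "(smooth_step 0 has_real_derivative 0) (at s)"
      by (rule has_field_derivative_transform_within_open[of _ _ _ "{..<-1}"])
        (use False in \<open>auto simp: smooth_step_left\<close>)
    then show ?thesis using 0 False by (simp add: smooth_step_Suc bump_zero)
  qed
qed

lemma smooth_step_mono: "s \<le> t \<Longrightarrow> smooth_step 0 s \<le> smooth_step 0 t"
  by (rule DERIV_nonneg_imp_nondecreasing)
    (use smooth_step_deriv[of 0] bump_nonneg in \<open>auto simp: smooth_step_Suc\<close>)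

lemma smooth_step_right: "s \<ge> 1 \<Longrightarrow> smooth_step 0 s = bump_mass"
proof -
  assume s: "s \<ge> 1"
  have "integral {1..s} (bump 0) = integral {1..s} (\<lambda>_. 0)"
    by (rule Henstock_Kurzweil_Integration.integral_cong) (auto intro: bump_zero)
  moreover have "integral {-1..1} (bump 0) + integral {1..s} (bump 0) = integral {-1..s} (bump 0)"
    by (rule Henstock_Kurzweil_Integration.integral_combine)
      (use s in \<open>auto intro!: integrable_continuous_interval continuous_on_subset[OF continuous_bump]\<close>)
  ultimately show ?thesis by (simp add: smooth_step_0 bump_mass_def)
qed

lemma bump_mass_pos: "bump_mass > 0"
proof -
  have "smooth_step 0 (- 1 / 2) < smooth_step 0 (1 / 2)"
  proof (rule DERIV_pos_imp_increasing[of "- 1 / 2" "1 / 2"])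
    fix x :: real assume "- 1 / 2 \<le> x" "x \<le> 1 / 2"
    then have "bump 0 x > 0" by (simp add: bump_0 abs_if)
    then show "\<exists>y. (smooth_step 0 has_real_derivative y) (at x) \<and> 0 < y"
      using smooth_step_deriv[of 0 x] by (auto simp: smooth_step_Suc)
  qed simp
  then show ?thesis
    using smooth_step_mono[of "-1" "-1/2"] smooth_step_mono[of "1/2" 1] smooth_step_left[of "-1"] smooth_step_right[of 1]
    by simp
qed

text \<open>A step up at \<open>a\<close> and a step down at \<open>b\<close>, each of half-width
  \<open>r\<close>. The steps overlap when \<open>b - a < 2 * r\<close>, which may happen in the
  second variable below.\<close>

definition plateau :: "nat \<Rightarrow> real \<Rightarrow> real \<Rightarrow> real \<Rightarrow> real \<Rightarrow> real" where
  "plateau n r a b x = (smooth_step n ((x - a) / r) - smooth_step n ((x - b) / r)) / r ^ n"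

lemma plateau_deriv:
  assumes "r > 0"
  shows "(plateau n r a b has_real_derivative plateau (Suc n) r a b x) (at x)"
proof -
  have 1: "((\<lambda>x. (x - c) / r) has_real_derivative 1 / r) (at x)" for c
    using assms by (auto intro!: derivative_eq_intros)
  have "((\<lambda>x. (smooth_step n ((x - a) / r) - smooth_step n ((x - b) / r)) / r ^ n) has_real_derivative
     (smooth_step (Suc n) ((x - a) / r) * (1 / r) - smooth_step (Suc n) ((x - b) / r) * (1 / r)) / r ^ n) (at x)"
    by (intro DERIV_cdivide DERIV_diff DERIV_chain2[OF smooth_step_deriv 1])
  moreover have "(A * (1 / r) - B * (1 / r)) / r ^ n = (A - B) / r ^ Suc n" for A B :: real
    unfolding left_diff_distrib[symmetric] by simp
  ultimately show ?thesis unfolding plateau_def[abs_def] by simp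
qed

lemma plateau_zero:
  assumes "r > 0" "a \<le> b" "x \<le> a - r \<or> b + r \<le> x"
  shows "plateau n r a b x = 0"
proof (cases n)
  case 0
  show ?thesis using assms(3)
  proof
    assume "x \<le> a - r"
    then have "(x - a) / r \<le> -1" "(x - b) / r \<le> -1"
      unfolding pos_divide_le_eq[OF assms(1)] using assms(2) by linarith+
    then show ?thesis using 0 by (simp add: plateau_def smooth_step_left)
  next
    assume "b + r \<le> x"
    then have "(x - a) / r \<ge> 1" "(x - b) / r \<ge> 1"
      unfolding pos_le_divide_eq[OF assms(1)] using assms(2) by linarith+
    then show ?thesis using 0 by (simp add: plateau_def smooth_step_right)
  qed
next
  case (Suc m)
  have "r \<le> \<bar>x - a\<bar>" "r \<le> \<bar>x - b\<bar>" using assms by linarith+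
  then have "\<bar>(x - a) / r\<bar> \<ge> 1" "\<bar>(x - b) / r\<bar> \<ge> 1"
    using assms(1) by (simp_all add: abs_divide pos_le_divide_eq)
  then show ?thesis using Suc by (simp add: plateau_def smooth_step_Suc bump_zero)
qed

lemma plateau_range:
  assumes "r > 0" "a \<le> b" shows "0 \<le> plateau 0 r a b x" "plateau 0 r a b x \<le> bump_mass"
proof -
  have "(x - b) / r \<le> (x - a) / r" using assms by (simp add: divide_right_mono)
  from smooth_step_mono[OF this] show "0 \<le> plateau 0 r a b x" by (simp add: plateau_def)
  have "smooth_step 0 ((x - a) / r) \<le> bump_mass"
    using smooth_step_mono[of _ "max 1 ((x - a) / r)"] smooth_step_right[of "max 1 ((x - a) / r)"] by simp
  moreover have "0 \<le> smooth_step 0 ((x - b) / r)"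
    using smooth_step_mono[of "min (-1) ((x - b) / r)"] smooth_step_left[of "min (-1) ((x - b) / r)"] by simp
  ultimately show "plateau 0 r a b x \<le> bump_mass" by (simp add: plateau_def)
qed

lemma plateau_one:
  assumes "r > 0" "a + r \<le> x" "x \<le> b - r" shows "plateau 0 r a b x = bump_mass"
proof -
  have "(x - a) / r \<ge> 1" "(x - b) / r \<le> -1"
    unfolding pos_le_divide_eq[OF assms(1)] pos_divide_le_eq[OF assms(1)] using assms(2,3) by linarith+
  then show ?thesis by (simp add: plateau_def smooth_step_left smooth_step_right)
qed

lemma product_partial:
  fixes U W :: "real \<Rightarrow> real"
  assumes "\<And>x. (U has_real_derivative U' x) (at x)" "\<And>x. (W has_real_derivative W' x) (at x)"
  shows "((\<lambda>z::real^2. U (z $ 1) * W (z $ 2)) has_derivative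
      (\<lambda>h. U' (z $ 1) * h $ 1 * W (z $ 2) + U (z $ 1) * (W' (z $ 2) * h $ 2))) (at z)"
proof -
  have n: "((\<lambda>z::real^2. z $ i) has_derivative (\<lambda>h. h $ i)) (at z)" for i
    by (rule bounded_linear_imp_has_derivative[OF bounded_linear_vec_nth])
  have 1: "((\<lambda>z::real^2. U (z $ 1)) has_derivative (\<lambda>h. U' (z $ 1) * h $ 1)) (at z)"
    using has_derivative_compose[OF n[of 1], of U "times (U' (z $ 1))"] assms(1)[of "z $ 1"]
    by (simp add: has_field_derivative_def)
  have 2: "((\<lambda>z::real^2. W (z $ 2)) has_derivative (\<lambda>h. W' (z $ 2) * h $ 2)) (at z)"
    using has_derivative_compose[OF n[of 2], of W "times (W' (z $ 2))"] assms(2)[of "z $ 2"]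
    by (simp add: has_field_derivative_def)
  show ?thesis using has_derivative_mult[OF 1 2] by (simp add: add.commute)
qed

text \<open>The sequences \<open>U\<close> and \<open>W\<close> list all derivatives of the two
  factors, so that every partial derivative of a product is again such a product and smoothness
  follows by induction over arbitrary orders \<open>a\<close> and \<open>b\<close>.\<close>

lemma product_test_function:
  fixes U W :: "nat \<Rightarrow> real \<Rightarrow> real"
  assumes U: "\<And>n x. (U n has_real_derivative U (Suc n) x) (at x)"
    and W: "\<And>n x. (W n has_real_derivative W (Suc n) x) (at x)"
    and supp: "\<And>x. M \<le> \<bar>x\<bar> \<Longrightarrow> U 0 x = 0" "\<And>x. M \<le> \<bar>x\<bar> \<Longrightarrow> W 0 x = 0"
  shows "(\<lambda>z::real^2. U 0 (z $ 1) * W 0 (z $ 2)) \<in> test_functions"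
    and "partial_deriv (axis 2 1) (\<lambda>z::real^2. U 0 (z $ 1) * W 0 (z $ 2)) z = U 0 (z $ 1) * W 1 (z $ 2)"
proof -
  note d = product_partial[OF U W]
  have p1: "partial_deriv (axis 1 1) (\<lambda>z::real^2. U a (z $ 1) * W b (z $ 2)) z = U (Suc a) (z $ 1) * W b (z $ 2)"
    and p2: "partial_deriv (axis 2 1) (\<lambda>z::real^2. U a (z $ 1) * W b (z $ 2)) z = U a (z $ 1) * W (Suc b) (z $ 2)"
    for a b z
    unfolding frechet_derivative_at[OF d, symmetric] by (simp_all add: axis_def)
  have diff: "(\<lambda>z::real^2. U a (z $ 1) * W b (z $ 2)) differentiable_on UNIV" for a b
    unfolding differentiable_on_def using d differentiableI by blast
  have "Ck k (\<lambda>z::real^2. U a (z $ 1) * W b (z $ 2))" for k a b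
  proof (induction k arbitrary: a b)
    case 0 show ?case using differentiable_imp_continuous_on[OF diff] by simp
  next
    case (Suc k)
    show ?case using diff Suc by (simp add: Basis_real2 p1 p2)
  qed
  moreover have "compact (closure {z::real^2. U 0 (z $ 1) * W 0 (z $ 2) \<noteq> 0})"
  proof -
    have "norm z \<le> 2 * M" if "U 0 (z $ 1) * W 0 (z $ 2) \<noteq> 0" for z :: "real^2"
    proof -
      have "\<bar>z $ 1\<bar> < M" using supp(1)[of "z $ 1"] that by (cases "M \<le> \<bar>z $ 1\<bar>") auto
      moreover have "\<bar>z $ 2\<bar> < M" using supp(2)[of "z $ 2"] that by (cases "M \<le> \<bar>z $ 2\<bar>") auto
      ultimately show ?thesis using norm_vec2_le[of z] by linarith
    qed
    then have "bounded {z::real^2. U 0 (z $ 1) * W 0 (z $ 2) \<noteq> 0}" by (intro boundedI) auto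
    then show ?thesis by (simp add: compact_closure)
  qed
  ultimately show "(\<lambda>z::real^2. U 0 (z $ 1) * W 0 (z $ 2)) \<in> test_functions" by (simp add: test_functions_def)
  show "partial_deriv (axis 2 1) (\<lambda>z::real^2. U 0 (z $ 1) * W 0 (z $ 2)) z = U 0 (z $ 1) * W 1 (z $ 2)"
    using p2[of 0 0 z] by simp
qed

text \<open>At \<open>s = 1 / 2\<close> the exponent \<open>1 / (1 - s\<^sup>2)\<close> equals 4/3;
  the middle half of the support is enough for a positive lower bound.\<close>

lemma bump_ge: "\<bar>s::real\<bar> \<le> 1 / 2 \<Longrightarrow> exp (- 4 / 3) \<le> bump 0 s"
proof -
  assume s: "\<bar>s\<bar> \<le> 1 / 2"
  have "s\<^sup>2 \<le> (1 / 2)\<^sup>2" using s power_mono[of "\<bar>s\<bar>" "1/2" 2] by simp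
  then have "3 / 4 \<le> 1 - s\<^sup>2" by (simp add: power2_eq_square)
  then have "1 / (1 - s\<^sup>2) \<le> 1 / (3 / 4)" by (intro divide_left_mono) auto
  then show ?thesis using s by (simp add: bump_0)
qed

lemma bump_le: "bump 0 s \<le> 1"
  by (simp add: bump_0 abs_square_le_1)

section \<open>Unbounded variation\<close>

lemma radon_measureD:
  fixes \<mu> :: "(real^2) measure"
  assumes "radon_measure \<mu>" "S \<in> sets borel" "bounded S"
  shows "S \<in> fmeasurable \<mu>"
proof -
  have s: "sets \<mu> = sets borel" using assms by (simp add: radon_measure_def)
  have "compact (closure S)" using assms(3) by (simp add: compact_closure)
  then have "emeasure \<mu> (closure S) < \<infinity>" using assms(1) by (simp add: radon_measure_def)
  moreover have "emeasure \<mu> S \<le> emeasure \<mu> (closure S)" by (rule emeasure_mono) (auto simp: s closure_subset)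
  ultimately show ?thesis using assms(2) s by (intro fmeasurableI) auto
qed

text \<open>For a test function that steps up at height \<open>\<eta>\<close> and down at
  \<open>\<zeta>\<close>, the vertical derivative is a positive bump at \<open>\<eta>\<close>, where
  \<open>f \<le> 0\<close>, minus one at \<open>\<zeta>\<close>, where
  \<open>f \<ge> \<delta>\<close>. The bumps have height of order \<open>1 / r\<close> and width of
  order \<open>r\<close>, so the bound depends neither on \<open>r\<close> nor on the distance of
  the two heights.\<close>

lemma oscillation_charges_measure:
  fixes f :: "real^2 \<Rightarrow> real"
  assumes f: "locally_integrable_on UNIV f"
    and ibp: "\<And>\<phi>. \<phi> \<in> test_functions \<Longrightarrow>
      (\<integral>x. f x * partial_deriv (axis 2 1) \<phi> x \<partial>lebesgue) = - ((\<integral>x. \<phi> x \<partial>\<mu>) - (\<integral>x. \<phi> x \<partial>\<nu>))"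
    and \<mu>: "radon_measure \<mu>"
    and uw: "u < w" and r: "r > 0" and ez: "\<eta> < \<zeta>" and \<delta>: "\<delta> \<ge> 0"
    and low: "AE z in lebesgue. u < z $ 1 \<and> z $ 1 < w \<and> \<bar>z $ 2 - \<eta>\<bar> < r \<longrightarrow> f z \<le> 0"
    and high: "AE z in lebesgue. u < z $ 1 \<and> z $ 1 < w \<and> \<bar>z $ 2 - \<zeta>\<bar> < r \<longrightarrow> \<delta> \<le> f z"
  shows "\<delta> * exp (- 4 / 3) / (2 * bump_mass) * (w - u)
    \<le> measure \<mu> (box (vec2 u (\<eta> - r)) (vec2 w (\<zeta> + r)))"
proof -
  \<comment> \<open>With transitions of half-width \<open>(w - u) / 8\<close> the cut-off has full
    height on the middle half of the interval, whence the factor 1/2 in the constant.\<close>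
  define \<epsilon> where "\<epsilon> = (w - u) / 8"
  have \<epsilon>: "\<epsilon> > 0" using uw by (simp add: \<epsilon>_def)
  have w8: "w = u + 8 * \<epsilon>" by (simp add: \<epsilon>_def field_simps)
  have uw': "u + \<epsilon> \<le> w - \<epsilon>" using \<epsilon> w8 by linarith
  define U where "U = (\<lambda>n. plateau n \<epsilon> (u + \<epsilon>) (w - \<epsilon>))"
  define W where "W = (\<lambda>n. plateau n r \<eta> \<zeta>)"
  define \<phi> where "\<phi> = (\<lambda>z::real^2. U 0 (z $ 1) * W 0 (z $ 2))"
  have U0: "U n x = 0" if "x \<le> u \<or> w \<le> x" for n x
    unfolding U_def by (rule plateau_zero[OF \<epsilon> uw']) (use that in auto)
  have W0: "W n y = 0" if "y \<le> \<eta> - r \<or> \<zeta> + r \<le> y" for n y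
    unfolding W_def by (rule plateau_zero[OF r less_imp_le[OF ez]]) (use that in auto)
  have Ur: "0 \<le> U 0 x" "U 0 x \<le> bump_mass" for x using plateau_range[OF \<epsilon> uw'] by (simp_all add: U_def)
  have Wr: "0 \<le> W 0 x" "W 0 x \<le> bump_mass" for x using plateau_range[OF r less_imp_le[OF ez]] by (simp_all add: W_def)
  have W1: "W 1 y = (bump 0 ((y - \<eta>) / r) - bump 0 ((y - \<zeta>) / r)) / r" for y
    unfolding W_def plateau_def One_nat_def smooth_step_Suc by simp
  define M where "M = \<bar>u\<bar> + \<bar>w\<bar> + \<bar>\<eta>\<bar> + \<bar>\<zeta>\<bar> + r"
  have dU: "(U n has_real_derivative U (Suc n) x) (at x)" for n x unfolding U_def by (rule plateau_deriv[OF \<epsilon>])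
  have dW: "(W n has_real_derivative W (Suc n) x) (at x)" for n x unfolding W_def by (rule plateau_deriv[OF r])
  have sU: "U 0 x = 0" if "M \<le> \<bar>x\<bar>" for x
    by (rule U0) (use that r in \<open>auto simp: M_def\<close>)
  have sW: "W 0 x = 0" if "M \<le> \<bar>x\<bar>" for x
    by (rule W0) (use that r in \<open>auto simp: M_def\<close>)
  have \<phi>: "\<phi> \<in> test_functions" unfolding \<phi>_def by (rule product_test_function(1)[of U W M, OF dU dW sU sW])
  have d\<phi>: "partial_deriv (axis 2 1) \<phi> z = U 0 (z $ 1) * W 1 (z $ 2)" for z
    unfolding \<phi>_def by (rule product_test_function(2)[of U W M, OF dU dW sU sW])
  define s where "s = r / 2"
  have s: "r = 2 * s" "s > 0" using r by (simp_all add: s_def)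
  define B where "B = cbox (vec2 (u + 2 * \<epsilon>) (\<zeta> - s)) (vec2 (w - 2 * \<epsilon>) (\<zeta> + s))"
  define c where "c = \<delta> * (bump_mass * exp (- 4 / 3) / r)"
  have pointwise: "f z * (U 0 (z $ 1) * W 1 (z $ 2)) \<le> - c * indicator B z"
    if l: "u < z $ 1 \<and> z $ 1 < w \<and> \<bar>z $ 2 - \<eta>\<bar> < r \<longrightarrow> f z \<le> 0"
      and h: "u < z $ 1 \<and> z $ 1 < w \<and> \<bar>z $ 2 - \<zeta>\<bar> < r \<longrightarrow> \<delta> \<le> f z" for z
  proof (cases "u < z $ 1 \<and> z $ 1 < w")
    case False
    then have "z \<notin> B" using \<epsilon> by (auto simp: B_def mem_box Basis_real2)
    moreover have "U 0 (z $ 1) = 0" using False by (intro U0) auto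
    ultimately show ?thesis by simp
  next
    case True
    define b1 where "b1 = bump 0 ((z $ 2 - \<eta>) / r)"
    define b2 where "b2 = bump 0 ((z $ 2 - \<zeta>) / r)"
    have "f z * b1 \<le> 0"
    proof (cases "\<bar>z $ 2 - \<eta>\<bar> < r")
      case True then show ?thesis using l \<open>u < z $ 1 \<and> z $ 1 < w\<close> bump_nonneg by (simp add: b1_def mult_nonpos_nonneg)
    next
      case False then show ?thesis using r by (simp add: b1_def bump_zero abs_divide pos_le_divide_eq)
    qed
    moreover have "\<delta> * b2 \<le> f z * b2"
    proof (cases "\<bar>z $ 2 - \<zeta>\<bar> < r")
      case True then show ?thesis using h \<open>u < z $ 1 \<and> z $ 1 < w\<close> bump_nonneg by (simp add: b2_def mult_right_mono)
    next
      case False then show ?thesis using r by (simp add: b2_def bump_zero abs_divide pos_le_divide_eq)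
    qed
    ultimately have "f z * (b1 - b2) \<le> - (\<delta> * b2)" by (simp add: right_diff_distrib)
    then have "(U 0 (z $ 1) / r) * (f z * (b1 - b2)) \<le> (U 0 (z $ 1) / r) * - (\<delta> * b2)"
      using Ur r by (intro mult_left_mono) auto
    then have "f z * (U 0 (z $ 1) * W 1 (z $ 2)) \<le> - (\<delta> * (U 0 (z $ 1) * b2 / r))"
      unfolding W1 b1_def[symmetric] b2_def[symmetric] by (simp add: mult_ac)
    also have "\<dots> \<le> - c * indicator B z"
    proof (cases "z \<in> B")
      case True
      then have z: "u + \<epsilon> + \<epsilon> \<le> z $ 1" "z $ 1 \<le> w - \<epsilon> - \<epsilon>" "\<bar>z $ 2 - \<zeta>\<bar> \<le> s"
        by (auto simp: B_def mem_box Basis_real2)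
      have "U 0 (z $ 1) = bump_mass" unfolding U_def by (rule plateau_one[OF \<epsilon> z(1,2)])
      moreover have "exp (- 4 / 3) \<le> b2" unfolding b2_def
        by (rule bump_ge) (use z(3) s in \<open>simp add: abs_divide pos_divide_le_eq\<close>)
      ultimately have "bump_mass * exp (- 4 / 3) / r \<le> U 0 (z $ 1) * b2 / r"
        using bump_mass_pos r by (intro divide_right_mono mult_mono) auto
      from mult_left_mono[OF this \<delta>] show ?thesis using True by (simp add: c_def)
    next
      case False
      have "0 \<le> U 0 (z $ 1) * b2 / r" using Ur r bump_nonneg by (simp add: b2_def)
      from mult_nonneg_nonneg[OF \<delta> this] show ?thesis using False by simp
    qed
    finally show ?thesis .
  qed
  have int: "integrable lebesgue (\<lambda>z. f z * (U 0 (z $ 1) * W 1 (z $ 2)))"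
  proof (rule Bochner_Integration.integrable_bound)
    let ?K = "cbox (vec2 u (\<eta> - r)) (vec2 w (\<zeta> + r))"
    have iK: "integrable lebesgue (\<lambda>z. indicator ?K z *\<^sub>R f z)"
      using f by (simp add: locally_integrable_on_def set_integrable_def)
    then show "integrable lebesgue (\<lambda>z. (bump_mass * (2 / r)) * (indicator ?K z *\<^sub>R f z))" by (rule integrable_mult_right)
    have eq: "f z * (U 0 (z $ 1) * W 1 (z $ 2)) = (indicator ?K z *\<^sub>R f z) * (U 0 (z $ 1) * W 1 (z $ 2))" for z
      using U0[of "z $ 1" 0] W0[of "z $ 2" 1] by (cases "z \<in> ?K") (auto simp: mem_box Basis_real2)
    have "continuous_on UNIV (U 0)" "continuous_on UNIV (W 1)"
      using dU dW DERIV_isCont by (intro continuous_at_imp_continuous_on; blast)+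
    then have "continuous_on UNIV (\<lambda>z::real^2. U 0 (z $ 1) * W 1 (z $ 2))"
      by (intro continuous_on_mult continuous_on_compose2[of UNIV "U 0" UNIV "\<lambda>z::real^2. z $ 1"]
          continuous_on_compose2[of UNIV "W 1" UNIV "\<lambda>z::real^2. z $ 2"]) (auto intro!: continuous_intros)
    then have "(\<lambda>z::real^2. U 0 (z $ 1) * W 1 (z $ 2)) \<in> borel_measurable lebesgue"
      using borel_measurable_continuous_onI measurable_completion[of _ lborel] by auto
    then show "(\<lambda>z. f z * (U 0 (z $ 1) * W 1 (z $ 2))) \<in> borel_measurable lebesgue"
      unfolding eq using borel_measurable_integrable[OF iK] by (rule borel_measurable_times[rotated])
    show "AE z in lebesgue. norm (f z * (U 0 (z $ 1) * W 1 (z $ 2))) \<le> norm ((bump_mass * (2 / r)) * (indicator ?K z *\<^sub>R f z))"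
    proof (rule AE_I2)
      fix z :: "real^2"
      have "\<bar>bump 0 ((z $ 2 - \<eta>) / r) - bump 0 ((z $ 2 - \<zeta>) / r)\<bar> \<le> 2"
        using bump_nonneg[of "(z $ 2 - \<eta>) / r"] bump_nonneg[of "(z $ 2 - \<zeta>) / r"]
          bump_le[of "(z $ 2 - \<eta>) / r"] bump_le[of "(z $ 2 - \<zeta>) / r"] by linarith
      then have "\<bar>W 1 (z $ 2)\<bar> \<le> 2 / r" unfolding W1 abs_divide using r by (simp add: divide_right_mono)
      moreover have "\<bar>U 0 (z $ 1)\<bar> \<le> bump_mass" using Ur[of "z $ 1"] by simp
      ultimately have "\<bar>U 0 (z $ 1) * W 1 (z $ 2)\<bar> \<le> bump_mass * (2 / r)"
        unfolding abs_mult using bump_mass_pos by (intro mult_mono) auto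
      then have "\<bar>indicator ?K z *\<^sub>R f z\<bar> * \<bar>U 0 (z $ 1) * W 1 (z $ 2)\<bar> \<le> \<bar>indicator ?K z *\<^sub>R f z\<bar> * (bump_mass * (2 / r))"
        by (intro mult_left_mono) auto
      moreover have "\<bar>bump_mass * (2 / r)\<bar> = bump_mass * (2 / r)" using bump_mass_pos r by simp
      ultimately show "norm (f z * (U 0 (z $ 1) * W 1 (z $ 2))) \<le> norm ((bump_mass * (2 / r)) * (indicator ?K z *\<^sub>R f z))"
        unfolding eq[of z] real_norm_def abs_mult[of "bump_mass * (2 / r)"] abs_mult[of _ "U 0 (z $ 1) * W 1 (z $ 2)"]
        by (simp only: mult.commute[of "bump_mass * (2 / r)"])
    qed
  qed
  have mB: "measure lebesgue B = (w - u) / 2 * r"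
  proof -
    have "measure lebesgue B = (w - 2 * \<epsilon> - (u + 2 * \<epsilon>)) * (\<zeta> + s - (\<zeta> - s))"
      unfolding B_def using \<epsilon> w8 s by (subst measure_completion, simp, subst content_cbox) (auto simp: Basis_real2 axis_real2_neq)
    then show ?thesis by (simp add: w8 s field_simps)
  qed
  have "B \<in> lmeasurable" by (simp add: B_def)
  then have iB: "integrable lebesgue (\<lambda>z. - c * indicator B z)"
    by (intro integrable_mult_right integrable_real_indicator) (auto simp: fmeasurable_def)
  have "(\<integral>z. f z * (U 0 (z $ 1) * W 1 (z $ 2)) \<partial>lebesgue) \<le> (\<integral>z. - c * indicator B z \<partial>lebesgue)"
  proof (rule integral_mono_AE[OF int iB])
    show "AE z in lebesgue. f z * (U 0 (z $ 1) * W 1 (z $ 2)) \<le> - c * indicator B z"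
      using low high by eventually_elim (rule pointwise)
  qed
  also have "\<dots> = - c * ((w - u) / 2 * r)" using mB by simp
  also have "\<dots> = - (\<delta> * (bump_mass * exp (- 4 / 3)) * (w - u) / 2)" using r by (simp add: c_def)
  finally have "\<delta> * (bump_mass * exp (- 4 / 3)) * (w - u) / 2 \<le> (\<integral>z. \<phi> z \<partial>\<mu>) - (\<integral>z. \<phi> z \<partial>\<nu>)"
    using ibp[OF \<phi>] unfolding d\<phi> by simp
  also have "\<dots> \<le> (\<integral>z. \<phi> z \<partial>\<mu>)" using Ur Wr by (simp add: \<phi>_def)
  also have "\<dots> \<le> bump_mass * bump_mass * measure \<mu> (box (vec2 u (\<eta> - r)) (vec2 w (\<zeta> + r)))" (is "_ \<le> _ * measure \<mu> ?S")
  proof -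
    have S: "?S \<in> fmeasurable \<mu>" by (rule radon_measureD[OF \<mu>]) auto
    have "(\<integral>z. \<phi> z \<partial>\<mu>) \<le> (\<integral>z. bump_mass * bump_mass * indicator ?S z \<partial>\<mu>)"
    proof (rule integral_mono')
      show "integrable \<mu> (\<lambda>z. bump_mass * bump_mass * indicator ?S z)"
        using S by (intro integrable_mult_right) (auto simp: fmeasurable_def integrable_real_indicator)
      fix z
      show "\<phi> z \<le> bump_mass * bump_mass * indicator ?S z"
      proof (cases "z \<in> ?S")
        case True
        have "\<phi> z \<le> bump_mass * bump_mass" unfolding \<phi>_def using Ur Wr bump_mass_pos by (intro mult_mono) auto
        then show ?thesis using True by simp
      next
        case False
        then show ?thesis using U0[of "z $ 1" 0] W0[of "z $ 2" 0] by (auto simp: \<phi>_def mem_box Basis_real2 not_less)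
      qed
      show "0 \<le> bump_mass * bump_mass * indicator ?S z" by simp
    qed
    also have "\<dots> = bump_mass * bump_mass * measure \<mu> ?S"
      using fmeasurableD[OF S] by simp
    finally show ?thesis .
  qed
  finally have "bump_mass * (\<delta> * exp (- 4 / 3) * (w - u) / 2) \<le> bump_mass * (bump_mass * measure \<mu> ?S)"
    by (simp add: mult_ac)
  then have "\<delta> * exp (- 4 / 3) * (w - u) / 2 \<le> bump_mass * measure \<mu> ?S"
    using bump_mass_pos by (simp only: mult_le_cancel_left_pos)
  then show ?thesis using bump_mass_pos by (simp add: field_simps)
qed

section \<open>Accumulation of mass on infinitely many pairs of levels\<close>

lemma level_mono: "h \<le> h' \<Longrightarrow> level x h \<le> level x h'"
  by (rule ccontr) (simp add: not_le level_less_iff)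

lemma stream_near:
  assumes "d > 0"
  obtains r where "r > 0"
    "\<And>x y. \<bar>x - x0\<bar> < r \<Longrightarrow> \<bar>y - level x0 h\<bar> < r \<Longrightarrow> \<bar>stream x y - h\<bar> < d"
proof -
  have "\<forall>e>0. \<exists>r>0. \<forall>p\<in>UNIV. dist p (x0, level x0 h) < r \<longrightarrow>
      dist (case p of (x, y) \<Rightarrow> stream x y) (case (x0, level x0 h) of (x, y) \<Rightarrow> stream x y) < e"
    using continuous_stream unfolding continuous_on_iff by blast
  then obtain r where r: "r > 0" "\<And>p. dist p (x0, level x0 h) < r \<Longrightarrow>
      dist (case p of (x, y) \<Rightarrow> stream x y) (case (x0, level x0 h) of (x, y) \<Rightarrow> stream x y) < d"
    using assms by blast
  show ?thesis
  proof (rule that[of "r / 2"])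
    fix x y assume xy: "\<bar>x - x0\<bar> < r / 2" "\<bar>y - level x0 h\<bar> < r / 2"
    have "dist (x, y) (x0, level x0 h) \<le> \<bar>x - x0\<bar> + \<bar>y - level x0 h\<bar>"
      unfolding dist_Pair_Pair dist_real_def using sqrt_sum_squares_le_sum_abs[of "\<bar>x - x0\<bar>" "\<bar>y - level x0 h\<bar>"] by simp
    then show "\<bar>stream x y - h\<bar> < d" using r(2)[of "(x, y)"] xy by (simp add: dist_real_def)
  qed (use r in simp)
qed

text \<open>Half-open in both variables, so that adjacent strips are disjoint and their measures add
  up even if a common side is charged.\<close>

definition strip :: "real \<Rightarrow> real \<Rightarrow> real \<Rightarrow> real \<Rightarrow> (real^2) set" where
  "strip u w p q = {z. u \<le> z $ 1 \<and> z $ 1 < w \<and> p \<le> z $ 2 \<and> z $ 2 < q}"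

lemma strip_fmeasurable: "radon_measure \<mu> \<Longrightarrow> strip u w p q \<in> fmeasurable \<mu>"
proof (rule radon_measureD)
  have "strip u w p q = {z \<in> space borel. u \<le> z $ 1 \<and> z $ 1 < w \<and> p \<le> z $ 2 \<and> z $ 2 < q}" by (simp add: strip_def)
  also have "\<dots> \<in> sets borel" by measurable
  finally show "strip u w p q \<in> sets borel" .
  have "strip u w p q \<subseteq> cbox (vec2 u p) (vec2 w q)" by (auto simp: strip_def mem_box Basis_real2)
  then show "bounded (strip u w p q)" using bounded_subset bounded_cbox by blast
qed

lemma measure_strip_split:
  assumes "radon_measure \<mu>" "strip u w p q = strip u1 w1 p1 q1 \<union> strip u2 w2 p2 q2" "strip u1 w1 p1 q1 \<inter> strip u2 w2 p2 q2 = {}"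
  shows "measure \<mu> (strip u w p q) = measure \<mu> (strip u1 w1 p1 q1) + measure \<mu> (strip u2 w2 p2 q2)"
  unfolding assms(2) using fmeasurableD[OF strip_fmeasurable[OF assms(1)]] fmeasurableD2[OF strip_fmeasurable[OF assms(1)]]
  by (intro measure_Union assms(3)) (auto simp: less_top)

lemma measure_strip_mono:
  assumes "radon_measure \<mu>" "S \<in> sets borel" "S \<subseteq> strip u w p q"
  shows "measure \<mu> S \<le> measure \<mu> (strip u w p q)"
  using assms by (intro measure_mono_fmeasurable strip_fmeasurable) (auto simp: radon_measure_def)

text \<open>The inverse of \<open>y \<mapsto> vlog (y\<^sup>2)\<close> for positive
  \<open>y\<close>; it allows heights to be prescribed through their phases.\<close>

definition vlog_height :: "real \<Rightarrow> real" where
  "vlog_height s = sqrt (1 / (exp s - 1))"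

lemma vlog_height_pos: "s > 0 \<Longrightarrow> vlog_height s > 0"
  by (simp add: vlog_height_def)

lemma vlog_height_less: "0 < s \<Longrightarrow> s < t \<Longrightarrow> vlog_height t < vlog_height s"
  by (simp add: vlog_height_def frac_less2)

lemma vlog_height_le_1:
  assumes "s \<ge> 1" shows "vlog_height s \<le> 1"
proof -
  have "2 \<le> exp s" using exp_ge_add_one_self[of s] assms by linarith
  then have "1 / (exp s - 1) \<le> 1" using assms by (simp add: divide_le_eq_1)
  then show ?thesis unfolding vlog_height_def by simp
qed

lemma vlog_of_vlog_height:
  assumes "s > 0" shows "vlog ((vlog_height s)\<^sup>2) = s"
proof -
  have "(vlog_height s)\<^sup>2 = 1 / (exp s - 1)" using assms by (simp add: vlog_height_def)
  then have "vlog ((vlog_height s)\<^sup>2) = ln (1 + (exp s - 1))" by (simp only: vlog_def) simp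
  then show ?thesis by simp
qed

text \<open>At time \<open>t\<close> the trajectories near the level through \<open>(0, a)\<close> have not passed the second axis, those near
  the level through \<open>(0, b)\<close> have gone beyond \<open>4 \<delta>\<close>.\<close>

lemma level_pair_charges_measure:
  assumes X: "regular_lagrangian_flow \<infinity> (\<lambda>_. field) X" and t: "t > 0"
    and f: "locally_integrable_on UNIV (\<lambda>z. X t z $ 1)"
    and ibp: "\<And>\<phi>. \<phi> \<in> test_functions \<Longrightarrow>
      (\<integral>x. X t x $ 1 * partial_deriv (axis 2 1) \<phi> x \<partial>lebesgue) = - ((\<integral>x. \<phi> x \<partial>\<mu>) - (\<integral>x. \<phi> x \<partial>\<nu>))"
    and \<mu>: "radon_measure \<mu>"
    and \<delta>: "0 < \<delta>" "4 * \<delta> \<le> 1" "crossing_time (4 * \<delta>) < t / 16"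
    and x0: "- 3 * \<delta> \<le> x0" "x0 \<le> - 2 * \<delta>"
    and a: "a > 0" "osc_sq a = 0" and ab: "a < b" and b: "sin (vlog (b\<^sup>2) / 5) = 0" and g: "g < a" "b < g'"
  shows "\<exists>d>0. \<forall>u w. u < w \<and> u \<le> x0 \<and> x0 \<le> w \<and> w - u < d \<longrightarrow>
    4 * \<delta> * exp (- 4 / 3) / (2 * bump_mass) * (w - u)
      \<le> measure \<mu> (strip u w (level x0 (stream 0 g)) (level x0 (stream 0 g')))"
proof -
  obtain da where da: "da > 0" "\<And>Z. trajectory Z \<Longrightarrow> Z 0 $ 1 \<le> - \<delta> \<Longrightarrow>
      \<bar>stream (Z 0 $ 1) (Z 0 $ 2) - stream 0 a\<bar> < da \<Longrightarrow> Z t $ 1 \<le> 0"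
    using trajectory_stuck[OF a t \<delta>(1)] by blast
  have b0: "b > 0" using a ab by simp
  have "\<exists>db>0. \<forall>h. \<bar>h - stream 0 b\<bar> < db \<longrightarrow> fast_level h"
  proof (rule fast_level_near[OF b b0])
    fix d assume "d > 0" "\<And>h. \<bar>h - stream 0 b\<bar> < d \<Longrightarrow> fast_level h"
    then show ?thesis by blast
  qed
  then obtain db where db: "db > 0" "\<And>h. \<bar>h - stream 0 b\<bar> < db \<Longrightarrow> fast_level h" by blast
  define \<eta> where "\<eta> = level x0 (stream 0 a)"
  define \<zeta> where "\<zeta> = level x0 (stream 0 b)"
  define p where "p = level x0 (stream 0 g)"
  define q where "q = level x0 (stream 0 g')"
  have ord: "p < \<eta>" "\<eta> < \<zeta>" "\<zeta> < q"
    using ab g by (simp_all add: \<eta>_def \<zeta>_def p_def q_def less_level_iff)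
  obtain r1 where r1: "r1 > 0" "\<And>x y. \<bar>x - x0\<bar> < r1 \<Longrightarrow> \<bar>y - \<eta>\<bar> < r1 \<Longrightarrow> \<bar>stream x y - stream 0 a\<bar> < da"
    unfolding \<eta>_def using stream_near[OF da(1)] by blast
  obtain r2 where r2: "r2 > 0" "\<And>x y. \<bar>x - x0\<bar> < r2 \<Longrightarrow> \<bar>y - \<zeta>\<bar> < r2 \<Longrightarrow> \<bar>stream x y - stream 0 b\<bar> < db"
    unfolding \<zeta>_def using stream_near[OF db(1)] by blast
  \<comment> \<open>The bound by \<open>\<delta>\<close> keeps the first coordinates between
    \<open>- 4 * \<delta>\<close> and \<open>- \<delta>\<close>, where both crossing estimates
    apply. The gaps to \<open>p\<close> and \<open>q\<close> keep the box of the test function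
    between these two heights.\<close>
  define r where "r = Min {r1, r2, \<eta> - p, q - \<zeta>, \<delta>}"
  have r: "r > 0" "r \<le> r1" "r \<le> r2" "r \<le> \<eta> - p" "r \<le> q - \<zeta>" "r \<le> \<delta>"
    unfolding r_def using r1 r2 ord \<delta> by (simp_all add: min_le_iff_disj)
  show ?thesis
  proof (rule exI[of _ r], rule conjI, rule r(1), intro allI impI)
    fix u w assume uw: "u < w \<and> u \<le> x0 \<and> x0 \<le> w \<and> w - u < r"
    note AE = AE_trajectory[OF X]
    have low: "AE z in lebesgue. u < z $ 1 \<and> z $ 1 < w \<and> \<bar>z $ 2 - \<eta>\<bar> < r \<longrightarrow> X t z $ 1 \<le> 0"
      using AE
    proof eventually_elim
      case (elim z)
      show ?case
      proof
        assume z: "u < z $ 1 \<and> z $ 1 < w \<and> \<bar>z $ 2 - \<eta>\<bar> < r"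
        have "z $ 1 \<le> - \<delta>" using z uw r x0 by linarith
        moreover have "\<bar>stream (z $ 1) (z $ 2) - stream 0 a\<bar> < da" by (rule r1(2)) (use z uw r in linarith)+
        ultimately show "X t z $ 1 \<le> 0" using elim da(2)[of "\<lambda>t. X t z"] by simp
      qed
    qed
    have high: "AE z in lebesgue. u < z $ 1 \<and> z $ 1 < w \<and> \<bar>z $ 2 - \<zeta>\<bar> < r \<longrightarrow> 4 * \<delta> \<le> X t z $ 1"
      using AE
    proof eventually_elim
      case (elim z)
      show ?case
      proof
        assume z: "u < z $ 1 \<and> z $ 1 < w \<and> \<bar>z $ 2 - \<zeta>\<bar> < r"
        have "- (4 * \<delta>) \<le> z $ 1" using z uw r x0 by linarith
        moreover have "\<bar>stream (z $ 1) (z $ 2) - stream 0 b\<bar> < db" by (rule r2(2)) (use z uw r in linarith)+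
        then have "fast_level (stream (z $ 1) (z $ 2))" by (rule db(2))
        ultimately show "4 * \<delta> \<le> X t z $ 1" using elim trajectory_passes[of "\<lambda>t. X t z" "4 * \<delta>" t] \<delta> t by simp
      qed
    qed
    have "4 * \<delta> * exp (- 4 / 3) / (2 * bump_mass) * (w - u) \<le> measure \<mu> (box (vec2 u (\<eta> - r)) (vec2 w (\<zeta> + r)))"
      using uw \<delta> by (intro oscillation_charges_measure[OF f ibp \<mu> _ r(1) ord(2) _ low high]) auto
    also have "\<dots> \<le> measure \<mu> (strip u w p q)"
      using r by (intro measure_strip_mono[OF \<mu>]) (auto simp: strip_def mem_box Basis_real2)
    finally show "4 * \<delta> * exp (- 4 / 3) / (2 * bump_mass) * (w - u) \<le> measure \<mu> (strip u w (level x0 (stream 0 g)) (level x0 (stream 0 g')))"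
      by (simp add: p_def q_def)
  qed
qed

lemma flow_not_BV:
  assumes X: "regular_lagrangian_flow \<infinity> (\<lambda>_. field) X" and t: "t > 0"
  shows "X t \<notin> BV_loc"
proof
  assume BV: "X t \<in> BV_loc"
  have e: "(axis 1 1 :: real^2) \<in> Basis" "(axis 2 1 :: real^2) \<in> Basis" by (auto simp: Basis_real2)
  have lX: "locally_integrable_on UNIV (X t)" using BV by (simp add: BV_loc_def)
  from BV have "\<forall>i\<in>Basis. \<forall>j\<in>Basis. \<exists>\<mu> \<nu>. radon_measure \<mu> \<and> radon_measure \<nu> \<and>
        (\<forall>\<phi>\<in>test_functions. (\<integral>x. (X t x \<bullet> j) * partial_deriv i \<phi> x \<partial>lebesgue) = - ((\<integral>x. \<phi> x \<partial>\<mu>) - (\<integral>x. \<phi> x \<partial>\<nu>)))"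
    by (simp add: BV_loc_def)
  from this[rule_format, OF e(2,1)] obtain \<mu> \<nu> where \<mu>: "radon_measure \<mu>"
    and ibp: "\<And>\<phi>. \<phi> \<in> test_functions \<Longrightarrow>
      (\<integral>x. X t x $ 1 * partial_deriv (axis 2 1) \<phi> x \<partial>lebesgue) = - ((\<integral>x. \<phi> x \<partial>\<mu>) - (\<integral>x. \<phi> x \<partial>\<nu>))"
    unfolding inner_axis2 by blast
  have f: "locally_integrable_on UNIV (\<lambda>z. X t z $ 1)"
    unfolding locally_integrable_on_def set_integrable_def
  proof (intro allI impI)
    fix K :: "(real^2) set" assume "compact K \<and> K \<subseteq> UNIV"
    then have "integrable lebesgue (\<lambda>z. indicator K z *\<^sub>R X t z)"
      using lX by (simp add: locally_integrable_on_def set_integrable_def)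
    then have "integrable lebesgue (\<lambda>z. (indicator K z *\<^sub>R X t z) \<bullet> axis 1 1)" by (rule integrable_inner_left)
    then show "integrable lebesgue (\<lambda>z. indicator K z *\<^sub>R X t z $ 1)" by simp
  qed
  \<comment> \<open>\<open>4 * \<delta>\<close> is at most 1, as \<open>trajectory_passes\<close>
    requires, and its crossing time is at most \<open>t / 32\<close>. The quarter leaves a margin of
    \<open>\<delta>\<close> on either side of the interval from \<open>- 3 * \<delta>\<close> to
    \<open>- 2 * \<delta>\<close>.\<close>
  define \<delta> where "\<delta> = min 1 (exp (- 1 / (t / 32))) / 4"
  have \<delta>4: "4 * \<delta> = min 1 (exp (- 1 / (t / 32)))" by (simp add: \<delta>_def)
  have \<delta>: "0 < \<delta>" "4 * \<delta> \<le> 1" unfolding \<delta>4 by (simp_all add: \<delta>_def)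
  have "\<bar>crossing_time (4 * \<delta>)\<bar> \<le> t / 32" unfolding \<delta>4 by (rule crossing_time_small) (use t in auto)
  moreover have "t / 32 < t / 16" using t by simp
  ultimately have \<delta>t: "crossing_time (4 * \<delta>) < t / 16" by linarith
  define c where "c = 4 * \<delta> * exp (- 4 / 3) / (2 * bump_mass)"
  have c: "c > 0" using \<delta> bump_mass_pos by (simp add: c_def)
  \<comment> \<open>\<open>sep (Suc k) < a k < b k < sep k\<close>, so the strips between consecutive separators are disjoint.\<close>
  define sep where "sep = (\<lambda>k::nat. vlog_height (5 * (pi * (real k + 3 / 4 + 1))))"
  define a where "a = (\<lambda>k::nat. vlog_height (5 * (pi * (real k + 1 / 2 + 2))))"
  define b where "b = (\<lambda>k::nat. vlog_height (5 * (pi * (real k + 2))))"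
  \<comment> \<open>In multiples of \<open>pi\<close>, the phases
    \<open>vlog (y\<^sup>2) / 5\<close> of \<open>sep k\<close>, \<open>b k\<close>,
    \<open>a k\<close> and \<open>sep (Suc k)\<close> are \<open>k + 7/4\<close>,
    \<open>k + 2\<close>, \<open>k + 5/2\<close> and \<open>k + 11/4\<close>; a larger phase is a
    smaller height. The sine vanishes at \<open>b k\<close>, the cosine at
    \<open>a k\<close>.\<close>
  have h: "sep (Suc k) < a k" "a k < b k" "b k < sep k" "sep k > 0" "a k > 0" for k
    unfolding sep_def a_def b_def by (rule vlog_height_less vlog_height_pos; simp add: add_nonneg_pos)+
  have ma: "osc_sq (a k) = 0" for k
  proof -
    have "vlog ((a k)\<^sup>2) = 5 * (pi * (real k + 1 / 2 + 2))" unfolding a_def by (rule vlog_of_vlog_height) (intro mult_pos_pos; simp)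
    moreover have "5 * (pi * (real k + 1 / 2 + 2)) / 5 = pi * real (k + 2) + pi / 2" by (simp add: field_simps)
    ultimately have "cos (vlog ((a k)\<^sup>2) / 5) = cos (pi * real (k + 2) + pi / 2)" by metis
    also have "\<dots> = 0" by (simp only: cos_add sin_npi2 cos_pi_half)
    finally show ?thesis by (simp add: osc_sq_def)
  qed
  have sb: "sin (vlog ((vlog_height (5 * (pi * real (Suc k))))\<^sup>2) / 5) = 0" for k
  proof -
    have "vlog ((vlog_height (5 * (pi * real (Suc k))))\<^sup>2) = 5 * (pi * real (Suc k))" by (rule vlog_of_vlog_height) simp
    then show ?thesis using sin_npi2[of "Suc k"] by (simp del: of_nat_Suc)
  qed
  have b_eq: "b k = vlog_height (5 * (pi * real (Suc (Suc k))))" for k by (simp add: b_def add.commute)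
  have step: "\<exists>d>0. \<forall>u w. u < w \<and> u \<le> x0 \<and> x0 \<le> w \<and> w - u < d \<longrightarrow>
      c * (w - u) \<le> measure \<mu> (strip u w (level x0 (stream 0 (sep (Suc k)))) (level x0 (stream 0 (sep k))))"
    if x0: "- 3 * \<delta> \<le> x0" "x0 \<le> - 2 * \<delta>" for x0 k
    unfolding c_def
    by (rule level_pair_charges_measure[OF X t f ibp \<mu> \<delta> \<delta>t x0 h(5) ma h(2) sb[of "Suc k", folded b_eq] h(1) h(3)])
  \<comment> \<open>Only finitely many pairs are summed at a time, so the smallest of their widths
    \<open>d\<close> is still positive.\<close>
  have accum: "\<exists>d>0. \<forall>u w. u < w \<and> u \<le> x0 \<and> x0 \<le> w \<and> w - u < d \<longrightarrow>
      real n * c * (w - u) \<le> measure \<mu> (strip u w (level x0 (stream 0 (sep n))) (level x0 (stream 0 (sep 0))))"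
    if x0: "- 3 * \<delta> \<le> x0" "x0 \<le> - 2 * \<delta>" for x0 n
  proof (induction n)
    case 0
    show ?case by (intro exI[of _ 1]) simp
  next
    case (Suc n)
    then obtain d1 where d1: "d1 > 0" "\<And>u w. u < w \<and> u \<le> x0 \<and> x0 \<le> w \<and> w - u < d1 \<Longrightarrow>
      real n * c * (w - u) \<le> measure \<mu> (strip u w (level x0 (stream 0 (sep n))) (level x0 (stream 0 (sep 0))))" by blast
    obtain d2 where d2: "d2 > 0" "\<And>u w. u < w \<and> u \<le> x0 \<and> x0 \<le> w \<and> w - u < d2 \<Longrightarrow>
      c * (w - u) \<le> measure \<mu> (strip u w (level x0 (stream 0 (sep (Suc n)))) (level x0 (stream 0 (sep n))))"
      using step[OF x0, of n] by blast
    have dec: "sep (Suc k) < sep k" for k using h(1-3)[of k] by linarith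
    have "decseq sep" by (intro decseq_SucI less_imp_le dec)
    then have "sep n \<le> sep 0" by (rule decseqD) simp
    then have "stream 0 (sep n) \<le> stream 0 (sep 0)" by (rule stream_mono)
    then have l1: "level x0 (stream 0 (sep n)) \<le> level x0 (stream 0 (sep 0))"
      by (rule level_mono)
    have l2: "level x0 (stream 0 (sep (Suc n))) \<le> level x0 (stream 0 (sep n))"
      using dec[of n] by (intro level_mono stream_mono) simp
    show ?case
    proof (intro exI[of _ "min d1 d2"] conjI allI impI)
      show "min d1 d2 > 0" using d1 d2 by simp
      fix u w assume uw: "u < w \<and> u \<le> x0 \<and> x0 \<le> w \<and> w - u < min d1 d2"
      have "measure \<mu> (strip u w (level x0 (stream 0 (sep (Suc n)))) (level x0 (stream 0 (sep 0))))
        = measure \<mu> (strip u w (level x0 (stream 0 (sep (Suc n)))) (level x0 (stream 0 (sep n))))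
         + measure \<mu> (strip u w (level x0 (stream 0 (sep n))) (level x0 (stream 0 (sep 0))))"
        by (rule measure_strip_split[OF \<mu>]) (use l1 l2 in \<open>auto simp: strip_def\<close>)
      moreover have "real (Suc n) * c * (w - u) = real n * c * (w - u) + c * (w - u)" by (simp add: algebra_simps)
      ultimately show "real (Suc n) * c * (w - u) \<le>
        measure \<mu> (strip u w (level x0 (stream 0 (sep (Suc n)))) (level x0 (stream 0 (sep 0))))"
        using d1(2)[of u w] d2(2)[of u w] uw by simp
    qed
  qed
  \<comment> \<open>The phase of \<open>sep 0\<close> is \<open>7 * pi / 4\<close>, which leaves the
    maximum \<open>b0\<close> with phase \<open>pi\<close> above all separators. As
    \<open>b0 \<le> 1\<close>, the level line through it bounds every strip by 6.\<close>
  have top: "level x0 (stream 0 (sep 0)) \<le> 6" if "\<bar>x0\<bar> \<le> 1" for x0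
  proof -
    define b0 where "b0 = vlog_height (5 * (pi * real (Suc 0)))"
    have "1 \<le> 5 * (pi * real (Suc 0))" using pi_ge_two by simp
    then have b0: "b0 > 0" "b0 \<le> 1" unfolding b0_def by (auto intro!: vlog_height_pos vlog_height_le_1)
    have "sin (vlog (b0\<^sup>2) / 5) = 0" unfolding b0_def by (rule sb)
    then have "level x0 (stream 0 b0) \<le> max \<bar>x0\<bar> (6 * b0)"
    proof (rule fast_level_near[OF _ b0(1)])
      fix d assume "d > 0" "\<And>h x y. \<bar>h - stream 0 b0\<bar> < d \<Longrightarrow> stream x y = h \<Longrightarrow> y \<le> max \<bar>x\<bar> (6 * b0)"
      from this(2)[of "stream 0 b0" x0 "level x0 (stream 0 b0)"] this(1) show ?thesis by simp
    qed
    moreover have "sep 0 < b0" unfolding sep_def b0_def by (rule vlog_height_less) auto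
    then have "level x0 (stream 0 (sep 0)) < level x0 (stream 0 b0)" by (simp add: less_level_iff)
    ultimately show ?thesis using that b0 by linarith
  qed
  have bottom: "0 \<le> level x0 (stream 0 (sep n))" for x0 n
    using h(4)[of n] stream_strict_mono[of 0 "sep n" 0] by (simp add: less_imp_le less_level_iff)
  let ?F = "\<lambda>u w. measure \<mu> (strip u w 0 6)"
  have big: "real n * c * \<delta> \<le> ?F (- 3 * \<delta>) (- 2 * \<delta>)" for n
  proof -
    \<comment> \<open>The width \<open>d\<close> in \<open>accum\<close> depends on
      \<open>x0\<close>, with no uniform lower bound at hand. Bisection makes up for this, since
      both sides are additive over adjacent intervals.\<close>
    have "real n * c * (- 2 * \<delta> - - 3 * \<delta>) \<le> ?F (- 3 * \<delta>) (- 2 * \<delta>)"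
    proof (rule Bolzano[where P="\<lambda>u w. real n * c * (w - u) \<le> ?F u w"])
      show "- 3 * \<delta> \<le> - 2 * \<delta>" using \<delta> by simp
    next
      fix u v w assume 1: "real n * c * (v - u) \<le> ?F u v" and 2: "real n * c * (w - v) \<le> ?F v w"
        and le: "u \<le> v" "v \<le> w"
      have "?F u w = ?F u v + ?F v w" by (rule measure_strip_split[OF \<mu>]) (use le in \<open>auto simp: strip_def\<close>)
      moreover have "real n * c * (w - u) = real n * c * (v - u) + real n * c * (w - v)" by (simp add: algebra_simps)
      ultimately show "real n * c * (w - u) \<le> ?F u w" using 1 2 by simp
    next
      fix x0 assume x0: "- 3 * \<delta> \<le> x0" "x0 \<le> - 2 * \<delta>"
      obtain d where d: "d > 0" "\<And>u w. u < w \<and> u \<le> x0 \<and> x0 \<le> w \<and> w - u < d \<Longrightarrow>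
        real n * c * (w - u) \<le> measure \<mu> (strip u w (level x0 (stream 0 (sep n))) (level x0 (stream 0 (sep 0))))"
        using accum[OF x0, of n] by blast
      have x01: "\<bar>x0\<bar> \<le> 1" using x0 \<delta> by linarith
      show "\<exists>d>0. \<forall>u w. u \<le> x0 \<and> x0 \<le> w \<and> w - u < d \<longrightarrow> real n * c * (w - u) \<le> ?F u w"
      proof (intro exI[of _ d] conjI allI impI)
        fix u w assume uw: "u \<le> x0 \<and> x0 \<le> w \<and> w - u < d"
        show "real n * c * (w - u) \<le> ?F u w"
        proof (cases "u = w")
          case False
          then have "real n * c * (w - u) \<le> measure \<mu> (strip u w (level x0 (stream 0 (sep n))) (level x0 (stream 0 (sep 0))))"
            using d(2)[of u w] uw by simp
          also have "\<dots> \<le> ?F u w"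
            using strip_fmeasurable[OF \<mu>] \<mu> top[OF x01] bottom[of x0 n]
            by (intro measure_mono_fmeasurable) (auto simp: strip_def dest: fmeasurableD)
          finally show ?thesis .
        qed simp
      qed (rule d(1))
    qed
    then show ?thesis by (simp add: algebra_simps)
  qed
  obtain n :: nat where "?F (- 3 * \<delta>) (- 2 * \<delta>) / (c * \<delta>) < real n"
    using reals_Archimedean2 by blast
  then have "?F (- 3 * \<delta>) (- 2 * \<delta>) < real n * (c * \<delta>)"
    using c \<delta> by (simp add: pos_divide_less_eq)
  then show False using big[of n] by (simp add: mult.assoc)
qed

theorem proposition1p5:
  shows "\<exists>b :: real^2 \<Rightarrow> real^2.
    bounded (range b) \<and>
    divergence_free b \<and>
    (\<forall>p\<ge>1. b \<in> W1p_loc p) \<and>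
    (AE z in lebesgue. b z \<bullet> axis 1 1 > 0) \<and>
    (\<exists>X. regular_lagrangian_flow \<infinity> (\<lambda>_. b) X) \<and>
    (\<forall>X. regular_lagrangian_flow \<infinity> (\<lambda>_. b) X \<longrightarrow>
       (\<forall>t>0. X t \<notin> BV_loc))"
proof (intro exI[of _ field] conjI allI impI)
  show "bounded (range field)" using field_bounded by (intro boundedI) auto
  show "\<exists>X. regular_lagrangian_flow \<infinity> (\<lambda>_. field) X" by (rule exI[of _ flow], rule field_flow_exists)
qed (simp_all add: field_divergence_free field_in_W1p AE_field_pos flow_not_BV del: inner_axis2)

end
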